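(* Let $s$ be a composition. The map $(w,A)\mapsto\Delta_{(w,A)}$ induces a poset isomorphism between the face poset of the $s$-permutahedron and the set of interior simplices of the DKK triangulation of $\mathcal F_{\mathcal O(s)}(\mathbf i)$ ordered by reverse inclusion.
   Context: $s=(s_1,\dots,s_n)$ positive integers, $|s|=\sum s_i$, $s_{n+1}:=2$. Stirling $s$-permutations: rearrangements of $1^{s_1}\cdots n^{s_n}$ avoiding $121$. $B_a$ ($a$-block) is the shortest factor containing all $a$'s; for $a<c$, $|(c,a)_w|$ = number of $c$'s before $B_a$; $s$-weak order: $w\le w'$ iff $|(c,a)_w|\le|(c,a)_{w'}|$ for all $a<c$ (a lattice). An ascent of $w$ is a pair $(a,c)$, $a<c$, with $ac$ a factor of $w$; then $w=u_1B_acu_2$ and the transposition of $w$ along $(a,c)$ is $u_1cB_au_2$. For a set $A$ of ascents of $w$, $w+A$ is the join of $w$ and all transpositions of $w$ along elements of $A$. The $s$-permutahedron is the combinatorial complex whose faces are pairs $(w,A)$, $A$ a set of ascents of $w$, with $(w,A)$ contained in $(w',A')$ iff the interval $[w,w+A]\subseteq[w',w'+A']$. Graph $\mathcal O(s)$: vertices $v_{-1},\dots,v_n$; source edges $e^i_1,\dots,e^i_{s_i-1}$ from $v_{-1}$ to $v_{n+1-i}$ ($i\in[n+1]$); bump $e^i_0$ and dip $e^i_{s_i}$ from $v_{n-i}$ to $v_{n+1-i}$ ($i\in[n]$); framing: incoming at $v_{n+1-i}$: $e^i_0\prec e^i_1\prec\cdots\prec e^i_{s_i}$, outgoing at $v_{n+1-i}$: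 $e^{i-1}_0\prec e^{i-1}_{s_{i-1}}$. Routes: paths $v_{-1}\to v_n$; $R(k,t,\delta)$ has edges $e^k_t,e^{k-1}_{\delta_{k-1}s_{k-1}},\dots,e^1_{\delta_1 s_1}$. $P,Q$ coherent: on every maximal common subpath $v_a\cdots v_b$ ($v_a\ne v_{-1}$, $v_b\ne v_n$), $P$'s entering edge at $v_a$ precedes $Q$'s iff $P$'s leaving edge at $v_b$ precedes $Q$'s. $\mathcal F_{\mathcal O(s)}(\mathbf i)=\mathrm{conv}\{\mathbf 1_R\}$ (unit flows); its DKK triangulation consists of simplices $\mathrm{conv}\{\mathbf 1_R:R\in C\}$, $C$ pairwise coherent; a simplex is interior if not contained in the boundary of $\mathcal F_{\mathcal O(s)}(\mathbf i)$. For a prefix $u$: $t_a$ = number of $a$'s in $u$, $c$ least $a$ with $0<t_a<s_a$ (else $c=n+1,t_{n+1}=1$), $R[u]:=R(c,t_c,(t_1/s_1,\dots,t_{c-1}/s_{c-1}))$; $\Delta_w:=\{R[w_{[i]}]:0\le i\le|s|\}$, identified with its simplex. $\Delta_{(w,A)}:=\bigcap_{(a,c)\in A}(\Delta_w\cap\Delta_{w'_{(a,c)}})$ where $w'_{(a,c)}$ is the transposition of $w$ along $(a,c)$, and $\Delta_{(w,\emptyset)}:=\Delta_w$. *)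

theory Defs
  imports
    "HOL-Analysis.Analysis"
    "HOL-Library.Multiset"
    "HOL-Library.Sublist"
    "HOL-Analysis.Finite_Function_Topology"
    "Graph_Theory.Arc_Walk"
begin

text \<open>
  A composition \<open>s = (s_1, ..., s_n)\<close> is a \<^typ>\<open>nat list\<close> of length \<open>n\<close> with positive entries.
  Its parts are indexed from 1, and \<open>s_{n+1} = 2\<close> by convention.
\<close>

definition part :: "nat list \<Rightarrow> nat \<Rightarrow> nat" where
  "part s i = (s @ [2]) ! (i - 1)"


section \<open>Stirling permutations and the weak order\<close>

definition stirling_perms :: "nat list \<Rightarrow> nat list set" where
  "stirling_perms s =
     {w. mset w = (\<Sum>a = 1..length s. replicate_mset (part s a) a) \<and>
         \<not> (\<exists>a b. a < b \<and> subseq [a, b, a] w)}"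

text \<open>
  If \<open>a\<close> occurs in \<open>w\<close>, then \<open>w = before a w @ block a w @ after a w\<close>, where the block starts with
  the first and ends with the last occurrence of \<open>a\<close>.
\<close>

definition before :: "nat \<Rightarrow> nat list \<Rightarrow> nat list" where
  "before a w = takeWhile (\<lambda>x. x \<noteq> a) w"

definition block :: "nat \<Rightarrow> nat list \<Rightarrow> nat list" where
  "block a w = rev (dropWhile (\<lambda>x. x \<noteq> a) (rev (dropWhile (\<lambda>x. x \<noteq> a) w)))"

definition after :: "nat \<Rightarrow> nat list \<Rightarrow> nat list" where
  "after a w = rev (takeWhile (\<lambda>x. x \<noteq> a) (rev w))"

definition inversions :: "nat list \<Rightarrow> nat \<Rightarrow> nat \<Rightarrow> nat" where
  "inversions w c a = count_list (before a w) c"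

definition weak_le :: "nat list \<Rightarrow> nat list \<Rightarrow> nat list \<Rightarrow> bool" where
  "weak_le s w w' \<longleftrightarrow>
     (\<forall>a c. 1 \<le> a \<and> a < c \<and> c \<le> length s \<longrightarrow> inversions w c a \<le> inversions w' c a)"

definition weak_interval :: "nat list \<Rightarrow> nat list \<Rightarrow> nat list \<Rightarrow> nat list set" where
  "weak_interval s x z = {y \<in> stirling_perms s. weak_le s x y \<and> weak_le s y z}"

definition weak_join :: "nat list \<Rightarrow> nat list set \<Rightarrow> nat list" where
  "weak_join s X =
     (THE z. z \<in> stirling_perms s \<and> (\<forall>x\<in>X. weak_le s x z) \<and>
             (\<forall>y\<in>stirling_perms s. (\<forall>x\<in>X. weak_le s x y) \<longrightarrow> weak_le s z y))"

definition ascents :: "nat list \<Rightarrow> (nat \<times> nat) set" where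
  "ascents w = {(a, c). a < c \<and> sublist [a, c] w}"

text \<open>
  For a Stirling permutation \<open>w\<close> with ascent \<open>(a, c)\<close>, the \<open>a\<close> of the factor \<open>ac\<close> is the last one
  (otherwise \<open>aca\<close> would occur), so \<open>after a w = c # u2\<close>.
\<close>

definition transposition :: "nat list \<Rightarrow> nat \<times> nat \<Rightarrow> nat list" where
  "transposition w = (\<lambda>(a, c). before a w @ [c] @ block a w @ tl (after a w))"

definition add_ascents :: "nat list \<Rightarrow> nat list \<Rightarrow> (nat \<times> nat) set \<Rightarrow> nat list" where
  "add_ascents s w A = weak_join s (insert w (transposition w ` A))"


section \<open>The permutahedron as a combinatorial complex\<close>

definition faces :: "nat list \<Rightarrow> (nat list \<times> (nat \<times> nat) set) set" where
  "faces s = {(w, A). w \<in> stirling_perms s \<and> A \<subseteq> ascents w}"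

definition face_le ::
  "nat list \<Rightarrow> nat list \<times> (nat \<times> nat) set \<Rightarrow> nat list \<times> (nat \<times> nat) set \<Rightarrow> bool" where
  "face_le s = (\<lambda>(w, A) (w', A').
     weak_interval s w (add_ascents s w A) \<subseteq> weak_interval s w' (add_ascents s w' A'))"


section \<open>The framed graph and its coherent routes\<close>

text \<open>
  The vertex \<open>v_j\<close> is the integer \<open>j\<close>, and the edge \<open>e^i_t\<close> is the pair \<open>(i, t)\<close>.
\<close>

definition oruga :: "nat list \<Rightarrow> (int, nat \<times> nat) pre_digraph" where
  "oruga s =
     \<lparr> verts = {- 1 .. int (length s)},
       arcs = {(i, t). 1 \<le> i \<and> i \<le> length s + 1 \<and> 1 \<le> t \<and> t < part s i} \<union>
              {(i, t). 1 \<le> i \<and> i \<le> length s \<and> (t = 0 \<or> t = part s i)},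
       tail = (\<lambda>(i, t). if 1 \<le> t \<and> t < part s i then - 1 else int (length s) - int i),
       head = (\<lambda>(i, t). int (length s) + 1 - int i) \<rparr>"

definition framing_in :: "nat list \<Rightarrow> ((nat \<times> nat) \<times> (nat \<times> nat)) set" where
  "framing_in s = {((i, t), (i, t')) | i t t'.
     (i, t) \<in> arcs (oruga s) \<and> (i, t') \<in> arcs (oruga s) \<and> t < t'}"

definition framing_out :: "nat list \<Rightarrow> ((nat \<times> nat) \<times> (nat \<times> nat)) set" where
  "framing_out s = {((i, 0), (i, part s i)) | i. 1 \<le> i \<and> i \<le> length s}"

definition routes :: "nat list \<Rightarrow> (nat \<times> nat) list set" where
  "routes s = {p. pre_digraph.apath (oruga s) (- 1) p (int (length s))}"

text \<open>
  Below, \<open>m\<close> ranges over the maximal common subpaths of \<open>p\<close> and \<open>q\<close> that neither start at the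
  source nor end at the sink, including the single vertices (\<open>m = []\<close>). Here \<open>e\<close>, \<open>f\<close> are the
  edges by which \<open>p\<close>, \<open>q\<close> enter it, and \<open>e'\<close>, \<open>f'\<close> those by which they leave it. Maximality
  means \<open>e \<noteq> f\<close> and \<open>e' \<noteq> f'\<close>; such edges may still be parallel.
\<close>

definition coherent :: "nat list \<Rightarrow> (nat \<times> nat) list \<Rightarrow> (nat \<times> nat) list \<Rightarrow> bool" where
  "coherent s p q \<longleftrightarrow>
     (\<forall>p1 p2 q1 q2 m e e' f f'.
        p = p1 @ [e] @ m @ [e'] @ p2 \<and> q = q1 @ [f] @ m @ [f'] @ q2 \<and>
        head (oruga s) e = head (oruga s) f \<and> tail (oruga s) e' = tail (oruga s) f' \<and>
        e \<noteq> f \<and> e' \<noteq> f' \<longrightarrow>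
        ((e, f) \<in> framing_in s \<longleftrightarrow> (e', f') \<in> framing_out s))"


section \<open>The flow polytope and its triangulation\<close>

text \<open>
  Flows are elements of the free real vector space on edge labels, normed by the sum of the
  absolute values; all of them are supported on the finite set of edges of the graph.
\<close>

definition route_vector :: "(nat \<times> nat) list \<Rightarrow> (nat \<times> nat) \<Rightarrow>\<^sub>0 real" where
  "route_vector p = (\<Sum>e\<in>set p. Poly_Mapping.single e 1)"

definition flow_polytope :: "nat list \<Rightarrow> ((nat \<times> nat) \<Rightarrow>\<^sub>0 real) set" where
  "flow_polytope s = convex hull (route_vector ` routes s)"

definition dkk_triangulation :: "nat list \<Rightarrow> ((nat \<times> nat) \<Rightarrow>\<^sub>0 real) set set" where
  "dkk_triangulation s =
     {convex hull (route_vector ` C) | C.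
        C \<noteq> {} \<and> C \<subseteq> routes s \<and> (\<forall>p\<in>C. \<forall>q\<in>C. coherent s p q)}"

text \<open>
  The polytope is not full-dimensional in the space of all edge weights, so its boundary is
  the relative one.
\<close>

definition interior_simplices :: "nat list \<Rightarrow> ((nat \<times> nat) \<Rightarrow>\<^sub>0 real) set set" where
  "interior_simplices s =
     {\<sigma> \<in> dkk_triangulation s. \<not> \<sigma> \<subseteq> rel_frontier (flow_polytope s)}"


section \<open>The simplices attached to faces\<close>

text \<open>The route \<open>R(k, t, \<delta>)\<close>, with \<open>\<delta>\<close> taking values in \<open>{0, 1}\<close>.\<close>

definition route :: "nat list \<Rightarrow> nat \<Rightarrow> nat \<Rightarrow> (nat \<Rightarrow> nat) \<Rightarrow> (nat \<times> nat) list" where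
  "route s k t \<delta> = (k, t) # map (\<lambda>i. (i, \<delta> i * part s i)) (rev [1..<k])"

definition prefix_count :: "nat list \<Rightarrow> nat list \<Rightarrow> nat \<Rightarrow> nat" where
  "prefix_count s u a = (if a = length s + 1 then 1 else count_list u a)"

text \<open>
  Since \<open>s_{n+1} = 2\<close> and \<open>t_{n+1} = 1\<close>, the minimum is \<open>n + 1\<close> exactly when no \<open>a \<le> n\<close>
  satisfies \<open>0 < t_a < s_a\<close>.
\<close>

definition prefix_pivot :: "nat list \<Rightarrow> nat list \<Rightarrow> nat" where
  "prefix_pivot s u =
     (LEAST a. 1 \<le> a \<and> a \<le> length s + 1 \<and> 0 < prefix_count s u a \<and> prefix_count s u a < part s a)"

text \<open>
  The integer division is exact: below the pivot, \<open>t_i\<close> is 0 or \<open>s_i\<close>.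
\<close>

definition prefix_route :: "nat list \<Rightarrow> nat list \<Rightarrow> (nat \<times> nat) list" where
  "prefix_route s u =
     route s (prefix_pivot s u) (prefix_count s u (prefix_pivot s u))
       (\<lambda>i. prefix_count s u i div part s i)"

definition perm_simplex :: "nat list \<Rightarrow> nat list \<Rightarrow> ((nat \<times> nat) \<Rightarrow>\<^sub>0 real) set" where
  "perm_simplex s w =
     convex hull (route_vector ` {prefix_route s (take i w) | i. i \<le> sum_list s})"

definition face_simplex ::
  "nat list \<Rightarrow> nat list \<times> (nat \<times> nat) set \<Rightarrow> ((nat \<times> nat) \<Rightarrow>\<^sub>0 real) set" where
  "face_simplex s = (\<lambda>(w, A).
     if A = {} then perm_simplex s w
     else (\<Inter>x\<in>A. perm_simplex s w \<inter> perm_simplex s (transposition w x)))"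

end

theory Submission
  imports Defs
begin

text \<open>
  A route uses exactly one edge \<open>(i, t)\<close> for each \<open>i \<le> k\<close>, where \<open>k\<close> is its length. Reading \<open>t\<close> as
  a number of letters \<open>i\<close>, two routes are coherent iff these numbers are comparable, all in the
  same direction, for the \<open>i\<close> that both routes reach. Coherent decompositions of flows are unique,
  so simplices intersect in the hull of their common routes; a simplex is interior iff its routes
  cover all edges of the graph.

  A coherent set \<open>C\<close> that covers all edges bounds inversion numbers: for \<open>a < c\<close> let \<open>lo C c a\<close> be
  the largest number of letters \<open>c\<close> in a route that avoids \<open>a\<close>, and \<open>hi C c a\<close> the smallest one in
  a route that uses up \<open>a\<close>. Then \<open>C\<close> consists of routes of \<open>w\<close> iff the inversion numbers of \<open>w\<close> lie
  between \<open>lo C\<close> and \<open>hi C\<close>, and both bounds are the inversion numbers of Stirling permutations.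
  Hence the permutations whose simplex contains \<open>C\<close> form an interval of the weak order. For a face
  \<open>(w, A)\<close>, whose routes are those of \<open>w\<close> except one for each ascent in \<open>A\<close>, this interval is
  \<open>[w, w + A]\<close>. Conversely, \<open>C\<close> misses only ascent routes of the bottom of its interval, so it comes
  from a face.
\<close>

subsection \<open>Words\<close>

text \<open>The join in \<open>add_ascents\<close> is a definite description, so a least upper bound
  has to be exhibited. The candidate is the permutation with inversion numbers \<open>hi C\<close>.
  That it lies below every upper bound \<open>y\<close> is the hard point: \<open>y\<close> is only
  known to dominate \<open>w\<close> and each transposition separately, whereas
  \<open>hi C c a\<close> may be raised by a whole sequence of ascents and nested blocks leading
  from \<open>a\<close> to \<open>c\<close>. What helps is that \<open>hi\<close> exceeds
  \<open>lo\<close> by at most one, so a single strict inequality has to be carried along that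
  sequence.

  Two properties of words do most of the work. A vector of letter counts belongs to a prefix as soon
  as it is compatible with the inversion numbers; this identifies the routes of a permutation, shows
  that inversion numbers determine it, and places the blocks when a word is built from prescribed
  numbers. And a block that is open at a cut has no larger letter next to the cut; hence the route
  of a prefix, though it ends at its pivot, still records the letter that ends the prefix.\<close>

definition nested :: "nat list \<Rightarrow> bool" where
  "nested w \<longleftrightarrow> (\<forall>u y v x. w = u @ y # v \<longrightarrow> x < y \<longrightarrow> x \<in> set u \<longrightarrow> x \<notin> set v)"

lemma subseq_pair: "subseq [x, y] w \<longleftrightarrow> (\<exists>u v. w = u @ y # v \<and> x \<in> set u)"
proof
  assume "subseq [x, y] w"
  then show "\<exists>u v. w = u @ y # v \<and> x \<in> set u"
  proof (induction w rule: list.induct)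
    case Nil
    then show ?case by simp
  next
    case (Cons z w)
    show ?case
    proof (cases "z = x")
      case True
      with Cons.prems have "y \<in> set w"
        by (simp add: subseq_singleton_left)
      then obtain u v where "w = u @ y # v" by (meson split_list)
      with True show ?thesis by (intro exI[of _ "z # u"] exI[of _ v]) auto
    next
      case False
      with Cons.prems have "subseq [x, y] w" by simp
      with Cons.IH obtain u v where "w = u @ y # v" "x \<in> set u" by blast
      then show ?thesis by (intro exI[of _ "z # u"] exI[of _ v]) auto
    qed
  qed
next
  assume "\<exists>u v. w = u @ y # v \<and> x \<in> set u"
  then obtain u v where w: "w = u @ y # v" and "x \<in> set u" by blast
  then have "subseq ([x] @ [y]) (u @ (y # v))"
    by (intro list_emb_append_mono) (auto simp: subseq_singleton_left)
  with w show "subseq [x, y] w" by simp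
qed

lemma subseq_triple: "subseq [x, y, z] w \<longleftrightarrow> (\<exists>u v. w = u @ y # v \<and> x \<in> set u \<and> z \<in> set v)"
proof
  assume "subseq [x, y, z] w"
  then show "\<exists>u v. w = u @ y # v \<and> x \<in> set u \<and> z \<in> set v"
  proof (induction w rule: list.induct)
    case Nil
    then show ?case by simp
  next
    case (Cons t w)
    show ?case
    proof (cases "t = x")
      case True
      with Cons.prems have "subseq [y, z] w" by simp
      then obtain p q where w: "w = p @ z # q" "y \<in> set p"
        unfolding subseq_pair by blast
      then obtain p1 p2 where "p = p1 @ y # p2" by (meson split_list)
      with True w show ?thesis
        by (intro exI[of _ "t # p1"] exI[of _ "p2 @ z # q"]) auto
    next
      case False
      with Cons.prems have "subseq [x, y, z] w" by simp
      with Cons.IH obtain u v where "w = u @ y # v" "x \<in> set u" "z \<in> set v" by blast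
      then show ?thesis by (intro exI[of _ "t # u"] exI[of _ v]) auto
    qed
  qed
next
  assume "\<exists>u v. w = u @ y # v \<and> x \<in> set u \<and> z \<in> set v"
  then obtain u v where w: "w = u @ y # v" and "x \<in> set u" "z \<in> set v" by blast
  then have "subseq ([x] @ [y, z]) (u @ (y # v))"
    by (intro list_emb_append_mono) (auto simp: subseq_singleton_left)
  with w show "subseq [x, y, z] w" by simp
qed

lemma nested_iff_subseq: "nested w \<longleftrightarrow> \<not> (\<exists>a b. a < b \<and> subseq [a, b, a] w)"
  unfolding nested_def subseq_triple by blast

lemma nestedD: "nested w \<Longrightarrow> w = u @ y # v \<Longrightarrow> x < y \<Longrightarrow> x \<in> set u \<Longrightarrow> x \<notin> set v"
  unfolding nested_def by blast

text \<open>A smaller letter on both sides of \<open>w ! i\<close> would form the pattern 121 with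
  it, so its block lies entirely on one side.\<close>

lemma nested_count_take:
  assumes "nested w" "i < length w" "x < w ! i"
  shows "count_list (take i w) x = 0 \<or> count_list (take i w) x = count_list w x"
proof -
  have w: "w = take i w @ w ! i # drop (Suc i) w"
    using assms(2) by (simp add: id_take_nth_drop)
  have "x \<notin> set (take i w) \<or> x \<notin> set (drop (Suc i) w)"
    using nestedD[OF assms(1) w assms(3)] by blast
  moreover have "count_list w x = count_list (take i w) x + count_list (drop (Suc i) w) x"
    using assms(3) by (subst w, subst count_list_append) simp
  ultimately show ?thesis by auto
qed

lemma nested_count_take_Suc:
  assumes "nested w" "i < length w" "x < w ! i"
  shows "count_list (take (Suc i) w) x = 0 \<or> count_list (take (Suc i) w) x = count_list w x"
  using nested_count_take[OF assms] assms by (simp add: take_Suc_conv_app_nth)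

lemma count_list_take_mono: "i \<le> j \<Longrightarrow> count_list (take i w) x \<le> count_list (take j w) x"
  by (metis count_list_append le_add1 le_add_diff_inverse take_add)

lemma count_list_take_le: "count_list (take i w) x \<le> count_list w x"
  by (metis count_list_append append_take_drop_id le_add1)

lemma count_list_take_Suc:
  "i < length w \<Longrightarrow> count_list (take (Suc i) w) x = count_list (take i w) x + (if w ! i = x then 1 else 0)"
  by (simp add: take_Suc_conv_app_nth)

lemma inversions_eq_take:
  assumes "a \<in> set w"
  shows "\<exists>i<length w. w ! i = a \<and> a \<notin> set (take i w) \<and> before a w = take i w \<and>
    (\<forall>c. inversions w c a = count_list (take i w) c)"
proof -
  obtain u v where w: "w = u @ a # v" "a \<notin> set u"
    using split_list_first[OF assms] by blast
  moreover from w have "before a w = u"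
    unfolding before_def by (auto simp: takeWhile_append2 takeWhile_eq_all_conv[THEN iffD2] takeWhile_append)
  ultimately show ?thesis
    by (intro exI[of _ "length u"]) (simp add: inversions_def)
qed

lemma inversions_le_count: "inversions w c a \<le> count_list w c"
  unfolding inversions_def before_def
  by (metis count_list_append le_add1 takeWhile_dropWhile_id)

text \<open>A prefix without \<open>a\<close> is a prefix of \<open>before a w\<close>.\<close>

lemma count_le_inversions:
  assumes "a \<in> set w" "a \<notin> set (take i w)"
  shows "count_list (take i w) c \<le> inversions w c a"
proof -
  obtain j where j: "j < length w" "w ! j = a" "a \<notin> set (take j w)"
    "before a w = take j w" "\<forall>c. inversions w c a = count_list (take j w) c"
    using inversions_eq_take[OF assms(1)] by blast
  have "i \<le> j"
  proof (rule ccontr)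
    assume "\<not> i \<le> j"
    then have "a \<in> set (take i w)"
      using j by (auto simp: in_set_conv_nth)
    with assms(2) show False by simp
  qed
  then show ?thesis using j(5) count_list_take_mono by simp
qed

lemma inversions_le_count_take:
  assumes "a \<in> set (take i w)"
  shows "inversions w c a \<le> count_list (take i w) c"
proof -
  have "a \<in> set w" using assms by (meson in_set_takeD)
  then obtain j where j: "j < length w" "w ! j = a" "a \<notin> set (take j w)"
    "before a w = take j w" "\<forall>c. inversions w c a = count_list (take j w) c"
    using inversions_eq_take by blast
  have "j \<le> i"
  proof (rule ccontr)
    assume "\<not> j \<le> i"
    then have "set (take i w) \<subseteq> set (take j w)" by (simp add: set_take_subset_set_take)
    with j assms show False by auto
  qed
  then show ?thesis using j(5) count_list_take_mono by simp
qed

text \<open>No letter larger than \<open>a\<close> occurs inside the block of \<open>a\<close>.\<close>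

lemma inversions_eq_count_take:
  assumes "nested w" "a < c" "a \<in> set (take i w)" "i \<le> length w"
    and "a \<in> set (drop i w) \<or> w ! (i - 1) = a"
  shows "inversions w c a = count_list (take i w) c"
proof -
  have "a \<in> set w" using assms by (meson in_set_takeD)
  then obtain j where j: "j < length w" "w ! j = a" "a \<notin> set (take j w)"
    "before a w = take j w" "\<forall>c. inversions w c a = count_list (take j w) c"
    using inversions_eq_take by blast
  have ji: "j < i"
  proof (rule ccontr)
    assume "\<not> j < i"
    then have "set (take i w) \<subseteq> set (take j w)" by (simp add: set_take_subset_set_take)
    with j assms show False by auto
  qed
  \<comment> \<open>Either disjunct gives an occurrence of \<open>a\<close> at or after position
    \<open>i - 1\<close>; with the first one at \<open>j\<close> it encloses everything from
    \<open>j\<close> up to the cut.\<close>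
  obtain i' where i': "i' < length w" "w ! i' = a" "i - 1 \<le> i'"
    using assms(5)
  proof
    assume "a \<in> set (drop i w)"
    then obtain k where "k < length w - i" "w ! (i + k) = a"
      using assms(4) by (auto simp: in_set_conv_nth)
    with that[of "i + k"] show ?thesis by auto
  next
    assume "w ! (i - 1) = a"
    with ji assms(4) show ?thesis by (intro that[of "i - 1"]) auto
  qed
  have nc: "w ! l \<noteq> c" if l: "j \<le> l" "l < i" for l
  proof
    assume c: "w ! l = c"
    have w: "w = take l w @ c # drop (Suc l) w"
      using l c assms(4) by (metis id_take_nth_drop less_le_trans)
    have "j \<noteq> l" using c j assms by auto
    then have "a \<in> set (take l w)"
      using l j assms(4) by (auto simp: in_set_conv_nth intro!: exI[of _ j])
    then have a: "a \<notin> set (drop (Suc l) w)"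
      using nestedD[OF assms(1) w assms(2)] by blast
    have "l \<noteq> i'" using c i' assms by auto
    with l i' have "Suc l \<le> i'" by linarith
    with i' have "drop (Suc l) w ! (i' - Suc l) = a" "i' - Suc l < length (drop (Suc l) w)"
      by auto
    with a show False by (metis nth_mem)
  qed
  have "take i w = take j w @ take (i - j) (drop j w)"
    using ji by (metis le_add_diff_inverse less_imp_le take_add)
  moreover have "c \<notin> set (take (i - j) (drop j w))"
  proof
    assume "c \<in> set (take (i - j) (drop j w))"
    then obtain k where "k < i - j" "j + k < length w" "w ! (j + k) = c"
      using j by (auto simp: in_set_conv_nth)
    moreover from this have "j + k < i" by linarith
    ultimately show False using nc[of "j + k"] by auto
  qed
  ultimately show ?thesis by (simp add: j(5))
qed

text \<open>The shortest prefix with at least the prescribed counts already has exactly these counts.\<close>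

lemma ex_prefix_with_counts:
  assumes "nested w"
    and le: "\<And>b. b \<in> L \<Longrightarrow> T b \<le> count_list w b"
    and lo: "\<And>b c. b \<in> L \<Longrightarrow> c \<in> L \<Longrightarrow> b < c \<Longrightarrow> T b < count_list w b \<Longrightarrow> T c \<le> inversions w c b"
    and hi: "\<And>b c. b \<in> L \<Longrightarrow> c \<in> L \<Longrightarrow> b < c \<Longrightarrow> 0 < T b \<Longrightarrow> inversions w c b \<le> T c"
  shows "\<exists>i\<le>length w. \<forall>b\<in>L. count_list (take i w) b = T b"
proof -
  let ?P = "\<lambda>i. \<forall>b\<in>L. T b \<le> count_list (take i w) b"
  define i where "i = (LEAST i. ?P i)"
  have P: "?P (length w)" using le by simp
  have Pi: "?P i" unfolding i_def by (rule LeastI[of ?P, OF P])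
  have il: "i \<le> length w" unfolding i_def by (rule Least_le[of ?P, OF P])
  have le_T: "count_list (take i w) y \<le> T y" if "y \<in> L" for y
  proof (cases i)
    case 0
    then show ?thesis by simp
  next
    case (Suc j)
    have jl: "j < length w" using Suc il by simp
    have "\<not> ?P j" using not_less_Least[of j ?P] Suc unfolding i_def by simp
    \<comment> \<open>Minimality of \<open>i\<close> makes the last letter of the prefix a letter
      \<open>x\<close> that reaches its target exactly there.\<close>
    then obtain x where x: "x \<in> L" "count_list (take j w) x < T x" by auto
    have "T x \<le> count_list (take i w) x" using Pi x by blast
    then have wj: "w ! j = x" and Tx: "T x = count_list (take i w) x"
      using x Suc count_list_take_Suc[OF jl, of x] by (simp_all split: if_splits)
    have "count_list (take i w) x \<noteq> 0" using x Tx by simp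
    then have xi: "x \<in> set (take i w)" by (simp add: count_list_0_iff)
    show ?thesis
    proof (rule ccontr)
      assume "\<not> ?thesis"
      then have y: "T y < count_list (take i w) y" by simp
      then have ylt: "T y < count_list w y" using count_list_take_le[of i w y] by linarith
      have "y \<noteq> x" using y Tx by auto
      \<comment> \<open>The overshooting \<open>y\<close> occurs before position \<open>j\<close>.
        If it is smaller than \<open>x\<close>, this contradicts \<open>lo\<close>. If it is larger,
        no \<open>y\<close> lies between the copies of \<open>x\<close>, the last of which ends the
        prefix, and this contradicts \<open>hi\<close>.\<close>
      then consider "y < x" | "x < y" by linarith
      then show False
      proof cases
        case 1
        have "T x \<le> inversions w x y" using lo[OF that x(1) 1 ylt] .
        moreover have "count_list (take j w) y \<noteq> 0"
          using y Suc count_list_take_Suc[OF jl, of y] 1 wj by simp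
        then have "inversions w x y \<le> count_list (take j w) x"
          by (intro inversions_le_count_take) (simp add: count_list_0_iff)
        ultimately show False using x by simp
      next
        case 2
        have "inversions w y x \<le> T y" using hi[OF x(1) that 2] x by simp
        moreover have "inversions w y x = count_list (take i w) y"
          using inversions_eq_count_take[OF assms(1) 2 xi il] Suc wj by simp
        ultimately show False using y by simp
      qed
    qed
  qed
  have "count_list (take i w) b = T b" if "b \<in> L" for b
    using Pi that le_T[OF that] by (simp add: le_antisym)
  with il show ?thesis by blast
qed

section \<open>Words determined by, and built from, their inversion numbers\<close>

text \<open>The conditions of \<open>ex_prefix_with_counts\<close> involve only total counts and
  inversion numbers, so every prefix of \<open>w\<close> has a counterpart in \<open>w'\<close> with
  the same counts. A letter is then read off from two successive prefixes.\<close>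

lemma nested_eqI:
  assumes "nested w" "nested w'" "\<And>a. count_list w a = count_list w' a"
    and "\<And>a c. a \<in> set w \<Longrightarrow> c \<in> set w \<Longrightarrow> a < c \<Longrightarrow> inversions w c a = inversions w' c a"
  shows "w = w'"
proof -
  have seteq: "set w = set w'"
    using assms(3) by (metis count_list_0_iff subsetI subset_antisym)
  have len: "length w = length w'"
    using sum_count_set[of w "set w"] sum_count_set[of w' "set w"] assms(3) seteq by simp
  have pre: "\<forall>b. count_list (take i w) b = count_list (take i w') b" if i: "i \<le> length w" for i
  proof -
    have "\<exists>j\<le>length w'. \<forall>b\<in>set w. count_list (take j w') b = count_list (take i w) b"
    proof (rule ex_prefix_with_counts[OF assms(2)])
      fix b c assume bc: "b \<in> set w" "c \<in> set w" "b < c"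
      show "count_list (take i w) c \<le> inversions w' c b"
        if "count_list (take i w) b < count_list w' b"
      proof (cases "b \<in> set (take i w)")
        case True
        have "count_list w b = count_list (take i w) b + count_list (drop i w) b"
          by (metis append_take_drop_id count_list_append)
        with that assms(3) have "b \<in> set (drop i w)"
          by (metis add_0_right count_list_0_iff less_irrefl)
        then show ?thesis
          using inversions_eq_count_take[OF assms(1) bc(3) True i] assms(4) bc by simp
      next
        case False
        then show ?thesis using count_le_inversions[OF bc(1) False, of c] assms(4)[OF bc] by simp
      qed
      show "inversions w' c b \<le> count_list (take i w) c" if "0 < count_list (take i w) b"
        using inversions_le_count_take[of b i w c] that assms(4) bc
        by (metis count_list_0_iff less_irrefl)
    qed (simp add: assms(3)[symmetric] count_list_take_le)
    then obtain j where j: "j \<le> length w'" "\<forall>b\<in>set w. count_list (take j w') b = count_list (take i w) b"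
      by blast
    have all: "count_list (take j w') b = count_list (take i w) b" for b
    proof (cases "b \<in> set w")
      case False
      with seteq have "b \<notin> set (take j w')" "b \<notin> set (take i w)"
        by (auto dest: in_set_takeD)
      then show ?thesis by simp
    qed (use j(2) in blast)
    \<comment> \<open>Equal counts of all letters force equal lengths, so the prefix found is the
      one with \<open>i\<close> letters.\<close>
    have "length (take j w') = length (take i w)"
      by (intro mset_eq_length multiset_eqI) (simp only: count_mset all)
    then have "j = i" using j i len by simp
    with all show ?thesis by simp
  qed
  show ?thesis
  proof (rule nth_equalityI[OF len])
    fix i assume i: "i < length w"
    have "count_list (take (Suc i) w) (w ! i) = count_list (take (Suc i) w') (w ! i)"
      "count_list (take i w) (w ! i) = count_list (take i w') (w ! i)"
      using pre i by auto
    then show "w ! i = w' ! i"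
      using i len by (simp add: count_list_take_Suc split: if_splits)
  qed
qed

text \<open>The hypotheses on \<open>I\<close> are the planarity and transitivity of inversion numbers. The word is
  built by inserting the blocks of the letters \<open>n, ..., 1\<close> in this order.\<close>

lemma ex_nested_with_inversions:
  fixes M :: "nat \<Rightarrow> nat" and I :: "nat \<Rightarrow> nat \<Rightarrow> nat"
  assumes pos: "\<And>a. 1 \<le> a \<Longrightarrow> a \<le> n \<Longrightarrow> 0 < M a"
    and le: "\<And>a c. 1 \<le> a \<Longrightarrow> a < c \<Longrightarrow> c \<le> n \<Longrightarrow> I c a \<le> M c"
    and lo: "\<And>a b c. 1 \<le> a \<Longrightarrow> a < b \<Longrightarrow> b < c \<Longrightarrow> c \<le> n \<Longrightarrow> I b a < M b \<Longrightarrow> I c a \<le> I c b"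
    and hi: "\<And>a b c. 1 \<le> a \<Longrightarrow> a < b \<Longrightarrow> b < c \<Longrightarrow> c \<le> n \<Longrightarrow> 0 < I b a \<Longrightarrow> I c b \<le> I c a"
  shows "\<exists>w. nested w \<and> (\<forall>a. count_list w a = (if 1 \<le> a \<and> a \<le> n then M a else 0)) \<and>
    (\<forall>a c. 1 \<le> a \<longrightarrow> a < c \<longrightarrow> c \<le> n \<longrightarrow> inversions w c a = I c a)"
proof -
  have "\<exists>w. nested w \<and> (\<forall>a. count_list w a = (if d < a \<and> a \<le> n then M a else 0)) \<and>
    (\<forall>a c. d < a \<longrightarrow> a < c \<longrightarrow> c \<le> n \<longrightarrow> inversions w c a = I c a)" if "d \<le> n" for d
    using that
  proof (induction rule: inc_induct)
    case base
    show ?case by (rule exI[of _ "[]"]) (auto simp: nested_def)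
  next
    case (step d)
    then obtain w where w: "nested w"
      and cnt: "\<And>a. count_list w a = (if Suc d < a \<and> a \<le> n then M a else 0)"
      and inv: "\<And>a c. Suc d < a \<Longrightarrow> a < c \<Longrightarrow> c \<le> n \<Longrightarrow> inversions w c a = I c a"
      by blast
    define e where "e = Suc d"
    have setw: "set w \<subseteq> {Suc e..n}"
    proof
      fix a assume "a \<in> set w"
      then have "count_list w a \<noteq> 0" by (simp add: count_list_0_iff)
      then show "a \<in> {Suc e..n}" using cnt[of a] by (auto simp: e_def split: if_splits)
    qed
    \<comment> \<open>The block of \<open>e\<close> belongs at the cut where every larger letter
      \<open>b\<close> has count \<open>I b e\<close>. Such a cut exists because \<open>lo\<close>
      and \<open>hi\<close> with \<open>a = e\<close> are the two compatibility conditions on these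
      targets.\<close>
    have "\<exists>i\<le>length w. \<forall>b\<in>{Suc e..n}. count_list (take i w) b = I b e"
    proof (rule ex_prefix_with_counts[OF w])
      show "I b e \<le> count_list w b" if "b \<in> {Suc e..n}" for b
        using that le[of e b] cnt[of b] by (auto simp: e_def)
      fix b c assume bc: "b \<in> {Suc e..n}" "c \<in> {Suc e..n}" "b < c"
      have "inversions w c b = I c b" using inv[of b c] bc by (auto simp: e_def)
      moreover have "count_list w b = M b" using cnt[of b] bc by (auto simp: e_def)
      ultimately show "I b e < count_list w b \<Longrightarrow> I c e \<le> inversions w c b"
        "0 < I b e \<Longrightarrow> inversions w c b \<le> I c e"
        using lo[of e b c] hi[of e b c] bc by (auto simp: e_def)
    qed
    then obtain i where i: "i \<le> length w" "\<And>b. b \<in> {Suc e..n} \<Longrightarrow> count_list (take i w) b = I b e"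
      by blast
    define p q where "p = take i w" and "q = drop i w"
    have wpq: "w = p @ q" by (simp add: p_def q_def)
    let ?w = "p @ replicate (M e) e @ q"
    have big: "e < x" if "x \<in> set p \<union> set q" for x
      using that setw wpq by auto
    have Me: "0 < M e" using pos[of e] step by (simp add: e_def)
    have "nested ?w"
      unfolding nested_iff_subseq
    proof safe
      fix x y assume xy: "x < y" "subseq [x, y, x] ?w"
      show False
      \<comment> \<open>A pattern around \<open>e\<close> would put another letter inside the
        contiguous block of \<open>e\<close>; any other pattern survives the deletion of
        \<open>e\<close> and already occurs in \<open>w\<close>.\<close>
      proof (cases "x = e")
        case True
        obtain u v where uv: "?w = u @ y # v" "e \<in> set u" "e \<in> set v"
          using xy(2) True unfolding subseq_triple by blast
        have "y \<noteq> e" using xy True by simp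
        have "e \<notin> set p" "e \<notin> set q" using big by auto
        show False
          using uv(1) unfolding append_eq_append_conv2[of p]
        proof (elim exE disjE conjE)
          fix us assume "p @ us = u" "replicate (M e) e @ q = us @ y # v"
          from this(2) show False
            unfolding append_eq_append_conv2[of "replicate (M e) e"]
          proof (elim exE disjE conjE)
            fix us' assume us: "replicate (M e) e = us @ us'" "us' @ q = y # v"
            have "set us' \<subseteq> {e}"
              using arg_cong[OF us(1), of set] by (auto split: if_splits)
            with us(2) \<open>y \<noteq> e\<close> \<open>e \<notin> set q\<close> uv(3) show False
              by (cases us') auto
          qed (use \<open>e \<notin> set q\<close> uv(3) in auto)
        qed (use \<open>e \<notin> set p\<close> uv(2) in auto)
      next
        case False
        obtain u v where "?w = u @ y # v" "x \<in> set u"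
          using xy(2) unfolding subseq_triple by blast
        then have "x \<in> set ?w" by simp
        then have "e < x" using False big by (auto split: if_splits)
        then have "subseq (filter (\<lambda>z. e < z) [x, y, x]) (filter (\<lambda>z. e < z) ?w)"
          using subseq_filter[OF xy(2)] by blast
        moreover have "filter (\<lambda>z. e < z) ?w = w" using big wpq by (auto simp: filter_id_conv)
        ultimately have "subseq [x, y, x] w" using \<open>e < x\<close> xy by simp
        with xy w show False unfolding nested_iff_subseq by blast
      qed
    qed
    moreover have "count_list ?w a = (if d < a \<and> a \<le> n then M a else 0)" for a
    proof -
      have rep: "count_list (replicate k e) a = (if a = e then k else 0)" for k
        by (induction k) auto
      have "count_list ?w a = count_list w a + (if a = e then M e else 0)"
        by (simp add: wpq rep)
      then show ?thesis using cnt[of a] step by (auto simp: e_def)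
    qed
    moreover have "inversions ?w c a = I c a" if ac: "d < a" "a < c" "c \<le> n" for a c
    proof (cases "a = e")
      case True
      have "before e ?w = p"
        unfolding before_def using Me big
        by (cases "M e") (auto simp: takeWhile_append takeWhile_eq_all_conv)
      with i(2)[of c] ac True show ?thesis by (simp add: inversions_def p_def)
    next
      case False
      have "count_list (takeWhile (\<lambda>x. x \<noteq> a) ?w) c = count_list (takeWhile (\<lambda>x. x \<noteq> a) (p @ q)) c"
        using False ac by (auto simp: takeWhile_append e_def)
      with inv[of a c] ac False show ?thesis
        by (simp add: inversions_def before_def wpq e_def)
    qed
    ultimately show ?case by (intro exI[of _ ?w]) auto
  qed
  from this[of 0] show ?thesis by (simp add: Suc_le_eq)
qed

text \<open>Once some \<open>b\<close> precedes the first \<open>a\<close>, everything before the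
  first \<open>b\<close> also precedes the first \<open>a\<close>.\<close>

lemma inversions_trans:
  assumes "a \<in> set w" "0 < inversions w b a"
  shows "inversions w c b \<le> inversions w c a"
proof -
  obtain i where i: "i < length w" "w ! i = a" "a \<notin> set (take i w)"
    "before a w = take i w" "\<forall>c. inversions w c a = count_list (take i w) c"
    using inversions_eq_take[OF assms(1)] by blast
  from i(5) have "b \<in> set (take i w)" using assms(2) by (metis count_list_0_iff less_irrefl)
  from inversions_le_count_take[OF this, of c] i(5) show ?thesis by simp
qed

subsection \<open>Routes\<close>

definition mk_route :: "nat \<Rightarrow> (nat \<Rightarrow> nat) \<Rightarrow> (nat \<times> nat) list" where
  "mk_route k f = map (\<lambda>i. (i, f i)) (rev [1..<Suc k])"

text \<open>A route of length \<open>k\<close> starts with a source edge to \<open>v_{n+1-k}\<close> and visits every later vertex,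
  so it contains exactly one edge \<open>(i, t)\<close> for each \<open>i \<le> k\<close>, namely for \<open>t = val R i\<close>.\<close>

definition val :: "(nat \<times> nat) list \<Rightarrow> nat \<Rightarrow> nat" where
  "val R i = snd (R ! (length R - i))"

lemma length_mk_route [simp]: "length (mk_route k f) = k"
  by (simp add: mk_route_def)

lemma mk_route_Suc: "mk_route (Suc k) f = (Suc k, f (Suc k)) # mk_route k f"
  by (simp add: mk_route_def)

lemma nth_mk_route: "j < k \<Longrightarrow> mk_route k f ! j = (k - j, f (k - j))"
  by (auto simp: mk_route_def rev_nth Suc_diff_Suc simp del: upt_Suc)

lemma val_mk_route: "1 \<le> i \<Longrightarrow> i \<le> k \<Longrightarrow> val (mk_route k f) i = f i"
  by (simp add: val_def nth_mk_route)

lemma set_mk_route: "set (mk_route k f) = {(i, f i) | i. 1 \<le> i \<and> i \<le> k}"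
  by (auto simp: mk_route_def)

lemma mk_route_cong: "(\<And>i. 1 \<le> i \<Longrightarrow> i \<le> k \<Longrightarrow> f i = g i) \<Longrightarrow> mk_route k f = mk_route k g"
  by (auto simp: mk_route_def)

locale composition =
  fixes s :: "nat list"
  assumes positive: "\<forall>x\<in>set s. 0 < x"
begin

abbreviation n :: nat where "n \<equiv> length s"

lemma part_pos: "1 \<le> i \<Longrightarrow> i \<le> Suc n \<Longrightarrow> 0 < part s i"
  using positive by (auto simp: part_def nth_append)

lemma part_last: "part s (Suc n) = 2"
  by (simp add: part_def)

text \<open>The strict bounds at \<open>k\<close> single out a source edge, the only kind that
  leaves the vertex -1; below \<open>k\<close> the edge is a bump (0) or a dip
  (\<open>part s i\<close>).\<close>

definition valid_route :: "nat \<Rightarrow> (nat \<Rightarrow> nat) \<Rightarrow> bool" where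
  "valid_route k f \<longleftrightarrow> 1 \<le> k \<and> k \<le> Suc n \<and> 0 < f k \<and> f k < part s k \<and>
    (\<forall>i. 1 \<le> i \<and> i < k \<longrightarrow> f i = 0 \<or> f i = part s i)"

lemma arcs_iff: "(i, t) \<in> arcs (oruga s) \<longleftrightarrow>
   1 \<le> i \<and> (i \<le> Suc n \<and> 1 \<le> t \<and> t < part s i \<or> i \<le> n \<and> (t = 0 \<or> t = part s i))"
  by (auto simp: oruga_def)

lemma tail_iff: "tail (oruga s) (i, t) = (if 1 \<le> t \<and> t < part s i then - 1 else int n - int i)"
  by (simp add: oruga_def)

lemma head_iff: "head (oruga s) (i, t) = int n + 1 - int i"
  by (simp add: oruga_def)

text \<open>A walk that has left the source climbs one vertex per edge, with only the bump and the
  dip to choose from, and no edge leaves the sink.\<close>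

lemma cas_to_sink:
  assumes "k \<le> n" "set p \<subseteq> arcs (oruga s)" "pre_digraph.cas (oruga s) (int n - int k) p (int n)"
  shows "\<exists>f. p = mk_route k f \<and> (\<forall>i. 1 \<le> i \<and> i \<le> k \<longrightarrow> f i = 0 \<or> f i = part s i)"
  using assms
proof (induction k arbitrary: p)
  case 0
  have "p = []"
  proof (cases p)
    case (Cons e es)
    with 0 have "tail (oruga s) e = int n" "e \<in> arcs (oruga s)"
      by (auto simp: pre_digraph.cas.simps)
    then show ?thesis by (cases e) (auto simp: arcs_iff tail_iff split: if_splits)
  qed
  then show ?case by (simp add: mk_route_def)
next
  case (Suc k)
  show ?case
  proof (cases p)
    case Nil
    with Suc.prems show ?thesis by (simp add: pre_digraph.cas.simps)
  next
    case (Cons e es)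
    obtain i t where e: "e = (i, t)" by (cases e)
    from Cons Suc.prems have tl: "tail (oruga s) e = int n - int (Suc k)" and arc: "e \<in> arcs (oruga s)"
      and es: "pre_digraph.cas (oruga s) (head (oruga s) e) es (int n)" "set es \<subseteq> arcs (oruga s)"
      by (auto simp: pre_digraph.cas.simps)
    from tl Suc.prems(1) have "\<not> (1 \<le> t \<and> t < part s i)" "int i = int (Suc k)"
      unfolding e by (auto simp: tail_iff split: if_splits)
    moreover from this(2) have "i = Suc k" by linarith
    ultimately have i: "i = Suc k" "t = 0 \<or> t = part s (Suc k)"
      using arc unfolding e by (auto simp: arcs_iff)
    have "head (oruga s) e = int n - int k" by (simp add: e head_iff i)
    with Suc.IH[of es] Suc.prems(1) es obtain f where f: "es = mk_route k f"
      "\<forall>i. 1 \<le> i \<and> i \<le> k \<longrightarrow> f i = 0 \<or> f i = part s i"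
      by auto
    have "p = mk_route (Suc k) (f(Suc k := t))"
      unfolding mk_route_Suc Cons e i f(1) by (auto intro: mk_route_cong)
    moreover have "\<forall>i. 1 \<le> i \<and> i \<le> Suc k \<longrightarrow> (f(Suc k := t)) i = 0 \<or> (f(Suc k := t)) i = part s i"
      using f(2) i(2) by (auto simp: le_Suc_eq)
    ultimately show ?thesis by blast
  qed
qed

lemma cas_mk_route:
  assumes "k \<le> n" "\<forall>i. 1 \<le> i \<and> i \<le> k \<longrightarrow> f i = 0 \<or> f i = part s i"
  shows "pre_digraph.cas (oruga s) (int n - int k) (mk_route k f) (int n)"
  using assms
proof (induction k)
  case 0
  then show ?case by (simp add: mk_route_def pre_digraph.cas.simps)
next
  case (Suc k)
  then have "f (Suc k) = 0 \<or> f (Suc k) = part s (Suc k)" by auto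
  with Suc show ?case
    by (auto simp: mk_route_Suc pre_digraph.cas.simps tail_iff head_iff)
qed

lemma routes_eq: "routes s = {mk_route k f | k f. valid_route k f}"
proof (intro equalityI subsetI)
  fix p assume "p \<in> routes s"
  then have p: "set p \<subseteq> arcs (oruga s)" "pre_digraph.cas (oruga s) (- 1) p (int n)"
    by (auto simp: routes_def pre_digraph.apath_def pre_digraph.awalk_def)
  then obtain e es where Cons: "p = e # es"
    by (cases p) (auto simp: pre_digraph.cas.simps)
  obtain i t where e: "e = (i, t)" by (cases e)
  from Cons p have tl: "tail (oruga s) e = - 1" and arc: "e \<in> arcs (oruga s)"
    and es: "pre_digraph.cas (oruga s) (head (oruga s) e) es (int n)" "set es \<subseteq> arcs (oruga s)"
    by (auto simp: pre_digraph.cas.simps)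
  from tl arc have i: "1 \<le> i" "i \<le> Suc n" "1 \<le> t" "t < part s i"
    unfolding e by (auto simp: arcs_iff tail_iff split: if_splits)
  then obtain k where k: "i = Suc k" by (cases i) auto
  have "head (oruga s) e = int n - int k" by (simp add: e head_iff k)
  with cas_to_sink[of k es] i k es obtain f where f: "es = mk_route k f"
    "\<forall>i. 1 \<le> i \<and> i \<le> k \<longrightarrow> f i = 0 \<or> f i = part s i"
    by auto
  have "p = mk_route (Suc k) (f(Suc k := t))"
    unfolding mk_route_Suc Cons e k f(1) by (auto intro: mk_route_cong)
  moreover have "valid_route (Suc k) (f(Suc k := t))"
    using f(2) i k by (auto simp: valid_route_def)
  ultimately show "p \<in> {mk_route k f | k f. valid_route k f}" by blast
next
  fix p assume "p \<in> {mk_route k f | k f. valid_route k f}"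
  then obtain k f where p: "p = mk_route k f" and v: "valid_route k f" by blast
  obtain j where k: "k = Suc j" using v by (cases k) (auto simp: valid_route_def)
  have arcs: "set p \<subseteq> arcs (oruga s)"
  proof
    fix e assume "e \<in> set p"
    then obtain i where i: "e = (i, f i)" "1 \<le> i" "i \<le> k" by (auto simp: p set_mk_route)
    show "e \<in> arcs (oruga s)"
      using i v by (cases "i = k") (auto simp: arcs_iff valid_route_def)
  qed
  have "pre_digraph.cas (oruga s) (int n - int j) (mk_route j f) (int n)"
    using v k by (intro cas_mk_route) (auto simp: valid_route_def)
  then have cas: "pre_digraph.cas (oruga s) (- 1) p (int n)"
    using v unfolding p k mk_route_Suc
    by (auto simp: pre_digraph.cas.simps tail_iff head_iff valid_route_def k)
  \<comment> \<open>No vertex repeats, since the heads run through consecutive integers above the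
    source.\<close>
  have "pre_digraph.awalk_verts (oruga s) (- 1) p = - 1 # map (head (oruga s)) p"
    using pre_digraph.awalk_verts_conv'[OF cas] cas
    by (auto simp: p k mk_route_Suc pre_digraph.cas.simps)
  moreover have "map (head (oruga s)) p = map (\<lambda>i. int n + 1 - int i) (rev [1..<Suc k])"
    unfolding p mk_route_def map_map by (rule map_cong) (auto simp: head_iff)
  moreover have "distinct (map (\<lambda>i. int n + 1 - int i) (rev [1..<Suc k]))"
    by (auto simp: distinct_map inj_on_def)
  moreover have "- 1 \<notin> set (map (\<lambda>i. int n + 1 - int i) (rev [1..<Suc k]))"
    using v by (auto simp: valid_route_def)
  ultimately have "distinct (pre_digraph.awalk_verts (oruga s) (- 1) p)" by simp
  then show "p \<in> routes s"
    using arcs cas by (simp add: routes_def pre_digraph.apath_def pre_digraph.awalk_def oruga_def)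
qed

lemma routeE:
  assumes "R \<in> routes s"
  shows "R = mk_route (length R) (val R)" "valid_route (length R) (val R)"
proof -
  obtain k f where R: "R = mk_route k f" "valid_route k f" using assms by (auto simp: routes_eq)
  have v: "\<And>i. 1 \<le> i \<Longrightarrow> i \<le> k \<Longrightarrow> val R i = f i" by (simp add: R val_mk_route)
  show "R = mk_route (length R) (val R)"
    using v by (subst R(1)) (auto simp: R(1) intro: mk_route_cong)
  show "valid_route (length R) (val R)"
    using R(2) v by (auto simp: R(1) valid_route_def)
qed

lemma route_length: "R \<in> routes s \<Longrightarrow> 1 \<le> length R \<and> length R \<le> Suc n"
  using routeE(2) by (simp add: valid_route_def)

lemma val_first: "R \<in> routes s \<Longrightarrow> 0 < val R (length R) \<and> val R (length R) < part s (length R)"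
  using routeE(2) by (simp add: valid_route_def)

lemma val_cases: "R \<in> routes s \<Longrightarrow> 1 \<le> i \<Longrightarrow> i < length R \<Longrightarrow> val R i = 0 \<or> val R i = part s i"
  using routeE(2) by (simp add: valid_route_def)

lemma val_le: "R \<in> routes s \<Longrightarrow> 1 \<le> i \<Longrightarrow> i \<le> length R \<Longrightarrow> val R i \<le> part s i"
  using val_first[of R] val_cases[of R i] by (cases "i = length R") auto

lemma in_route_iff: "R \<in> routes s \<Longrightarrow> (i, t) \<in> set R \<longleftrightarrow> 1 \<le> i \<and> i \<le> length R \<and> val R i = t"
  by (subst routeE(1), assumption) (auto simp: set_mk_route)

lemma route_eqI:
  assumes "R \<in> routes s" "Q \<in> routes s" "length R = length Q"
    "\<And>i. 1 \<le> i \<Longrightarrow> i \<le> length R \<Longrightarrow> val R i = val Q i"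
  shows "R = Q"
  using routeE(1)[OF assms(1)] routeE(1)[OF assms(2)] assms(3,4) mk_route_cong by metis

text \<open>The largest index among the edges is the length, and each index up to it carries a
  single value.\<close>

lemma set_route_inj: "inj_on set (routes s)"
proof (rule inj_onI)
  fix R Q assume R: "R \<in> routes s" and Q: "Q \<in> routes s" and eq: "set R = set Q"
  have iff: "1 \<le> i \<and> i \<le> length R \<and> val R i = t \<longleftrightarrow> 1 \<le> i \<and> i \<le> length Q \<and> val Q i = t" for i t
    using in_route_iff[OF R] in_route_iff[OF Q] eq by blast
  have "length R = length Q"
    using iff[of "length R" "val R (length R)"] iff[of "length Q" "val Q (length Q)"]
      route_length[OF R] route_length[OF Q] by simp
  with iff show "R = Q" by (intro route_eqI[OF R Q]) blast+
qed

lemma finite_routes: "finite (routes s)"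
proof (rule finite_imageD[OF _ set_route_inj])
  have "arcs (oruga s) \<subseteq> (SIGMA i:{1..Suc n}. {..part s i})"
    by (auto simp: arcs_iff)
  then have "finite (arcs (oruga s))" by (rule finite_subset) auto
  moreover have "set ` routes s \<subseteq> Pow (arcs (oruga s))"
    by (auto simp: routes_def pre_digraph.apath_def pre_digraph.awalk_def)
  ultimately show "finite (set ` routes s)" by (meson finite_Pow_iff finite_subset)
qed

lemma route_arcs: "R \<in> routes s \<Longrightarrow> set R \<subseteq> arcs (oruga s)"
  by (auto simp: routes_def pre_digraph.apath_def pre_digraph.awalk_def)

section \<open>Coherence as the absence of opposite comparisons\<close>

definition less_route :: "(nat \<times> nat) list \<Rightarrow> (nat \<times> nat) list \<Rightarrow> bool" where
  "less_route P Q \<longleftrightarrow> (\<exists>i. 1 \<le> i \<and> i \<le> length P \<and> i \<le> length Q \<and> val P i < val Q i)"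

text \<open>The shorter route starts with a source edge, whose label lies strictly between 0 and the
  part, whereas the longer one has a bump or a dip at that index; so the values would differ
  there.\<close>

lemma length_eq_if_vals_eq:
  assumes "P \<in> routes s" "Q \<in> routes s" "i < length P" "i < length Q"
    and eq: "\<And>j. i < j \<Longrightarrow> j \<le> length P \<Longrightarrow> j \<le> length Q \<Longrightarrow> val P j = val Q j"
  shows "length P = length Q"
proof (rule ccontr)
  assume "length P \<noteq> length Q"
  then consider "length P < length Q" | "length Q < length P" by linarith
  then show False
  proof cases
    case 1
    then show False
      using eq[of "length P"] val_first[OF assms(1)] val_cases[OF assms(2), of "length P"]
        route_length[OF assms(1)] assms(3,4) by auto
  next
    case 2
    then show False
      using eq[of "length Q"] val_first[OF assms(2)] val_cases[OF assms(1), of "length Q"]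
        route_length[OF assms(2)] assms(3,4) by auto
  qed
qed

text \<open>Take two indices, as close as possible, at which the routes compare in opposite ways. In
  between the routes agree, so this is a maximal common subpath entered and left in opposite orders.
  Conversely, entering and leaving a common subpath are comparisons at two common indices.\<close>

lemma coherent_iff:
  assumes P: "P \<in> routes s" and Q: "Q \<in> routes s"
  shows "coherent s P Q \<longleftrightarrow> \<not> (less_route P Q \<and> less_route Q P)"
proof
  assume coh: "coherent s P Q"
  show "\<not> (less_route P Q \<and> less_route Q P)"
  proof
    assume "less_route P Q \<and> less_route Q P"
    define K where "K = min (length P) (length Q)"
    let ?S = "\<lambda>d. \<exists>i j. 1 \<le> i \<and> i < j \<and> j \<le> K \<and> d = j - i \<and>
      (val P i < val Q i \<and> val Q j < val P j \<or> val Q i < val P i \<and> val P j < val Q j)"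
    have "\<exists>d. ?S d"
    proof -
      obtain i j where ij: "1 \<le> i" "i \<le> K" "val P i < val Q i" "1 \<le> j" "j \<le> K" "val Q j < val P j"
        using \<open>less_route P Q \<and> less_route Q P\<close> unfolding less_route_def K_def by auto
      then have "i < j \<or> j < i" by (cases i j rule: linorder_cases) auto
      then show ?thesis
      proof
        assume "i < j"
        with ij show ?thesis by (intro exI[of _ "j - i"] exI[of _ i] exI[of _ j]) simp
      next
        assume "j < i"
        with ij show ?thesis by (intro exI[of _ "i - j"] exI[of _ j] exI[of _ i]) simp
      qed
    qed
    then obtain d where d: "?S d" "\<forall>d'<d. \<not> ?S d'"
      using exists_least_iff[of ?S] by blast
    then obtain i j where ij: "1 \<le> i" "i < j" "j \<le> K" "d = j - i"
      "val P i < val Q i \<and> val Q j < val P j \<or> val Q i < val P i \<and> val P j < val Q j"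
      by blast
    have eq: "val P l = val Q l" if l: "i < l" "l < j" for l
    proof (rule ccontr)
      assume "val P l \<noteq> val Q l"
      then consider "val P l < val Q l" | "val Q l < val P l" by linarith
      then have "?S (l - i) \<or> ?S (j - l)"
      proof cases
        case 1
        show ?thesis
        proof (cases "val P i < val Q i")
          case True
          with 1 l ij show ?thesis by (intro disjI2 exI[of _ l] exI[of _ j]) auto
        next
          case False
          with 1 l ij show ?thesis by (intro disjI1 exI[of _ i] exI[of _ l]) auto
        qed
      next
        case 2
        show ?thesis
        proof (cases "val P i < val Q i")
          case True
          with 2 l ij show ?thesis by (intro disjI1 exI[of _ i] exI[of _ l]) auto
        next
          case False
          with 2 l ij show ?thesis by (intro disjI2 exI[of _ l] exI[of _ j]) auto
        qed
      qed
      moreover have "l - i < d" "j - l < d" using l ij by linarith+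
      ultimately show False using d(2) by blast
    qed
    \<comment> \<open>Routes list indices in decreasing order, so the common subpath is entered by
      the edge of index \<open>j\<close> and left by that of index \<open>i\<close>.\<close>
    have split: "\<exists>p1 p2. R = p1 @ [(j, val R j)] @ map (\<lambda>l. (l, val R l)) (rev [Suc i..<j])
        @ [(i, val R i)] @ p2" if R: "R \<in> routes s" "K \<le> length R" for R
    proof -
      have upt: "[a..<c] = [a..<b] @ [b..<c]" if "a \<le> b" "b \<le> c" for a b c
        using that upt_add_eq_append[of a b "c - b"] by simp
      have "[1..<Suc (length R)] = [1..<i] @ i # [Suc i..<j] @ j # [Suc j..<Suc (length R)]"
        using upt[of 1 i "Suc (length R)"] upt[of "Suc i" j "Suc (length R)"]
          upt_conv_Cons[of i "Suc (length R)"] upt_conv_Cons[of j "Suc (length R)"] ij R(2)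
        by (simp del: upt_Suc)
      then have "mk_route (length R) (val R) = map (\<lambda>l. (l, val R l)) (rev [Suc j..<Suc (length R)]) @ [(j, val R j)]
        @ map (\<lambda>l. (l, val R l)) (rev [Suc i..<j]) @ [(i, val R i)] @ map (\<lambda>l. (l, val R l)) (rev [1..<i])"
        by (simp add: mk_route_def del: upt_Suc)
      with routeE(1)[OF R(1)] show ?thesis by metis
    qed
    have m: "map (\<lambda>l. (l, val Q l)) (rev [Suc i..<j]) = map (\<lambda>l. (l, val P l)) (rev [Suc i..<j])"
      using eq by auto
    obtain p1 p2 where p: "P = p1 @ [(j, val P j)] @ map (\<lambda>l. (l, val P l)) (rev [Suc i..<j])
        @ [(i, val P i)] @ p2"
      using split[OF P] unfolding K_def by auto
    obtain q1 q2 where q: "Q = q1 @ [(j, val Q j)] @ map (\<lambda>l. (l, val P l)) (rev [Suc i..<j])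
        @ [(i, val Q i)] @ q2"
      using split[OF Q] unfolding K_def m by auto
    have il: "i < length P" "i < length Q" using ij unfolding K_def by auto
    \<comment> \<open>As \<open>i\<close> is below both lengths, both leaving edges are bumps or
      dips and start at the same vertex; the entering edges at \<open>j\<close> may be source
      edges.\<close>
    have tails: "tail (oruga s) (i, val P i) = tail (oruga s) (i, val Q i)"
      using val_cases[OF P ij(1) il(1)] val_cases[OF Q ij(1) il(2)] by (auto simp: tail_iff)
    have iff: "((j, val P j), (j, val Q j)) \<in> framing_in s \<longleftrightarrow> ((i, val P i), (i, val Q i)) \<in> framing_out s"
      using coh[unfolded coherent_def, rule_format, OF conjI, OF p conjI, OF q] tails ij(5)
      by (auto simp: head_iff)
    have arc: "(j, val P j) \<in> arcs (oruga s)" "(j, val Q j) \<in> arcs (oruga s)"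
      using route_arcs[OF P] route_arcs[OF Q] p q by (metis in_set_conv_decomp append_Cons append_Nil subsetD)+
    have in_iff: "((j, val P j), (j, val Q j)) \<in> framing_in s \<longleftrightarrow> val P j < val Q j"
      using arc by (auto simp: framing_in_def)
    have out_iff: "((i, val P i), (i, val Q i)) \<in> framing_out s \<longleftrightarrow> val P i < val Q i"
      using val_cases[OF P ij(1) il(1)] val_cases[OF Q ij(1) il(2)] ij part_pos[of i] route_length[OF P] il
      by (auto simp: framing_out_def)
    show False using iff ij(5) unfolding in_iff out_iff by auto
  qed
next
  assume ncr: "\<not> (less_route P Q \<and> less_route Q P)"
  show "coherent s P Q"
    unfolding coherent_def
  proof (intro allI impI, elim conjE)
    fix p1 p2 q1 q2 m e e' f f'
    assume p: "P = p1 @ [e] @ m @ [e'] @ p2" and q: "Q = q1 @ [f] @ m @ [f'] @ q2"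
      and hd: "head (oruga s) e = head (oruga s) f" and ne: "e \<noteq> f" "e' \<noteq> f'"
    have P1: "e = (length P - length p1, val P (length P - length p1))"
      and P2: "e' = (length P - (length p1 + 1 + length m), val P (length P - (length p1 + 1 + length m)))"
      using routeE(1)[OF P] nth_mk_route[of "length p1" "length P" "val P"]
        nth_mk_route[of "length p1 + 1 + length m" "length P" "val P"] p
      by (auto simp: nth_append)
    have Q1: "f = (length Q - length q1, val Q (length Q - length q1))"
      and Q2: "f' = (length Q - (length q1 + 1 + length m), val Q (length Q - (length q1 + 1 + length m)))"
      using routeE(1)[OF Q] nth_mk_route[of "length q1" "length Q" "val Q"]
        nth_mk_route[of "length q1 + 1 + length m" "length Q" "val Q"] q
      by (auto simp: nth_append)
    define j where "j = length P - length p1"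
    define i where "i = length P - (length p1 + 1 + length m)"
    have lP: "length P = length p1 + length m + length p2 + 2"
      and lQ: "length Q = length q1 + length m + length q2 + 2"
      using p q by auto
    \<comment> \<open>The common head forces the same index \<open>j\<close> on both routes, and the
      shared \<open>m\<close> then the same index \<open>i\<close>.\<close>
    have jQ: "length Q - length q1 = j"
      using hd unfolding P1 Q1 head_iff j_def by simp
    then have iQ: "length Q - (length q1 + 1 + length m) = i"
      unfolding i_def j_def using lP lQ by linarith
    have e: "e = (j, val P j)" "e' = (i, val P i)" "f = (j, val Q j)" "f' = (i, val Q i)"
      using P1 P2 Q1 Q2 jQ iQ by (simp_all add: i_def j_def)
    have ij: "1 \<le> i" "i < j" "j \<le> length P" "j \<le> length Q"
      using lP lQ jQ by (auto simp: i_def j_def)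
    have arc: "e \<in> arcs (oruga s)" "f \<in> arcs (oruga s)"
      using route_arcs[OF P] route_arcs[OF Q] p q by auto
    have in_iff: "(e, f) \<in> framing_in s \<longleftrightarrow> val P j < val Q j"
      using arc by (auto simp: framing_in_def e)
    have out_iff: "(e', f') \<in> framing_out s \<longleftrightarrow> val P i < val Q i"
      using val_cases[OF P, of i] val_cases[OF Q, of i] ij part_pos[of i] route_length[OF P]
      by (auto simp: framing_out_def e)
    have "val P j \<noteq> val Q j" "val P i \<noteq> val Q i" using ne unfolding e by auto
    moreover have "less_route P Q" if "val P l < val Q l" "l = i \<or> l = j" for l
      using that ij unfolding less_route_def by (intro exI[of _ l]) auto
    moreover have "less_route Q P" if "val Q l < val P l" "l = i \<or> l = j" for l
      using that ij unfolding less_route_def by (intro exI[of _ l]) auto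
    ultimately show "(e, f) \<in> framing_in s \<longleftrightarrow> (e', f') \<in> framing_out s"
      unfolding in_iff out_iff using ncr by (meson linorder_neqE_nat less_asym)
  qed
qed

subsection \<open>Uniqueness of coherent decompositions\<close>

definition chain :: "(nat \<times> nat) list set \<Rightarrow> bool" where
  "chain C \<longleftrightarrow> C \<subseteq> routes s \<and> (\<forall>P\<in>C. \<forall>Q\<in>C. \<not> (less_route P Q \<and> less_route Q P))"

lemma chain_iff_coherent: "C \<subseteq> routes s \<Longrightarrow> chain C \<longleftrightarrow> (\<forall>P\<in>C. \<forall>Q\<in>C. coherent s P Q)"
  unfolding chain_def using coherent_iff by (meson subsetD)

lemma chain_routes: "chain C \<Longrightarrow> C \<subseteq> routes s"
  by (simp add: chain_def)

lemma chain_mono: "chain C \<Longrightarrow> B \<subseteq> C \<Longrightarrow> chain B"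
  unfolding chain_def by blast

lemma chainD:
  assumes "chain C" "P \<in> C" "Q \<in> C" "1 \<le> i" "i \<le> length P" "i \<le> length Q" "val P i < val Q i"
    "1 \<le> j" "j \<le> length P" "j \<le> length Q"
  shows "val P j \<le> val Q j"
proof (rule ccontr)
  assume "\<not> ?thesis"
  then have "less_route Q P" using assms unfolding less_route_def by (intro exI[of _ j]) auto
  moreover have "less_route P Q" using assms unfolding less_route_def by (intro exI[of _ i]) auto
  ultimately show False using assms unfolding chain_def by blast
qed

text \<open>Since indices decrease along a route, these are its edges up to the one that enters the
  vertex \<open>n + 1 - i\<close>. The set is empty if the route leaves the source to a later
  vertex.\<close>

definition initial_part :: "nat \<Rightarrow> (nat \<times> nat) list \<Rightarrow> (nat \<times> nat) set" where
  "initial_part i R = {e \<in> set R. i \<le> fst e}"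

lemma initial_part_1: "R \<in> routes s \<Longrightarrow> initial_part 1 R = set R"
  unfolding initial_part_def using in_route_iff by fastforce

lemma initial_part_step:
  assumes "R \<in> routes s" "1 \<le> i" "i \<le> length R"
  shows "initial_part i R = insert (i, val R i) (initial_part (Suc i) R)"
  using in_route_iff[OF assms(1)] assms(2,3)
  by (auto simp: initial_part_def Suc_le_eq le_less)

lemma initial_part_empty_iff: "R \<in> routes s \<Longrightarrow> initial_part i R = {} \<longleftrightarrow> length R < i"
  using in_route_iff[of R "length R" "val R (length R)"] route_length[of R] in_route_iff[of R]
  unfolding initial_part_def
  by (force simp: not_less)

lemma initial_part_eq_insert_iff:
  assumes "R \<in> routes s" "1 \<le> i" "E \<noteq> {}" "\<forall>e\<in>E. i < fst e"
  shows "initial_part i R = insert (i, v) E \<longleftrightarrow> (i, v) \<in> set R \<and> initial_part (Suc i) R = E"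
proof
  assume eq: "initial_part i R = insert (i, v) E"
  then have "(i, v) \<in> set R" unfolding initial_part_def by blast
  moreover have "initial_part (Suc i) R = {e \<in> initial_part i R. i < fst e}"
    unfolding initial_part_def by (auto simp: Suc_le_eq)
  then have "initial_part (Suc i) R = E" unfolding eq using assms(4) by auto
  ultimately show "(i, v) \<in> set R \<and> initial_part (Suc i) R = E" by blast
next
  assume *: "(i, v) \<in> set R \<and> initial_part (Suc i) R = E"
  then have "i \<le> length R" "val R i = v" using in_route_iff[OF assms(1)] by auto
  with initial_part_step[OF assms(1,2)] * show "initial_part i R = insert (i, v) E" by simp
qed

text \<open>The amount of the flow that arrives along the initial segment \<open>D\<close>.
  Uniqueness of decompositions is shown by determining these amounts for ever longer segments, that
  is, for decreasing \<open>i\<close>.\<close>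

definition weight :: "((nat \<times> nat) list \<Rightarrow> real) \<Rightarrow> nat \<Rightarrow> (nat \<times> nat) set \<Rightarrow> real" where
  "weight f i D = sum f {R \<in> routes s. initial_part i R = D}"

lemma weight_nonneg: "(\<And>R. R \<in> routes s \<Longrightarrow> 0 \<le> f R) \<Longrightarrow> 0 \<le> weight f i D"
  unfolding weight_def by (rule sum_nonneg) auto

lemma weight_pos_witness:
  assumes "0 < weight f i D"
  obtains R where "R \<in> routes s" "initial_part i R = D" "0 < f R"
proof -
  have "\<exists>R\<in>{R \<in> routes s. initial_part i R = D}. 0 < f R"
    using assms unfolding weight_def by (meson leI not_le sum_nonpos)
  with that show ?thesis by blast
qed

text \<open>Segments ending at the common tail of the bump and the dip of index \<open>i\<close>,
  one of which has to follow.\<close>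

abbreviation partial_routes :: "nat \<Rightarrow> (nat \<times> nat) set set" where
  "partial_routes i \<equiv> initial_part (Suc i) ` {R \<in> routes s. i < length R}"

lemma partial_routesD:
  assumes "E \<in> partial_routes i"
  shows "E \<noteq> {}" "\<forall>e\<in>E. i < fst e"
  using assms initial_part_empty_iff by (auto simp: initial_part_def)

lemma weight_split:
  assumes "1 \<le> i" "E \<in> partial_routes i"
  shows "weight f (Suc i) E = weight f i (insert (i, 0) E) + weight f i (insert (i, part s i) E)"
proof -
  obtain R0 where R0: "R0 \<in> routes s" "i < length R0" "E = initial_part (Suc i) R0"
    using assms(2) by blast
  have E: "E \<noteq> {}" "\<forall>e\<in>E. i < fst e" using partial_routesD[OF assms(2)] by auto
  have pp: "0 < part s i" using part_pos[OF assms(1)] R0 route_length[OF R0(1)] by linarith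
  have iff: "initial_part i R = insert (i, v) E \<longleftrightarrow> initial_part (Suc i) R = E \<and> val R i = v"
    if "R \<in> routes s" for R v
    using initial_part_eq_insert_iff[OF that assms(1) E, of v] in_route_iff[OF that, of i v]
      initial_part_empty_iff[OF that, of "Suc i"] E(1) assms(1) by auto
  have vals: "val R i = 0 \<or> val R i = part s i" if "R \<in> routes s" "initial_part (Suc i) R = E" for R
    using that E(1) initial_part_empty_iff[of R "Suc i"] val_cases[of R i] assms(1) by auto
  have "{R \<in> routes s. initial_part (Suc i) R = E} =
      {R \<in> routes s. initial_part i R = insert (i, 0) E} \<union>
      {R \<in> routes s. initial_part i R = insert (i, part s i) E}" (is "?A = ?B \<union> ?C")
  proof (intro set_eqI)
    fix R
    show "R \<in> ?A \<longleftrightarrow> R \<in> ?B \<union> ?C"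
      by (cases "R \<in> routes s") (use vals iff in \<open>simp_all, blast\<close>)
  qed
  moreover have "?B \<inter> ?C = {}"
  proof (intro equals0I)
    fix R assume "R \<in> ?B \<inter> ?C"
    then have "val R i = 0" "val R i = part s i" using iff[of R] by blast+
    with pp show False by simp
  qed
  ultimately show ?thesis
    unfolding weight_def using finite_routes by (simp add: sum.union_disjoint)
qed

text \<open>A bump or a dip is never the first edge of a route, so its flow is the sum over all
  segments that can precede it.\<close>

lemma sum_weight:
  assumes "1 \<le> i" "v = 0 \<or> v = part s i"
  shows "(\<Sum>E\<in>partial_routes i. weight f i (insert (i, v) E)) = sum f {R \<in> routes s. (i, v) \<in> set R}"
proof -
  let ?S = "{R \<in> routes s. (i, v) \<in> set R}"
  have len: "i < length R" if "R \<in> ?S" for R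
    using that in_route_iff[of R i v] val_first[of R] assms(2) by (cases "i = length R") auto
  have "sum f ?S = (\<Sum>E\<in>partial_routes i. sum f {R \<in> ?S. initial_part (Suc i) R = E})"
    using finite_routes len by (intro sum.group[symmetric]) auto
  also have "\<dots> = (\<Sum>E\<in>partial_routes i. weight f i (insert (i, v) E))"
  proof (rule sum.cong[OF refl])
    fix E assume E: "E \<in> partial_routes i"
    have "{R \<in> ?S. initial_part (Suc i) R = E} = {R \<in> routes s. initial_part i R = insert (i, v) E}"
      using initial_part_eq_insert_iff[OF _ assms(1) partial_routesD[OF E]] by blast
    then show "sum f {R \<in> ?S. initial_part (Suc i) R = E} = weight f i (insert (i, v) E)"
      by (simp add: weight_def)
  qed
  finally show ?thesis ..
qed

text \<open>If \<open>f\<close> sent more weight than \<open>g\<close> from \<open>D\<close> to the bump, then by coherence \<open>f\<close> would send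
  nothing to the dip from the partial routes below \<open>D\<close>, and \<open>g\<close> nothing to the bump from those
  above \<open>D\<close>, so the total weight of the bump would be larger for \<open>f\<close>.\<close>

lemma weight_bump_le:
  assumes i: "1 \<le> i"
    and f: "\<And>R. R \<in> routes s \<Longrightarrow> 0 \<le> f R" "chain {R \<in> routes s. 0 < f R}"
    and g: "\<And>R. R \<in> routes s \<Longrightarrow> 0 \<le> g R" "chain {R \<in> routes s. 0 < g R}"
    and sums: "sum f {R \<in> routes s. (i, 0) \<in> set R} = sum g {R \<in> routes s. (i, 0) \<in> set R}"
    and IH: "\<And>E. E \<in> partial_routes i \<Longrightarrow> weight f (Suc i) E = weight g (Suc i) E"
    and D: "D \<in> partial_routes i"
  shows "weight f i (insert (i, 0) D) \<le> weight g i (insert (i, 0) D)"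
proof (rule ccontr)
  assume "\<not> ?thesis"
  then have gt: "weight g i (insert (i, 0) D) < weight f i (insert (i, 0) D)" by simp
  then have "0 < weight f i (insert (i, 0) D)"
    using weight_nonneg[of g i "insert (i, 0) D", OF g(1)] by linarith
  then obtain P where P: "P \<in> routes s" "initial_part i P = insert (i, 0) D" "0 < f P"
    by (rule weight_pos_witness)
  have "0 < weight g i (insert (i, part s i) D)"
    using weight_split[OF i D, of f] weight_split[OF i D, of g] IH[OF D] gt
      weight_nonneg[of f i "insert (i, part s i) D", OF f(1)] by linarith
  then obtain Q where Q: "Q \<in> routes s" "initial_part i Q = insert (i, part s i) D" "0 < g Q"
    by (rule weight_pos_witness)
  have D': "D \<noteq> {}" "\<forall>e\<in>D. i < fst e" using partial_routesD[OF D] by auto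
  note ins = initial_part_eq_insert_iff[OF _ i]
  have P': "i < length P" "val P i = 0" "initial_part (Suc i) P = D"
    using P ins[OF P(1) D'] in_route_iff[OF P(1)] initial_part_empty_iff[OF P(1), of "Suc i"] D' by auto
  have Q': "i < length Q" "val Q i = part s i" "initial_part (Suc i) Q = D"
    using Q ins[OF Q(1) D'] in_route_iff[OF Q(1)] initial_part_empty_iff[OF Q(1), of "Suc i"] D' by auto
  have pp: "0 < part s i" using part_pos[OF i] P' route_length[OF P(1)] by linarith
  \<comment> \<open>Both routes start with the segment \<open>D\<close>, so they are interchangeable
    in comparisons above index \<open>i\<close>; \<open>P\<close> is available for the coherence of
    \<open>f\<close> and \<open>Q\<close> for that of \<open>g\<close>.\<close>
  have PQ: "length P = length Q" "\<And>j. i < j \<Longrightarrow> j \<le> length P \<Longrightarrow> val P j = val Q j"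
  proof -
    have iff: "(j, v) \<in> set P \<longleftrightarrow> (j, v) \<in> set Q" if "i < j" for j v
      using P'(3) Q'(3) that unfolding initial_part_def by (auto simp: set_eq_iff Suc_le_eq)
    show eq: "val P j = val Q j" if "i < j" "j \<le> length P" for j
      using iff[OF that(1), of "val P j"] that in_route_iff[OF P(1)] in_route_iff[OF Q(1)] by auto
    show "length P = length Q"
      by (rule length_eq_if_vals_eq[OF P(1) Q(1) P'(1) Q'(1)]) (use eq in auto)
  qed
  have le: "weight g i (insert (i, 0) E) \<le> weight f i (insert (i, 0) E)" if E: "E \<in> partial_routes i" for E
  proof (cases "E = D \<or> weight g i (insert (i, 0) E) \<le> 0")
    case True
    then show ?thesis using gt weight_nonneg[of f i "insert (i, 0) E", OF f(1)] by auto
  next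
    case False
    then have "E \<noteq> D" "0 < weight g i (insert (i, 0) E)" by auto
    from this(2) obtain R where R: "R \<in> routes s" "initial_part i R = insert (i, 0) E" "0 < g R"
      by (rule weight_pos_witness)
    have E': "E \<noteq> {}" "\<forall>e\<in>E. i < fst e" using partial_routesD[OF E] by auto
    have R': "i < length R" "val R i = 0" "initial_part (Suc i) R = E"
      using R ins[OF R(1) E'] in_route_iff[OF R(1)] initial_part_empty_iff[OF R(1), of "Suc i"] E' by auto
    \<comment> \<open>Different segments differ at a common index: agreement wherever both are
      defined would make the lengths equal too.\<close>
    have "\<exists>j. i < j \<and> j \<le> length R \<and> j \<le> length Q \<and> val R j \<noteq> val Q j"
    proof (rule ccontr)
      assume "\<not> ?thesis"
      then have eq: "val R j = val Q j" if "i < j" "j \<le> length R" "j \<le> length Q" for j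
        using that by blast
      then have "length R = length Q"
        using length_eq_if_vals_eq[OF R(1) Q(1) R'(1) Q'(1)] by blast
      with eq have "initial_part (Suc i) R = initial_part (Suc i) Q"
        using in_route_iff[OF R(1)] in_route_iff[OF Q(1)] by (auto simp: initial_part_def Suc_le_eq)
      with R' Q' \<open>E \<noteq> D\<close> show False by simp
    qed
    then obtain j where j: "i < j" "j \<le> length R" "j \<le> length Q" "val R j \<noteq> val Q j" by blast
    have "val R j \<le> val Q j"
      by (rule chainD[OF g(2), of R Q i]) (use R R' Q Q' i j pp in auto)
    with j have lt: "val R j < val P j" using PQ by simp
    have "weight f i (insert (i, part s i) E) \<le> 0"
    proof (rule ccontr)
      assume "\<not> ?thesis"
      then have "0 < weight f i (insert (i, part s i) E)" by simp
      then obtain S where S: "S \<in> routes s" "initial_part i S = insert (i, part s i) E" "0 < f S"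
        by (rule weight_pos_witness)
      have S': "i < length S" "val S i = part s i" "initial_part (Suc i) S = E"
        using S ins[OF S(1) E'] in_route_iff[OF S(1)] initial_part_empty_iff[OF S(1), of "Suc i"] E' by auto
      have "(j, val R j) \<in> initial_part (Suc i) R"
        using j i in_route_iff[OF R(1)] by (auto simp: initial_part_def)
      then have "(j, val R j) \<in> initial_part (Suc i) S" by (simp only: R'(3) S'(3))
      then have "(j, val R j) \<in> set S" by (simp add: initial_part_def)
      then have "j \<le> length S" "val S j = val R j" using in_route_iff[OF S(1)] by auto
      then have "val P j \<le> val R j"
        using chainD[OF f(2), of P S i j] P P' S S' i j pp PQ by auto
      with lt show False by simp
    qed
    then have "weight f (Suc i) E \<le> weight f i (insert (i, 0) E)"
      using weight_split[OF i E, of f] by linarith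
    moreover have "weight g i (insert (i, 0) E) \<le> weight g (Suc i) E"
      using weight_split[OF i E, of g] weight_nonneg[of g i "insert (i, part s i) E", OF g(1)] by linarith
    ultimately show ?thesis using IH[OF E] by linarith
  qed
  have "(\<Sum>E\<in>partial_routes i. weight g i (insert (i, 0) E)) < (\<Sum>E\<in>partial_routes i. weight f i (insert (i, 0) E))"
    using finite_routes le D gt by (intro sum_strict_mono_ex1) auto
  with sums show False using sum_weight[OF i, of 0] by simp
qed

text \<open>For \<open>i = 1\<close> the segments are whole routes, and their weights are the
  coefficients. In the step, bumps are settled by \<open>weight_bump_le\<close> in both directions,
  and dips receive the rest of what arrives.\<close>

lemma coherent_decomposition_unique:
  fixes f g :: "(nat \<times> nat) list \<Rightarrow> real"
  assumes f: "\<And>R. R \<in> routes s \<Longrightarrow> 0 \<le> f R" "chain {R \<in> routes s. 0 < f R}"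
    and g: "\<And>R. R \<in> routes s \<Longrightarrow> 0 \<le> g R" "chain {R \<in> routes s. 0 < g R}"
    and sums: "\<And>e. sum f {R \<in> routes s. e \<in> set R} = sum g {R \<in> routes s. e \<in> set R}"
    and R: "R \<in> routes s"
  shows "f R = g R"
proof -
  have "\<forall>D. D \<noteq> {} \<longrightarrow> weight f i D = weight g i D" if "1 \<le> i" "i \<le> Suc (Suc n)" for i
    using that(2,1)
  proof (induction rule: inc_induct)
    case base
    show ?case
    proof (intro allI impI)
      fix D :: "(nat \<times> nat) set" assume "D \<noteq> {}"
      have "initial_part (Suc (Suc n)) R = {}" if "R \<in> routes s" for R
        using initial_part_empty_iff[OF that] route_length[OF that] by simp
      with \<open>D \<noteq> {}\<close> have "{R \<in> routes s. initial_part (Suc (Suc n)) R = D} = {}" by auto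
      then show "weight f (Suc (Suc n)) D = weight g (Suc (Suc n)) D" by (simp only: weight_def sum.empty)
    qed
  next
    case (step i)
    have IH: "weight f (Suc i) E = weight g (Suc i) E" if "E \<in> partial_routes i" for E
      using step.IH partial_routesD(1)[OF that] by auto
    have bump: "weight f i (insert (i, 0) E) = weight g i (insert (i, 0) E)" if "E \<in> partial_routes i" for E
      by (intro antisym weight_bump_le) (use step.prems f g sums IH that in auto)
    have dip: "weight f i (insert (i, part s i) E) = weight g i (insert (i, part s i) E)"
      if "E \<in> partial_routes i" for E
      using weight_split[OF step.prems that] IH[OF that] bump[OF that] by (metis add_left_cancel)
    show ?case
    proof (intro allI impI)
      fix D :: "(nat \<times> nat) set" assume "D \<noteq> {}"
      show "weight f i D = weight g i D"
      proof (cases "\<exists>R\<in>routes s. initial_part i R = D")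
        case False
        then have "{R \<in> routes s. initial_part i R = D} = {}" by blast
        then show ?thesis by (simp only: weight_def sum.empty)
      next
        case True
        then obtain R where R: "R \<in> routes s" "initial_part i R = D" by blast
        have il: "i \<le> length R" using R \<open>D \<noteq> {}\<close> initial_part_empty_iff[OF R(1), of i] by simp
        have D: "D = insert (i, val R i) (initial_part (Suc i) R)"
          using initial_part_step[OF R(1) step.prems il] R by simp
        show ?thesis
        proof (cases "i = length R")
          case True
          \<comment> \<open>A source edge is an entire segment: every route through it begins with
            it, so the weight is the given flow on that edge.\<close>
          have v: "0 < val R i" "val R i < part s i" using val_first[OF R(1)] True by auto
          have "initial_part (Suc i) Q = {}" if "Q \<in> routes s" "(i, val R i) \<in> set Q" for Q
            using that in_route_iff[of Q i "val R i"] val_cases[of Q i] v initial_part_empty_iff[of Q "Suc i"]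
            by (cases "i = length Q") auto
          then have "initial_part i Q = D" if "Q \<in> routes s" "(i, val R i) \<in> set Q" for Q
            using that R(1) in_route_iff[of Q] in_route_iff[of R] il step.prems
              initial_part_step[of Q i] D by (metis)
          moreover have "(i, val R i) \<in> set Q" if "initial_part i Q = D" for Q
            using that D unfolding initial_part_def by blast
          ultimately have "{Q \<in> routes s. initial_part i Q = D} = {Q \<in> routes s. (i, val R i) \<in> set Q}"
            by blast
          then show ?thesis using sums by (simp only: weight_def)
        next
          case False
          then have "initial_part (Suc i) R \<in> partial_routes i" using R il by auto
          then show ?thesis
            using bump[of "initial_part (Suc i) R"] dip[of "initial_part (Suc i) R"]
              val_cases[OF R(1) step.prems] False il by (subst (1 2) D) auto
        qed
      qed
    qed
  qed
  then have "weight f 1 (set R) = weight g 1 (set R)"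
    using route_length[OF R] by (cases R) auto
  moreover have "{Q \<in> routes s. initial_part 1 Q = set R} = {R}"
    using initial_part_1 R inj_onD[OF set_route_inj] by auto
  ultimately show ?thesis by (simp add: weight_def)
qed

end

subsection \<open>Simplices of the triangulation\<close>

lemma lookup_scaleR:
  fixes x :: "'a \<Rightarrow>\<^sub>0 'b::real_vector"
  shows "Poly_Mapping.lookup (r *\<^sub>R x) e = r *\<^sub>R Poly_Mapping.lookup x e"
proof -
  have "finite {e. r *\<^sub>R Poly_Mapping.lookup x e \<noteq> 0}"
    by (rule finite_subset[OF _ finite_lookup[of x]]) auto
  then show ?thesis by (simp add: scaleR_poly_mapping_def)
qed

text \<open>The distance sums the coordinate distances over both supports, outside of which both
  coordinates vanish.\<close>

lemma dist_lookup_le: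
  fixes x y :: "'a \<Rightarrow>\<^sub>0 'b::real_normed_vector"
  shows "dist (Poly_Mapping.lookup x e) (Poly_Mapping.lookup y e) \<le> dist x y"
proof (cases "e \<in> Poly_Mapping.keys x \<union> Poly_Mapping.keys y")
  case True
  then show ?thesis
    unfolding dist_poly_mapping_def
    by (intro member_le_sum[where f = "\<lambda>e. dist (Poly_Mapping.lookup x e) (Poly_Mapping.lookup y e)"]) auto
next
  case False
  then show ?thesis by (simp add: in_keys_iff)
qed

lemma lookup_route_vector:
  "Poly_Mapping.lookup (route_vector p) e = (if e \<in> set p then 1 else 0)"
  by (simp add: route_vector_def lookup_sum lookup_single when_def)

context composition begin

lemma route_vector_inj: "inj_on route_vector (routes s)"
proof (rule inj_onI)
  fix R Q assume "R \<in> routes s" "Q \<in> routes s" "route_vector R = route_vector Q"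
  moreover from this(3) have "set R = set Q"
    by (metis (full_types) lookup_route_vector subsetI subset_antisym zero_neq_one)
  ultimately show "R = Q" using inj_onD[OF set_route_inj] by blast
qed

text \<open>Coefficients are functions on all routes, zero outside the set in question, so that
  decompositions over different sets can be compared.\<close>

definition mix :: "((nat \<times> nat) list \<Rightarrow> real) \<Rightarrow> (nat \<times> nat) \<Rightarrow>\<^sub>0 real" where
  "mix f = (\<Sum>R\<in>routes s. f R *\<^sub>R route_vector R)"

lemma lookup_mix: "Poly_Mapping.lookup (mix f) e = sum f {R \<in> routes s. e \<in> set R}"
  unfolding mix_def lookup_sum lookup_scaleR lookup_route_vector
  using finite_routes by (auto intro!: sum.mono_neutral_cong_right split: if_splits)

lemma mem_route_hull_iff:
  assumes "C \<subseteq> routes s"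
  shows "x \<in> convex hull (route_vector ` C) \<longleftrightarrow>
    (\<exists>f. (\<forall>R\<in>routes s. 0 \<le> f R) \<and> (\<forall>R\<in>routes s - C. f R = 0) \<and> sum f (routes s) = 1 \<and> x = mix f)"
    (is "_ \<longleftrightarrow> ?rhs")
proof -
  have fin: "finite C" using finite_routes assms finite_subset by blast
  have inj: "inj_on route_vector C" using route_vector_inj assms inj_on_subset by blast
  have sum_eq: "sum g C = sum g (routes s)" if "\<forall>R\<in>routes s - C. g R = 0"
    for g :: "(nat \<times> nat) list \<Rightarrow> 'a::comm_monoid_add"
    using that by (intro sum.mono_neutral_left finite_routes assms) auto
  show ?thesis
  proof
    assume "x \<in> convex hull (route_vector ` C)"
    then obtain u where u: "\<forall>y\<in>route_vector ` C. 0 \<le> u y" "sum u (route_vector ` C) = 1"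
      "(\<Sum>y\<in>route_vector ` C. u y *\<^sub>R y) = x"
      unfolding convex_hull_finite[OF finite_imageI[OF fin]] by blast
    define f where "f R = (if R \<in> C then u (route_vector R) else 0)" for R
    have "sum f (routes s) = sum f C" by (rule sum_eq[symmetric]) (simp add: f_def)
    also have "\<dots> = 1" using u(2) by (simp add: f_def sum.reindex[OF inj])
    finally have 1: "sum f (routes s) = 1" .
    have "mix f = (\<Sum>R\<in>C. f R *\<^sub>R route_vector R)"
      unfolding mix_def by (rule sum_eq[symmetric]) (simp add: f_def)
    also have "\<dots> = x" using u(3) by (simp add: f_def sum.reindex[OF inj])
    finally have "x = mix f" ..
    with 1 u(1) show ?rhs by (intro exI[of _ f]) (auto simp: f_def)
  next
    assume ?rhs
    then obtain f where f: "\<forall>R\<in>routes s. 0 \<le> f R" "\<forall>R\<in>routes s - C. f R = 0"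
      "sum f (routes s) = 1" "x = mix f" by blast
    have "mix f = (\<Sum>R\<in>C. f R *\<^sub>R route_vector R)"
      unfolding mix_def by (rule sum_eq[symmetric]) (simp add: f(2))
    moreover have "sum f C = 1" using sum_eq[OF f(2)] f(3) by simp
    ultimately show "x \<in> convex hull (route_vector ` C)"
      unfolding f(4) using f(1) assms
      by (auto intro!: convex_sum[OF fin convex_convex_hull] intro: hull_inc)
  qed
qed

lemma mix_unique:
  assumes "chain C" "chain C'"
    and f: "\<forall>R\<in>routes s. 0 \<le> f R" "\<forall>R\<in>routes s - C. f R = 0"
    and g: "\<forall>R\<in>routes s. 0 \<le> g R" "\<forall>R\<in>routes s - C'. g R = 0"
    and eq: "mix f = mix g" and R: "R \<in> routes s"
  shows "f R = g R"
proof (rule coherent_decomposition_unique[OF _ _ _ _ _ R])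
  show "chain {R \<in> routes s. 0 < f R}" by (rule chain_mono[OF assms(1)]) (use f in force)
  show "chain {R \<in> routes s. 0 < g R}" by (rule chain_mono[OF assms(2)]) (use g in force)
  show "sum f {R \<in> routes s. e \<in> set R} = sum g {R \<in> routes s. e \<in> set R}" for e
    using eq by (simp flip: lookup_mix)
qed (use f g in auto)

text \<open>A common point has a coherent decomposition over each set. The two coincide, so the
  coefficients vanish outside the intersection.\<close>

lemma hull_Int:
  assumes "chain C" "chain C'"
  shows "convex hull (route_vector ` C) \<inter> convex hull (route_vector ` C') =
    convex hull (route_vector ` (C \<inter> C'))"
proof
  show "convex hull (route_vector ` (C \<inter> C')) \<subseteq>
    convex hull (route_vector ` C) \<inter> convex hull (route_vector ` C')"
    by (intro Int_greatest hull_mono) auto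
  show "convex hull (route_vector ` C) \<inter> convex hull (route_vector ` C') \<subseteq>
    convex hull (route_vector ` (C \<inter> C'))"
  proof
    fix x assume x: "x \<in> convex hull (route_vector ` C) \<inter> convex hull (route_vector ` C')"
    have sub: "C \<subseteq> routes s" "C' \<subseteq> routes s" "C \<inter> C' \<subseteq> routes s"
      using assms chain_routes by auto
    obtain f where f: "\<forall>R\<in>routes s. 0 \<le> f R" "\<forall>R\<in>routes s - C. f R = 0"
      "sum f (routes s) = 1" "x = mix f"
      using x mem_route_hull_iff[OF sub(1)] by blast
    obtain g where g: "\<forall>R\<in>routes s. 0 \<le> g R" "\<forall>R\<in>routes s - C'. g R = 0" "x = mix g"
      using x mem_route_hull_iff[OF sub(2)] by blast
    have "f R = g R" if "R \<in> routes s" for R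
      using mix_unique[OF assms f(1,2) g(1,2)] f(4) g(3) that by simp
    then have "\<forall>R\<in>routes s - C \<inter> C'. f R = 0" using f(2) g(2) by auto
    with f show "x \<in> convex hull (route_vector ` (C \<inter> C'))"
      unfolding mem_route_hull_iff[OF sub(3)] by blast
  qed
qed

text \<open>A vertex is decomposed by its own route alone, and a singleton is a chain; uniqueness
  against a decomposition over \<open>C'\<close> puts the route into \<open>C'\<close>.\<close>

lemma hull_subset_iff:
  assumes "C \<subseteq> routes s" "chain C'"
  shows "convex hull (route_vector ` C) \<subseteq> convex hull (route_vector ` C') \<longleftrightarrow> C \<subseteq> C'"
proof
  assume sub: "convex hull (route_vector ` C) \<subseteq> convex hull (route_vector ` C')"
  show "C \<subseteq> C'"
  proof
    fix R assume R: "R \<in> C"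
    then have Rr: "R \<in> routes s" using assms by blast
    then have ch: "chain {R}" by (auto simp: chain_def less_route_def)
    have "route_vector R \<in> convex hull (route_vector ` C')"
      using sub R by (meson hull_inc image_eqI subsetD)
    then obtain g where g: "\<forall>R\<in>routes s. 0 \<le> g R" "\<forall>R\<in>routes s - C'. g R = 0"
      "route_vector R = mix g"
      using mem_route_hull_iff[OF chain_routes[OF assms(2)]] by blast
    let ?f = "\<lambda>Q. if Q = R then 1 else 0 :: real"
    have "mix ?f = route_vector R"
      unfolding mix_def using finite_routes Rr
      by (simp add: if_distrib[of "\<lambda>a. a *\<^sub>R _"] sum.delta cong: if_cong)
    then have "?f R = g R"
      using mix_unique[OF ch assms(2) _ _ g(1,2) _ Rr, of ?f] g(3) by simp
    then show "R \<in> C'" using g(2) Rr by (metis DiffI zero_neq_one)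
  qed
qed (meson hull_mono image_mono)

section \<open>The flow polytope described by linear conditions\<close>

definition inflow :: "((nat \<times> nat) \<Rightarrow>\<^sub>0 real) \<Rightarrow> nat \<Rightarrow> real" where
  "inflow y i = (\<Sum>t\<le>part s i. Poly_Mapping.lookup y (i, t))"

definition outflow :: "((nat \<times> nat) \<Rightarrow>\<^sub>0 real) \<Rightarrow> nat \<Rightarrow> real" where
  "outflow y i = Poly_Mapping.lookup y (i, 0) + Poly_Mapping.lookup y (i, part s i)"

text \<open>Conservation at the vertex \<open>n - i\<close>, which the edges of index
  \<open>Suc i\<close> enter and the bump and the dip of index \<open>i\<close> leave. The total
  flow is \<open>inflow y 1\<close>, the flow into the sink.\<close>

definition flows :: "((nat \<times> nat) \<Rightarrow>\<^sub>0 real) set" where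
  "flows = {y. (\<forall>e. e \<notin> arcs (oruga s) \<longrightarrow> Poly_Mapping.lookup y e = 0) \<and>
    (\<forall>i. 1 \<le> i \<and> i \<le> n \<longrightarrow> outflow y i = inflow y (Suc i))}"

lemma flows_support: "y \<in> flows \<Longrightarrow> e \<notin> arcs (oruga s) \<Longrightarrow> Poly_Mapping.lookup y e = 0"
  unfolding flows_def by blast

lemma inflow_add: "inflow (x + y) i = inflow x i + inflow y i"
  by (simp add: inflow_def lookup_add sum.distrib)

lemma inflow_scaleR: "inflow (r *\<^sub>R x) i = r * inflow x i"
  by (simp add: inflow_def lookup_scaleR sum_distrib_left)

lemma outflow_add: "outflow (x + y) i = outflow x i + outflow y i"
  by (simp add: outflow_def lookup_add)

lemma outflow_scaleR: "outflow (r *\<^sub>R x) i = r * outflow x i"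
  by (simp add: outflow_def lookup_scaleR distrib_left)

lemma inflow_route:
  assumes "R \<in> routes s" "1 \<le> i"
  shows "inflow (route_vector R) i = (if i \<le> length R then 1 else 0)"
proof -
  have "inflow (route_vector R) i = (\<Sum>t\<le>part s i. if i \<le> length R \<and> t = val R i then 1 else 0)"
    unfolding inflow_def lookup_route_vector using in_route_iff[OF assms(1)] assms(2)
    by (intro sum.cong) auto
  also have "\<dots> = (if i \<le> length R then 1 else 0)"
    using val_le[OF assms] by (cases "i \<le> length R") (auto simp: sum.delta)
  finally show ?thesis .
qed

lemma outflow_route:
  assumes "R \<in> routes s" "1 \<le> i" "i \<le> n"
  shows "outflow (route_vector R) i = (if i < length R then 1 else 0)"
proof -
  have iff: "(i, t) \<in> set R \<longleftrightarrow> i \<le> length R \<and> val R i = t" for t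
    using in_route_iff[OF assms(1)] assms(2) by simp
  have "0 < part s i" using part_pos assms by simp
  then show ?thesis
    unfolding outflow_def lookup_route_vector iff
    using val_cases[OF assms(1,2)] val_first[OF assms(1)]
    by (cases "i = length R") auto
qed

lemma route_in_flows: "R \<in> routes s \<Longrightarrow> route_vector R \<in> flows"
  using route_arcs[of R] by (auto simp: flows_def lookup_route_vector inflow_route outflow_route)

lemma flows_combination: "x \<in> flows \<Longrightarrow> y \<in> flows \<Longrightarrow> u *\<^sub>R x + v *\<^sub>R y \<in> flows"
  by (simp add: flows_def lookup_add lookup_scaleR inflow_add inflow_scaleR outflow_add outflow_scaleR)

lemma finite_arcs: "finite (arcs (oruga s))"
proof (rule finite_subset)
  show "arcs (oruga s) \<subseteq> (SIGMA i:{1..Suc n}. {..part s i})" by (auto simp: arcs_iff)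
qed auto

text \<open>The route is traced backwards from the sink: a vertex with positive inflow has a
  positive incoming edge. Either this is a source edge, or conservation gives positive inflow at its
  tail.\<close>

lemma ex_route_in_support:
  assumes y: "y \<in> flows" "\<And>e. 0 \<le> Poly_Mapping.lookup y e" and "0 < inflow y 1"
  shows "\<exists>R\<in>routes s. \<forall>e\<in>set R. 0 < Poly_Mapping.lookup y e"
proof -
  have "0 < inflow y i \<longrightarrow> (\<exists>k f. i \<le> k \<and> k \<le> Suc n \<and> 0 < f k \<and> f k < part s k \<and>
    (\<forall>j. i \<le> j \<and> j < k \<longrightarrow> f j = 0 \<or> f j = part s j) \<and>
    (\<forall>j. i \<le> j \<and> j \<le> k \<longrightarrow> 0 < Poly_Mapping.lookup y (j, f j)))" if "1 \<le> i" "i \<le> Suc n" for i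
    using that(2,1)
  proof (induction rule: inc_induct)
    case base
    show ?case
    proof
      assume "0 < inflow y (Suc n)"
      then obtain t where t: "0 < Poly_Mapping.lookup y (Suc n, t)"
        unfolding inflow_def by (meson leI not_le sum_nonpos)
      \<comment> \<open>Index \<open>Suc n\<close> has source edges only, so the tracing ends here
        at the latest.\<close>
      then have "(Suc n, t) \<in> arcs (oruga s)" using flows_support[OF y(1)] by force
      then have "0 < t" "t < part s (Suc n)" by (auto simp: arcs_iff)
      with t show "\<exists>k f. Suc n \<le> k \<and> k \<le> Suc n \<and> 0 < f k \<and> f k < part s k \<and>
        (\<forall>j. Suc n \<le> j \<and> j < k \<longrightarrow> f j = 0 \<or> f j = part s j) \<and>
        (\<forall>j. Suc n \<le> j \<and> j \<le> k \<longrightarrow> 0 < Poly_Mapping.lookup y (j, f j))"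
        by (intro exI[of _ "Suc n"] exI[of _ "\<lambda>_. t"]) auto
    qed
  next
    case (step i)
    show ?case
    proof
      assume "0 < inflow y i"
      then obtain t where t: "t \<le> part s i" "0 < Poly_Mapping.lookup y (i, t)"
        unfolding inflow_def by (meson atMost_iff leI not_le sum_nonpos)
      show "\<exists>k f. i \<le> k \<and> k \<le> Suc n \<and> 0 < f k \<and> f k < part s k \<and>
        (\<forall>j. i \<le> j \<and> j < k \<longrightarrow> f j = 0 \<or> f j = part s j) \<and>
        (\<forall>j. i \<le> j \<and> j \<le> k \<longrightarrow> 0 < Poly_Mapping.lookup y (j, f j))"
      proof (cases "0 < t \<and> t < part s i")
        case True
        with t step.hyps show ?thesis by (intro exI[of _ i] exI[of _ "\<lambda>_. t"]) auto
      next
        case False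
        with t have t': "t = 0 \<or> t = part s i" by auto
        have "0 < outflow y i"
          unfolding outflow_def using t(2) t' y(2)[of "(i, 0)"] y(2)[of "(i, part s i)"] by auto
        then have "0 < inflow y (Suc i)" using y(1) step by (auto simp: flows_def)
        with step.IH obtain k f where k: "Suc i \<le> k" "k \<le> Suc n" "0 < f k" "f k < part s k"
          "\<And>j. Suc i \<le> j \<Longrightarrow> j < k \<Longrightarrow> f j = 0 \<or> f j = part s j"
          "\<And>j. Suc i \<le> j \<Longrightarrow> j \<le> k \<Longrightarrow> 0 < Poly_Mapping.lookup y (j, f j)"
          by auto
        have "(f(i := t)) j = 0 \<or> (f(i := t)) j = part s j" if "i \<le> j" "j < k" for j
          using that k(5)[of j] t' by (cases "j = i") auto
        moreover have "0 < Poly_Mapping.lookup y (j, (f(i := t)) j)" if "i \<le> j" "j \<le> k" for j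
          using that k(6)[of j] t by (cases "j = i") auto
        ultimately show ?thesis
          using k(1-4) by (intro exI[of _ k] exI[of _ "f(i := t)"]) auto
      qed
    qed
  qed
  from this[of 1] assms(3) obtain k f where k: "1 \<le> k" "k \<le> Suc n" "0 < f k" "f k < part s k"
    "\<forall>j. 1 \<le> j \<and> j < k \<longrightarrow> f j = 0 \<or> f j = part s j"
    "\<forall>j. 1 \<le> j \<and> j \<le> k \<longrightarrow> 0 < Poly_Mapping.lookup y (j, f j)"
    by auto
  then have "mk_route k f \<in> routes s" unfolding routes_eq valid_route_def by blast
  with k(6) show ?thesis by (intro bexI[of _ "mk_route k f"]) (auto simp: set_mk_route)
qed

text \<open>All summands of a vanishing inflow are zero, and conservation carries this from the sink
  back to the earlier vertices.\<close>

lemma flow_zero: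
  assumes y: "y \<in> flows" "\<And>e. 0 \<le> Poly_Mapping.lookup y e" and "inflow y 1 = 0"
  shows "y = 0"
proof -
  have zero: "Poly_Mapping.lookup y (i, t) = 0" if "inflow y i = 0" "t \<le> part s i" for i t
    using that y(2) unfolding inflow_def by (subst (asm) sum_nonneg_eq_0_iff) auto
  have inflow: "inflow y i = 0" if "1 \<le> i" "i \<le> Suc n" for i
    using that
  proof (induction i rule: dec_induct)
    case (step i)
    then have "outflow y i = 0" using zero[of i] by (simp add: outflow_def)
    then show ?case using y(1) step by (auto simp: flows_def)
  qed (use assms in simp)
  have "Poly_Mapping.lookup y (i, t) = 0" for i t
  proof (cases "(i, t) \<in> arcs (oruga s)")
    case True
    then show ?thesis using zero[of i t] inflow[of i] by (auto simp: arcs_iff)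
  qed (rule flows_support[OF y(1)])
  then show ?thesis by (intro poly_mapping_eqI) auto
qed

text \<open>Subtracting a route of the support, multiplied by the least amount on its edges, keeps
  the flow nonnegative and empties at least one edge.\<close>

lemma flow_decomposition:
  assumes "y \<in> flows" "\<And>e. 0 \<le> Poly_Mapping.lookup y e"
  shows "\<exists>f. (\<forall>R\<in>routes s. 0 \<le> f R) \<and> y = mix f"
  using assms
proof (induction "card {e \<in> arcs (oruga s). 0 < Poly_Mapping.lookup y e}" arbitrary: y rule: less_induct)
  case less
  show ?case
  proof (cases "inflow y 1 = 0")
    case True
    then have "y = 0" using flow_zero less.prems by blast
    then show ?thesis by (intro exI[of _ "\<lambda>_. 0"]) (simp add: mix_def)
  next
    case False
    have "0 \<le> inflow y 1" unfolding inflow_def using less.prems by (intro sum_nonneg) auto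
    with False obtain R where R: "R \<in> routes s" "\<forall>e\<in>set R. 0 < Poly_Mapping.lookup y e"
      using ex_route_in_support[OF less.prems] by force
    have "set R \<noteq> {}" using route_length[OF R(1)] by auto
    define c where "c = Min (Poly_Mapping.lookup y ` set R)"
    have "c \<in> Poly_Mapping.lookup y ` set R"
      unfolding c_def using \<open>set R \<noteq> {}\<close> by (intro Min_in) auto
    then obtain e0 where e0: "e0 \<in> set R" "c = Poly_Mapping.lookup y e0" by blast
    have cle: "c \<le> Poly_Mapping.lookup y e" if "e \<in> set R" for e
      unfolding c_def using that by (intro Min_le) auto
    have "0 < c" using e0 R by simp
    define y' where y'_def: "y' = 1 *\<^sub>R y + (- c) *\<^sub>R route_vector R"
    have lk: "Poly_Mapping.lookup y' e = Poly_Mapping.lookup y e - (if e \<in> set R then c else 0)" for e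
      unfolding y'_def lookup_add lookup_scaleR lookup_route_vector by simp
    have "y' \<in> flows" unfolding y'_def using less.prems R route_in_flows flows_combination by blast
    moreover have "0 \<le> Poly_Mapping.lookup y' e" for e
      using cle[of e] less.prems(2)[of e] by (simp add: lk)
    moreover have "card {e \<in> arcs (oruga s). 0 < Poly_Mapping.lookup y' e}
        < card {e \<in> arcs (oruga s). 0 < Poly_Mapping.lookup y e}"
    proof (rule psubset_card_mono)
      have "e0 \<in> {e \<in> arcs (oruga s). 0 < Poly_Mapping.lookup y e}"
        using e0 R route_arcs[OF R(1)] by auto
      moreover have "e0 \<notin> {e \<in> arcs (oruga s). 0 < Poly_Mapping.lookup y' e}"
        using e0 by (simp add: lk)
      moreover have "{e \<in> arcs (oruga s). 0 < Poly_Mapping.lookup y' e}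
          \<subseteq> {e \<in> arcs (oruga s). 0 < Poly_Mapping.lookup y e}"
        using \<open>0 < c\<close> by (auto simp: lk split: if_splits)
      ultimately show "{e \<in> arcs (oruga s). 0 < Poly_Mapping.lookup y' e}
          \<subset> {e \<in> arcs (oruga s). 0 < Poly_Mapping.lookup y e}" by blast
    qed (use finite_arcs in auto)
    ultimately obtain f where f: "\<forall>R\<in>routes s. 0 \<le> f R" "y' = mix f"
      using less.hyps by blast
    let ?g = "\<lambda>Q. f Q + (if Q = R then c else 0)"
    have "mix ?g = mix f + (\<Sum>Q\<in>routes s. (if Q = R then c else 0) *\<^sub>R route_vector Q)"
      by (simp add: mix_def scaleR_add_left sum.distrib)
    also have "(\<Sum>Q\<in>routes s. (if Q = R then c else 0) *\<^sub>R route_vector Q) = c *\<^sub>R route_vector R"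
      using finite_routes R(1)
      by (simp add: if_distrib[of "\<lambda>a. a *\<^sub>R _"] sum.delta cong: if_cong)
    also have "mix f + c *\<^sub>R route_vector R = y"
      unfolding f(2)[symmetric] y'_def by simp
    finally have "y = mix ?g" ..
    with f(1) \<open>0 < c\<close> show ?thesis by (intro exI[of _ ?g]) auto
  qed
qed

lemma inflow_mix: "inflow (mix f) 1 = sum f (routes s)"
proof -
  have "inflow (mix f) 1 = (\<Sum>R\<in>routes s. f R * inflow (route_vector R) 1)"
    unfolding mix_def inflow_def lookup_sum lookup_scaleR
    by (subst sum.swap) (simp add: sum_distrib_left)
  also have "\<dots> = sum f (routes s)"
    using inflow_route[of _ 1] route_length by (intro sum.cong) auto
  finally show ?thesis .
qed

lemma flow_polytope_eq:
  "flow_polytope s = {y \<in> flows. inflow y 1 = 1 \<and> (\<forall>e. 0 \<le> Poly_Mapping.lookup y e)}"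
proof -
  have mix: "mix f \<in> flows" for f
  proof -
    have "(\<Sum>R\<in>S. f R *\<^sub>R route_vector R) \<in> flows" if "finite S" "S \<subseteq> routes s" for S
      using that
    proof (induction S rule: finite_induct)
      case empty
      show ?case by (simp add: flows_def inflow_def outflow_def)
    next
      case (insert R S)
      then show ?case using flows_combination[of "route_vector R" _ "f R" 1] route_in_flows by simp
    qed
    then show ?thesis unfolding mix_def using finite_routes by blast
  qed
  show ?thesis
  proof (intro set_eqI iffI)
    fix y assume "y \<in> flow_polytope s"
    then obtain f where f: "\<forall>R\<in>routes s. 0 \<le> f R" "sum f (routes s) = 1" "y = mix f"
      unfolding flow_polytope_def mem_route_hull_iff[OF order_refl] by blast
    then show "y \<in> {y \<in> flows. inflow y 1 = 1 \<and> (\<forall>e. 0 \<le> Poly_Mapping.lookup y e)}"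
      using mix inflow_mix by (auto simp: lookup_mix intro!: sum_nonneg)
  next
    fix y assume "y \<in> {y \<in> flows. inflow y 1 = 1 \<and> (\<forall>e. 0 \<le> Poly_Mapping.lookup y e)}"
    then show "y \<in> flow_polytope s"
      unfolding flow_polytope_def mem_route_hull_iff[OF order_refl]
      using flow_decomposition[of y] inflow_mix by force
  qed
qed

lemma affine_hull_flow_polytope: "affine hull (flow_polytope s) \<subseteq> {y \<in> flows. inflow y 1 = 1}"
proof (rule hull_minimal)
  show "flow_polytope s \<subseteq> {y \<in> flows. inflow y 1 = 1}" by (auto simp: flow_polytope_eq)
  show "affine {y \<in> flows. inflow y 1 = 1}"
    unfolding affine_def using flows_combination by (auto simp: inflow_add inflow_scaleR)
qed

section \<open>Interior simplices\<close>

definition covering :: "(nat \<times> nat) list set \<Rightarrow> bool" where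
  "covering C \<longleftrightarrow> (\<forall>e\<in>arcs (oruga s). \<exists>R\<in>C. e \<in> set R)"

lemma covering_routes: "covering (routes s)"
  unfolding covering_def
proof (clarify)
  fix i t assume "(i, t) \<in> arcs (oruga s)"
  then consider "1 \<le> i" "i \<le> Suc n" "1 \<le> t" "t < part s i" | "1 \<le> i" "i \<le> n" "t = 0 \<or> t = part s i"
    unfolding arcs_iff by blast
  then show "\<exists>R\<in>routes s. (i, t) \<in> set R"
  proof cases
    case 1
    let ?f = "\<lambda>j. if j = i then t else 0"
    have "mk_route i ?f \<in> routes s"
      using 1 unfolding routes_eq valid_route_def by (intro CollectI exI[of _ i] exI[of _ ?f]) auto
    then show ?thesis using 1 by (intro bexI[of _ "mk_route i ?f"]) (auto simp: set_mk_route)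
  next
    case 2
    let ?f = "\<lambda>j. if j = i then t else if j = Suc n then 1 else 0"
    have "mk_route (Suc n) ?f \<in> routes s"
      using 2 part_last unfolding routes_eq valid_route_def
      by (intro CollectI exI[of _ "Suc n"] exI[of _ ?f]) auto
    then show ?thesis using 2 by (intro bexI[of _ "mk_route (Suc n) ?f"]) (auto simp: set_mk_route)
  qed
qed

text \<open>The barycentre of a covering set is positive on all edges, hence relatively interior. If
  an edge \<open>e\<close> is missed, its coordinate vanishes on the simplex while some route uses
  \<open>e\<close>; moving away from that route leaves the polytope at once.\<close>

lemma hull_subset_frontier_iff:
  assumes C: "C \<subseteq> routes s" "C \<noteq> {}"
  shows "convex hull (route_vector ` C) \<subseteq> rel_frontier (flow_polytope s) \<longleftrightarrow> \<not> covering C"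
proof
  assume front: "convex hull (route_vector ` C) \<subseteq> rel_frontier (flow_polytope s)"
  show "\<not> covering C"
  proof
    assume cov: "covering C"
    have fin: "finite C" using C finite_routes finite_subset by blast
    then have card: "0 < card C" using C by (simp add: card_gt_0_iff)
    define f where "f R = (if R \<in> C then 1 / real (card C) else 0)" for R
    have "sum f (routes s) = sum f C"
      using C finite_routes by (intro sum.mono_neutral_right) (auto simp: f_def)
    then have sum1: "sum f (routes s) = 1" using card by (simp add: f_def)
    then have x: "mix f \<in> convex hull (route_vector ` C)"
      unfolding mem_route_hull_iff[OF C(1)] by (intro exI[of _ f]) (auto simp: f_def)
    then have xP: "mix f \<in> flow_polytope s"
      unfolding flow_polytope_def using C(1) by (meson hull_mono image_mono subsetD)
    have pos: "1 / card C \<le> Poly_Mapping.lookup (mix f) e" if e: "e \<in> arcs (oruga s)" for e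
    proof -
      obtain R where R: "R \<in> C" "e \<in> set R" 
        using bspec[OF cov[unfolded covering_def] e] by blast
      have "f R \<le> sum f {R \<in> routes s. e \<in> set R}"
        using R C finite_routes by (intro member_le_sum) (auto simp: f_def)
      then show ?thesis using R by (simp add: lookup_mix f_def)
    qed
    \<comment> \<open>Inside the affine hull only nonnegativity can fail. A coordinate changes by
      less than the radius, and every edge carries at least \<open>1 / card C\<close>.\<close>
    have "ball (mix f) (1 / card C) \<inter> affine hull (flow_polytope s) \<subseteq> flow_polytope s"
    proof
      fix y assume y: "y \<in> ball (mix f) (1 / card C) \<inter> affine hull (flow_polytope s)"
      have yf: "y \<in> flows" "inflow y 1 = 1" using y affine_hull_flow_polytope by auto
      have "0 \<le> Poly_Mapping.lookup y e" for e
      proof (cases "e \<in> arcs (oruga s)")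
        case True
        have "dist (Poly_Mapping.lookup (mix f) e) (Poly_Mapping.lookup y e) < 1 / card C"
          using y dist_lookup_le[of "mix f" e y] by auto
        with pos[OF True] show ?thesis by (auto simp: dist_real_def abs_less_iff)
      next
        case False
        then show ?thesis using flows_support[OF yf(1)] by simp
      qed
      with yf show "y \<in> flow_polytope s" by (simp add: flow_polytope_eq)
    qed
    then have "mix f \<in> rel_interior (flow_polytope s)"
      unfolding mem_rel_interior_ball using xP card by (intro conjI exI[of _ "1 / card C"]) auto
    with x front show False by (auto simp: rel_frontier_def)
  qed
next
  assume "\<not> covering C"
  then obtain e where e: "e \<in> arcs (oruga s)" "\<forall>R\<in>C. e \<notin> set R" unfolding covering_def by blast
  obtain Q where Q: "Q \<in> routes s" "e \<in> set Q" using covering_routes e unfolding covering_def by blast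
  show "convex hull (route_vector ` C) \<subseteq> rel_frontier (flow_polytope s)"
  proof
    fix x assume x: "x \<in> convex hull (route_vector ` C)"
    then obtain f where f: "\<forall>R\<in>routes s - C. f R = 0" "x = mix f"
      unfolding mem_route_hull_iff[OF C(1)] by blast
    have xe: "Poly_Mapping.lookup x e = 0"
      unfolding f(2) lookup_mix using f(1) e(2) by (intro sum.neutral) auto
    have xP: "x \<in> flow_polytope s"
      unfolding flow_polytope_def using x C(1) by (meson hull_mono image_mono subsetD)
    have QP: "route_vector Q \<in> flow_polytope s"
      unfolding flow_polytope_def using Q by (simp add: hull_inc)
    have "x \<notin> rel_interior (flow_polytope s)"
    proof
      assume "x \<in> rel_interior (flow_polytope s)"
      then obtain r where r: "0 < r" "ball x r \<inter> affine hull (flow_polytope s) \<subseteq> flow_polytope s"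
        unfolding mem_rel_interior_ball by blast
      let ?N = "norm (x - route_vector Q)"
      \<comment> \<open>The point \<open>y\<close> lies slightly beyond \<open>x\<close> as seen
        from the vector of \<open>Q\<close>, with coordinate \<open>- d\<close> at \<open>e\<close>.
        The factor 2 keeps it strictly inside the ball, and the summand 1 keeps the denominator
        positive.\<close>
      define d where "d = r / (2 * (?N + 1))"
      define y where "y = (1 + d) *\<^sub>R x + (- d) *\<^sub>R route_vector Q"
      have "0 < ?N + 1" using norm_ge_zero[of "x - route_vector Q"] by linarith
      with r have d: "0 < d" by (simp add: d_def)
      have "y - x = d *\<^sub>R (x - route_vector Q)"
        unfolding y_def by (simp add: algebra_simps)
      then have "dist x y = d * ?N" using d by (metis dist_commute dist_norm norm_scaleR abs_of_pos)
      also have "\<dots> \<le> r / 2 * (?N / (?N + 1))" by (simp add: d_def field_simps)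
      also have "\<dots> \<le> r / 2 * 1" using r \<open>0 < ?N + 1\<close> by (intro mult_left_mono) (simp_all add: divide_le_eq_1)
      also have "\<dots> < r" using r by simp
      finally have "y \<in> ball x r" by simp
      moreover have "y \<in> affine hull (flow_polytope s)"
        unfolding y_def using xP QP by (intro mem_affine[OF affine_affine_hull]) (auto intro: hull_inc)
      ultimately have "y \<in> flow_polytope s" using r by blast
      then have "0 \<le> Poly_Mapping.lookup y e" unfolding flow_polytope_eq by blast
      moreover have "Poly_Mapping.lookup y e = - d"
        using Q xe unfolding y_def lookup_add lookup_scaleR lookup_route_vector by simp
      ultimately show False using d by simp
    qed
    with xP show "x \<in> rel_frontier (flow_polytope s)"
      unfolding rel_frontier_def using closure_subset by blast
  qed
qed

lemma interior_simplices_eq: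
  "interior_simplices s = {convex hull (route_vector ` C) | C. C \<noteq> {} \<and> chain C \<and> covering C}"
proof (intro set_eqI iffI)
  fix \<sigma> assume "\<sigma> \<in> interior_simplices s"
  then obtain C where C: "\<sigma> = convex hull (route_vector ` C)" "C \<noteq> {}" "C \<subseteq> routes s"
    "\<forall>p\<in>C. \<forall>q\<in>C. coherent s p q" "\<not> \<sigma> \<subseteq> rel_frontier (flow_polytope s)"
    unfolding interior_simplices_def dkk_triangulation_def by blast
  have "chain C" using chain_iff_coherent[OF C(3)] C(4) by simp
  moreover have "covering C" using hull_subset_frontier_iff[OF C(3,2)] C(1,5) by simp
  ultimately show "\<sigma> \<in> {convex hull (route_vector ` C) | C. C \<noteq> {} \<and> chain C \<and> covering C}"
    using C(1,2) by blast
next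
  fix \<sigma> assume "\<sigma> \<in> {convex hull (route_vector ` C) | C. C \<noteq> {} \<and> chain C \<and> covering C}"
  then obtain C where C: "\<sigma> = convex hull (route_vector ` C)" "C \<noteq> {}" "chain C" "covering C" by blast
  have sub: "C \<subseteq> routes s" using chain_routes[OF C(3)] .
  have "\<forall>p\<in>C. \<forall>q\<in>C. coherent s p q" using chain_iff_coherent[OF sub] C(3) by simp
  moreover have "\<not> \<sigma> \<subseteq> rel_frontier (flow_polytope s)"
    using hull_subset_frontier_iff[OF sub C(2)] C(1,4) by simp
  ultimately show "\<sigma> \<in> interior_simplices s"
    unfolding interior_simplices_def dkk_triangulation_def using C(1,2) sub by blast
qed

end

subsection \<open>Routes of prefixes\<close>

lemma ascents_iff:
  "(a, c) \<in> ascents w \<longleftrightarrow> a < c \<and> (\<exists>i>0. i < length w \<and> w ! (i - 1) = a \<and> w ! i = c)"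
proof -
  have "sublist [a, c] w \<longleftrightarrow> (\<exists>i>0. i < length w \<and> w ! (i - 1) = a \<and> w ! i = c)"
  proof
    assume "sublist [a, c] w"
    then obtain u v where "w = u @ [a, c] @ v" unfolding sublist_def by blast
    then show "\<exists>i>0. i < length w \<and> w ! (i - 1) = a \<and> w ! i = c"
      by (intro exI[of _ "Suc (length u)"]) (auto simp: nth_append)
  next
    assume "\<exists>i>0. i < length w \<and> w ! (i - 1) = a \<and> w ! i = c"
    then obtain j where j: "Suc j < length w" "w ! j = a" "w ! Suc j = c"
      by (metis Suc_pred')
    then have "w = take j w @ [a, c] @ drop (Suc (Suc j)) w"
      using id_take_nth_drop[of j w] Cons_nth_drop_Suc[of "Suc j" w] by simp
    then show "sublist [a, c] w" unfolding sublist_def by blast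
  qed
  then show ?thesis by (auto simp: ascents_def)
qed

text \<open>If the factor occurred twice, its first occurrence of the larger letter would lie
  between two copies of the smaller one. So ascents, defined as pairs of letters, correspond to
  cuts.\<close>

lemma ascent_position_unique:
  assumes "nested w" "w ! (i - 1) < w ! i" "0 < i" "i < length w" "0 < j" "j < length w"
    and "w ! (j - 1) = w ! (i - 1)" "w ! j = w ! i"
  shows "i = j"
proof -
  have False if "i < j" "w ! (i - 1) < w ! i" "0 < i" "j < length w" "w ! (j - 1) = w ! (i - 1)" for i j
  proof -
    have w: "w = take i w @ w ! i # drop (Suc i) w"
      using that by (simp add: id_take_nth_drop)
    have "j - 1 \<noteq> i" using that by auto
    then have "Suc i \<le> j - 1" using that by linarith
    then have "drop (Suc i) w ! (j - 1 - Suc i) = w ! (j - 1)" "j - 1 - Suc i < length (drop (Suc i) w)"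
      using that by (simp_all only: nth_drop length_drop le_add_diff_inverse)
    with that(5) have "w ! (i - 1) \<in> set (drop (Suc i) w)" by (metis nth_mem)
    moreover have "w ! (i - 1) \<in> set (take i w)"
      using that by (auto simp: in_set_conv_nth intro!: exI[of _ "i - 1"])
    ultimately show False using nestedD[OF assms(1) w that(2)] by blast
  qed
  from this[of i j] this[of j i] assms show ?thesis by (metis linorder_neqE_nat)
qed

context composition begin

abbreviation SP :: "nat list set" where "SP \<equiv> stirling_perms s"

lemma stirling_perms_iff:
  "w \<in> SP \<longleftrightarrow> nested w \<and> (\<forall>a. count_list w a = (if 1 \<le> a \<and> a \<le> n then part s a else 0))"
proof -
  have "mset w = (\<Sum>a = 1..n. replicate_mset (part s a) a) \<longleftrightarrow>
    (\<forall>a. count_list w a = (if 1 \<le> a \<and> a \<le> n then part s a else 0))"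
    by (simp add: multiset_eq_iff count_sum count_mset sum.delta)
  then show ?thesis by (auto simp: stirling_perms_def nested_iff_subseq)
qed

lemma stirling_nested: "w \<in> SP \<Longrightarrow> nested w"
  by (simp add: stirling_perms_iff)

lemma stirling_count: "w \<in> SP \<Longrightarrow> 1 \<le> a \<Longrightarrow> a \<le> n \<Longrightarrow> count_list w a = part s a"
  by (simp add: stirling_perms_iff)

lemma stirling_set: "w \<in> SP \<Longrightarrow> set w = {1..n}"
proof (intro set_eqI)
  fix a assume "w \<in> SP"
  then have "a \<in> set w \<longleftrightarrow> (if 1 \<le> a \<and> a \<le> n then part s a else 0) \<noteq> 0"
    by (metis count_list_0_iff stirling_perms_iff)
  then show "a \<in> set w \<longleftrightarrow> a \<in> {1..n}" using part_pos[of a] by auto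
qed

lemma stirling_nth: "w \<in> SP \<Longrightarrow> i < length w \<Longrightarrow> 1 \<le> w ! i \<and> w ! i \<le> n"
  using stirling_set nth_mem by fastforce

lemma stirling_length: "w \<in> SP \<Longrightarrow> length w = sum_list s"
proof -
  assume w: "w \<in> SP"
  have "length w = (\<Sum>a = 1..n. part s a)"
    using sum_count_set[of w "{1..n}"] stirling_set[OF w] stirling_count[OF w] by simp
  also have "\<dots> = (\<Sum>i = 0..<n. s ! i)"
    by (rule sum.reindex_bij_witness[of _ Suc "\<lambda>a. a - 1"]) (auto simp: part_def nth_append)
  finally show ?thesis by (simp add: sum_list_sum_nth)
qed

lemma weak_le_antisym:
  assumes "w \<in> SP" "w' \<in> SP" "weak_le s w w'" "weak_le s w' w"
  shows "w = w'"
proof (rule nested_eqI)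
  show "count_list w a = count_list w' a" for a using assms by (simp add: stirling_perms_iff)
  show "inversions w c a = inversions w' c a" if "a \<in> set w" "c \<in> set w" "a < c" for a c
    using that assms stirling_set[OF assms(1)] unfolding weak_le_def by (auto intro!: le_antisym)
qed (use assms stirling_nested in auto)

lemma prefix_count_le:
  "w \<in> SP \<Longrightarrow> 1 \<le> a \<Longrightarrow> a \<le> Suc n \<Longrightarrow> prefix_count s (take i w) a \<le> part s a"
  using count_list_take_le[of i w a] stirling_count[of w a] part_last
  by (auto simp: prefix_count_def)

lemma prefix_pivot:
  fixes w :: "nat list" and i :: nat
  assumes "w \<in> SP"
  defines "u \<equiv> take i w"
  shows "1 \<le> prefix_pivot s u" "prefix_pivot s u \<le> Suc n"
    "0 < prefix_count s u (prefix_pivot s u)" "prefix_count s u (prefix_pivot s u) < part s (prefix_pivot s u)"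
    and "\<And>a. 1 \<le> a \<Longrightarrow> a < prefix_pivot s u \<Longrightarrow> prefix_count s u a = 0 \<or> prefix_count s u a = part s a"
proof -
  let ?P = "\<lambda>a. 1 \<le> a \<and> a \<le> n + 1 \<and> 0 < prefix_count s u a \<and> prefix_count s u a < part s a"
  have "?P (Suc n)" using part_last by (simp add: prefix_count_def)
  from LeastI[of ?P, OF this] show *: "1 \<le> prefix_pivot s u" "prefix_pivot s u \<le> Suc n"
    "0 < prefix_count s u (prefix_pivot s u)" "prefix_count s u (prefix_pivot s u) < part s (prefix_pivot s u)"
    unfolding prefix_pivot_def[symmetric] by auto
  fix a assume a: "1 \<le> a" "a < prefix_pivot s u"
  then have "\<not> ?P a" unfolding prefix_pivot_def using not_less_Least[of a ?P] by blast
  then have "prefix_count s u a = 0 \<or> part s a \<le> prefix_count s u a"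
    using a *(2) by auto
  moreover have "prefix_count s u a \<le> part s a"
    unfolding u_def using prefix_count_le[OF assms(1) a(1)] a(2) *(2) by simp
  ultimately show "prefix_count s u a = 0 \<or> prefix_count s u a = part s a" by auto
qed

lemma prefix_route_eq:
  assumes "w \<in> SP"
  shows "prefix_route s (take i w) = mk_route (prefix_pivot s (take i w)) (prefix_count s (take i w))"
proof -
  let ?u = "take i w"
  obtain k where k: "prefix_pivot s ?u = Suc k" using prefix_pivot(1)[OF assms, of i] by (cases "prefix_pivot s ?u") auto
  have "prefix_count s ?u a div part s a * part s a = prefix_count s ?u a" if "1 \<le> a" "a \<le> k" for a
    using prefix_pivot(5)[OF assms, of a i] that k by auto
  then show ?thesis
    unfolding prefix_route_def route_def k mk_route_Suc by (auto simp: mk_route_def simp del: upt_Suc)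
qed

lemma prefix_route_in_routes: "w \<in> SP \<Longrightarrow> prefix_route s (take i w) \<in> routes s"
  unfolding routes_eq prefix_route_eq valid_route_def
  using prefix_pivot[where w = w and i = i]
  by (intro CollectI exI[of _ "prefix_pivot s (take i w)"] exI[of _ "prefix_count s (take i w)"]) auto

lemma length_prefix_route: "w \<in> SP \<Longrightarrow> length (prefix_route s (take i w)) = prefix_pivot s (take i w)"
  by (simp add: prefix_route_eq)

lemma val_prefix_route:
  "w \<in> SP \<Longrightarrow> 1 \<le> j \<Longrightarrow> j \<le> length (prefix_route s (take i w)) \<Longrightarrow>
    val (prefix_route s (take i w)) j = prefix_count s (take i w) j"
  by (simp add: prefix_route_eq val_mk_route)

text \<open>Agreement of the values also fixes the pivot, because it forces equal lengths by
  \<open>length_eq_if_vals_eq\<close>.\<close>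

lemma prefix_route_eqI:
  assumes "w \<in> SP" "Q \<in> routes s"
    and eq: "\<And>j. 1 \<le> j \<Longrightarrow> j \<le> length Q \<Longrightarrow> val Q j = prefix_count s (take i w) j"
  shows "prefix_route s (take i w) = Q"
proof -
  let ?P = "prefix_route s (take i w)"
  have P: "?P \<in> routes s" using prefix_route_in_routes[OF assms(1)] .
  have vals: "val ?P j = val Q j" if "1 \<le> j" "j \<le> length ?P" "j \<le> length Q" for j
    using val_prefix_route[OF assms(1)] eq that by simp
  have "0 < length ?P" "0 < length Q" using route_length[OF P] route_length[OF assms(2)] by linarith+
  then have "length ?P = length Q"
    by (rule length_eq_if_vals_eq[OF P assms(2)]) (use vals in auto)
  with vals show ?thesis by (intro route_eqI[OF P assms(2)]) auto
qed

definition perm_routes :: "nat list \<Rightarrow> (nat \<times> nat) list set" where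
  "perm_routes w = {prefix_route s (take i w) | i. i \<le> length w}"

lemma perm_simplex_eq: "w \<in> SP \<Longrightarrow> perm_simplex s w = convex hull (route_vector ` perm_routes w)"
  by (simp add: perm_simplex_def perm_routes_def stirling_length)

lemma val_last: "Q \<in> routes s \<Longrightarrow> length Q = Suc n \<Longrightarrow> val Q (Suc n) = 1"
  using val_first[of Q] part_last by simp

text \<open>Index \<open>Suc n\<close> can be left out: a route that reaches it has value 1 there,
  which is also the convention in \<open>prefix_count\<close>.\<close>

lemma prefix_route_eqI':
  assumes "w \<in> SP" "Q \<in> routes s"
    and eq: "\<And>j. 1 \<le> j \<Longrightarrow> j \<le> length Q \<Longrightarrow> j \<le> n \<Longrightarrow> val Q j = count_list (take i w) j"
  shows "prefix_route s (take i w) = Q"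
proof (rule prefix_route_eqI[OF assms(1,2)])
  fix j assume "1 \<le> j" "j \<le> length Q"
  then show "val Q j = prefix_count s (take i w) j"
    using eq[of j] val_last[OF assms(2)] route_length[OF assms(2)]
    by (cases "j = Suc n") (auto simp: prefix_count_def)
qed

lemma val_prefix_route':
  "w \<in> SP \<Longrightarrow> 1 \<le> j \<Longrightarrow> j \<le> length (prefix_route s (take i w)) \<Longrightarrow> j \<le> n \<Longrightarrow>
    val (prefix_route s (take i w)) j = count_list (take i w) j"
  by (simp add: val_prefix_route prefix_count_def)

text \<open>Counts grow with the prefix, so a longer prefix never has the smaller value at a common
  index.\<close>

lemma perm_routes_chain: "w \<in> SP \<Longrightarrow> chain (perm_routes w)"
proof -
  assume w: "w \<in> SP"
  have mono: "\<not> less_route (prefix_route s (take j w)) (prefix_route s (take i w))" if "i \<le> j" for i j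
    using that count_list_take_mono[of i j w]
    by (auto simp: less_route_def val_prefix_route[OF w] prefix_count_def not_less)
  show ?thesis
    unfolding chain_def perm_routes_def
  proof (intro conjI ballI)
    show "{prefix_route s (take i w) |i. i \<le> length w} \<subseteq> routes s"
      using prefix_route_in_routes[OF w] by blast
    fix P Q assume "P \<in> {prefix_route s (take i w) |i. i \<le> length w}"
      "Q \<in> {prefix_route s (take i w) |i. i \<le> length w}"
    then obtain i j where "P = prefix_route s (take i w)" "Q = prefix_route s (take j w)" by blast
    with mono[of i j] mono[of j i] show "\<not> (less_route P Q \<and> less_route Q P)"
      using nat_le_linear[of i j] by blast
  qed
qed

text \<open>Equal routes have equal counts up to the pivot, so the letter after the shorter prefix
  exceeds the pivot; but the block of the pivot is still open there.\<close>

lemma prefix_route_inj: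
  assumes w: "w \<in> SP" and "i \<le> length w" "j \<le> length w"
    and eq: "prefix_route s (take i w) = prefix_route s (take j w)"
  shows "i = j"
proof -
  have False if ij: "i < j" "j \<le> length w"
    and eq: "prefix_route s (take i w) = prefix_route s (take j w)" for i j
  proof -
    define k where "k = prefix_pivot s (take i w)"
    have k': "k = prefix_pivot s (take j w)"
      using eq length_prefix_route[OF w] unfolding k_def by metis
    have counts: "prefix_count s (take i w) a = prefix_count s (take j w) a" if "1 \<le> a" "a \<le> k" for a
      using val_prefix_route[OF w that(1), of i] val_prefix_route[OF w that(1), of j]
        length_prefix_route[OF w] that eq k' unfolding k_def by metis
    let ?x = "w ! i"
    have x: "1 \<le> ?x" "?x \<le> n" using stirling_nth[OF w, of i] ij by auto
    have "count_list (take i w) ?x < count_list (take (Suc i) w) ?x"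
      using ij by (simp add: count_list_take_Suc)
    also have "\<dots> \<le> count_list (take j w) ?x" using ij by (intro count_list_take_mono) simp
    finally have "k < ?x" using counts[of ?x] x by (auto simp: prefix_count_def not_le[symmetric])
    then have "k \<le> n" using x by simp
    with prefix_pivot(1,3,4)[OF w, of i] have
      "0 < count_list (take i w) k" "count_list (take i w) k < count_list w k"
      using stirling_count[OF w, of k] unfolding k_def by (auto simp: prefix_count_def)
    then show False
      using nested_count_take[OF stirling_nested[OF w] _ \<open>k < ?x\<close>] ij by auto
  qed
  from this[of i j] this[of j i] assms show ?thesis by (metis linorder_neqE_nat)
qed

text \<open>A prefix without \<open>a\<close> ends before the block of \<open>a\<close>, and one
  with all its copies reaches past the first; this bounds the count of \<open>c\<close>. Conversely,
  the bounds are the conditions of \<open>ex_prefix_with_counts\<close> for the letters that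
  \<open>Q\<close> reaches, where every letter below the length is untouched or used up.\<close>

lemma mem_perm_routes_iff:
  assumes w: "w \<in> SP" and Q: "Q \<in> routes s"
  shows "Q \<in> perm_routes w \<longleftrightarrow> (\<forall>a c. 1 \<le> a \<and> a < c \<and> c \<le> n \<and> c \<le> length Q \<longrightarrow>
    (val Q a = 0 \<longrightarrow> val Q c \<le> inversions w c a) \<and> (val Q a = part s a \<longrightarrow> inversions w c a \<le> val Q c))"
proof
  assume "Q \<in> perm_routes w"
  then obtain i where i: "Q = prefix_route s (take i w)" unfolding perm_routes_def by blast
  show "\<forall>a c. 1 \<le> a \<and> a < c \<and> c \<le> n \<and> c \<le> length Q \<longrightarrow>
    (val Q a = 0 \<longrightarrow> val Q c \<le> inversions w c a) \<and> (val Q a = part s a \<longrightarrow> inversions w c a \<le> val Q c)"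
  proof (intro allI impI)
    fix a c assume ac: "1 \<le> a \<and> a < c \<and> c \<le> n \<and> c \<le> length Q"
    have v: "val Q a = count_list (take i w) a" "val Q c = count_list (take i w) c"
      using val_prefix_route'[OF w, of a i] val_prefix_route'[OF w, of c i] ac i by auto
    have "a \<in> set w" using stirling_set[OF w] ac by simp
    have "val Q c \<le> inversions w c a" if "val Q a = 0"
      using count_le_inversions[OF \<open>a \<in> set w\<close>, of i c] that v by (simp add: count_list_0_iff)
    moreover have "inversions w c a \<le> val Q c" if "val Q a = part s a"
    proof -
      have "count_list (take i w) a \<noteq> 0" using that v part_pos[of a] ac by auto
      then show ?thesis using inversions_le_count_take[of a i w c] v by (simp add: count_list_0_iff)
    qed
    ultimately show "(val Q a = 0 \<longrightarrow> val Q c \<le> inversions w c a) \<and>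
      (val Q a = part s a \<longrightarrow> inversions w c a \<le> val Q c)" by blast
  qed
next
  assume *: "\<forall>a c. 1 \<le> a \<and> a < c \<and> c \<le> n \<and> c \<le> length Q \<longrightarrow>
    (val Q a = 0 \<longrightarrow> val Q c \<le> inversions w c a) \<and> (val Q a = part s a \<longrightarrow> inversions w c a \<le> val Q c)"
  have "\<exists>i\<le>length w. \<forall>b\<in>{1..min n (length Q)}. count_list (take i w) b = val Q b"
  proof (rule ex_prefix_with_counts[OF stirling_nested[OF w]])
    show "val Q b \<le> count_list w b" if "b \<in> {1..min n (length Q)}" for b
      using that val_le[OF Q, of b] stirling_count[OF w, of b] by auto
    fix b c assume bc: "b \<in> {1..min n (length Q)}" "c \<in> {1..min n (length Q)}" "b < c"
    then have "val Q b = 0 \<or> val Q b = part s b" using val_cases[OF Q, of b] by auto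
    moreover have "count_list w b = part s b" using stirling_count[OF w, of b] bc by auto
    ultimately show "val Q b < count_list w b \<Longrightarrow> val Q c \<le> inversions w c b"
      "0 < val Q b \<Longrightarrow> inversions w c b \<le> val Q c"
      using *[rule_format, of b c] bc by auto
  qed
  then obtain i where i: "i \<le> length w" "\<forall>b\<in>{1..min n (length Q)}. count_list (take i w) b = val Q b"
    by blast
  have "prefix_route s (take i w) = Q"
    by (rule prefix_route_eqI'[OF w Q]) (use i in auto)
  with i show "Q \<in> perm_routes w" unfolding perm_routes_def by blast
qed

subsection \<open>Coherent sets that cover all edges\<close>

text \<open>One of the two witnessing indices is common to \<open>P\<close> and \<open>R\<close>: if
  \<open>i\<close> exceeds \<open>length R\<close>, then \<open>j\<close> is smaller and lies within
  \<open>P\<close>. Coherence transports the other comparison to that index.\<close>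

lemma less_route_trans:
  assumes "chain C" "P \<in> C" "Q \<in> C" "R \<in> C" "less_route P Q" "less_route Q R"
  shows "less_route P R"
proof -
  obtain i where i: "1 \<le> i" "i \<le> length P" "i \<le> length Q" "val P i < val Q i"
    using assms(5) unfolding less_route_def by blast
  obtain j where j: "1 \<le> j" "j \<le> length Q" "j \<le> length R" "val Q j < val R j"
    using assms(6) unfolding less_route_def by blast
  show ?thesis
  proof (cases "i \<le> length R")
    case True
    have "val Q i \<le> val R i" using chainD[OF assms(1,3,4) j i(1) i(3) True] .
    with i True show ?thesis unfolding less_route_def by (intro exI[of _ i]) auto
  next
    case False
    with i j have "j \<le> length P" by simp
    have "val P j \<le> val Q j" using chainD[OF assms(1,2,3) i j(1) \<open>j \<le> length P\<close> j(2)] .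
    with j \<open>j \<le> length P\<close> show ?thesis unfolding less_route_def by (intro exI[of _ j]) auto
  qed
qed

lemma coveringE:
  assumes "covering C" "C \<subseteq> routes s" "1 \<le> i" "i \<le> n" "t \<le> part s i"
  obtains Q where "Q \<in> C" "i \<le> length Q" "val Q i = t"
proof -
  have "(i, t) \<in> arcs (oruga s)" using assms by (auto simp: arcs_iff)
  then obtain Q where "Q \<in> C" "(i, t) \<in> set Q" using assms(1) unfolding covering_def by blast
  with that[of Q] in_route_iff[of Q] assms(2) show ?thesis by auto
qed

lemma covering_nonempty: "covering C \<Longrightarrow> C \<noteq> {}"
proof -
  assume "covering C"
  moreover have "(Suc n, 1) \<in> arcs (oruga s)" using part_last by (simp add: arcs_iff)
  ultimately show "C \<noteq> {}" unfolding covering_def by blast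
qed

text \<open>A minimal route has value 0 at every letter it reaches, since the route covering the
  bump there would be smaller. As source edges have positive labels, it must start at index
  \<open>Suc n\<close>. The top is dual, with dips.\<close>

lemma
  assumes "chain C" "covering C"
  shows chain_bottom: "\<exists>R\<in>C. length R = Suc n \<and> (\<forall>i. 1 \<le> i \<and> i \<le> n \<longrightarrow> val R i = 0)"
    and chain_top: "\<exists>R\<in>C. length R = Suc n \<and> (\<forall>i. 1 \<le> i \<and> i \<le> n \<longrightarrow> val R i = part s i)"
proof -
  have sub: "C \<subseteq> routes s" using chain_routes[OF assms(1)] .
  have fin: "finite C" using finite_subset[OF sub finite_routes] .
  have asymp: "asymp_on C less_route" using assms(1) by (auto simp: chain_def asymp_on_def)
  have transp: "transp_on C less_route"
  proof (rule transp_onI)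
    fix P Q R assume "P \<in> C" "Q \<in> C" "R \<in> C" "less_route P Q" "less_route Q R"
    then show "less_route P R" by (rule less_route_trans[OF assms(1)])
  qed
  obtain R0 where R0: "R0 \<in> C" "\<forall>P\<in>C. P \<noteq> R0 \<longrightarrow> \<not> less_route P R0"
    using Finite_Set.bex_min_element[OF fin asymp transp covering_nonempty[OF assms(2)]] by blast
  obtain R1 where R1: "R1 \<in> C" "\<forall>P\<in>C. P \<noteq> R1 \<longrightarrow> \<not> less_route R1 P"
    using Finite_Set.bex_max_element[OF fin asymp transp covering_nonempty[OF assms(2)]] by blast
  have low: "val R0 i = 0" if i: "1 \<le> i" "i \<le> n" "i \<le> length R0" for i
  proof (rule ccontr)
    assume neq: "val R0 i \<noteq> 0"
    obtain Q where Q: "Q \<in> C" "i \<le> length Q" "val Q i = 0"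
      using coveringE[OF assms(2) sub i(1,2), of 0] by auto
    then have "less_route Q R0" using i neq unfolding less_route_def by (intro exI[of _ i]) auto
    moreover have "Q \<noteq> R0" using Q neq by blast
    ultimately show False using R0(2) Q(1) by blast
  qed
  have high: "val R1 i = part s i" if i: "1 \<le> i" "i \<le> n" "i \<le> length R1" for i
  proof (rule ccontr)
    assume neq: "val R1 i \<noteq> part s i"
    obtain Q where Q: "Q \<in> C" "i \<le> length Q" "val Q i = part s i"
      using coveringE[OF assms(2) sub i(1,2), of "part s i"] by auto
    have "val R1 i < part s i" using val_le[OF subsetD[OF sub R1(1)] i(1,3)] neq by simp
    then have "less_route R1 Q" using i Q unfolding less_route_def by (intro exI[of _ i]) auto
    moreover have "Q \<noteq> R1" using Q neq by blast
    ultimately show False using R1(2) Q(1) by blast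
  qed
  have R: "R0 \<in> routes s" "R1 \<in> routes s" using R0 R1 sub by auto
  have len0: "length R0 = Suc n"
    using low[of "length R0"] val_first[OF R(1)] route_length[OF R(1)] by (cases "length R0 \<le> n") auto
  have len1: "length R1 = Suc n"
    using high[of "length R1"] val_first[OF R(2)] route_length[OF R(2)] by (cases "length R1 \<le> n") auto
  show "\<exists>R\<in>C. length R = Suc n \<and> (\<forall>i. 1 \<le> i \<and> i \<le> n \<longrightarrow> val R i = 0)"
    using R0(1) len0 low by (intro bexI[of _ R0]) auto
  show "\<exists>R\<in>C. length R = Suc n \<and> (\<forall>i. 1 \<le> i \<and> i \<le> n \<longrightarrow> val R i = part s i)"
    using R1(1) len1 high by (intro bexI[of _ R1]) auto
qed

section \<open>Bounds on inversion numbers from a covering coherent set\<close>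

definition lo :: "(nat \<times> nat) list set \<Rightarrow> nat \<Rightarrow> nat \<Rightarrow> nat" where
  "lo C c a = Max {val Q c | Q. Q \<in> C \<and> c \<le> length Q \<and> val Q a = 0}"

definition hi :: "(nat \<times> nat) list set \<Rightarrow> nat \<Rightarrow> nat \<Rightarrow> nat" where
  "hi C c a = Min {val Q c | Q. Q \<in> C \<and> c \<le> length Q \<and> val Q a = part s a}"

context
  fixes C assumes chain: "chain C" and covering: "covering C"
begin

lemma C_routes: "Q \<in> C \<Longrightarrow> Q \<in> routes s"
  using chain_routes[OF chain] by blast

lemma finite_C: "finite C"
  using finite_subset[OF chain_routes[OF chain] finite_routes] .

text \<open>The route that avoids all letters shows that the maximum is not taken over the empty
  set.\<close>

lemma lo_attained:
  assumes "1 \<le> a" "a < c" "c \<le> n"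
  obtains Q where "Q \<in> C" "c \<le> length Q" "val Q a = 0" "val Q c = lo C c a"
proof -
  let ?S = "{val Q c | Q. Q \<in> C \<and> c \<le> length Q \<and> val Q a = 0}"
  obtain R where "R \<in> C" "length R = Suc n" "\<forall>i. 1 \<le> i \<and> i \<le> n \<longrightarrow> val R i = 0"
    using chain_bottom[OF chain covering] by blast
  then have "val R c \<in> ?S" using assms by (intro CollectI exI[of _ R]) simp
  then have "?S \<noteq> {}" by blast
  moreover have "finite ?S" using finite_C by simp
  ultimately have "lo C c a \<in> ?S" unfolding lo_def by (rule Max_in[rotated])
  with that show ?thesis by auto
qed

lemma le_lo: "Q \<in> C \<Longrightarrow> c \<le> length Q \<Longrightarrow> val Q a = 0 \<Longrightarrow> val Q c \<le> lo C c a"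
  unfolding lo_def using finite_C by (intro Max_ge) auto

lemma hi_attained:
  assumes "1 \<le> a" "a < c" "c \<le> n"
  obtains Q where "Q \<in> C" "c \<le> length Q" "val Q a = part s a" "val Q c = hi C c a"
proof -
  let ?S = "{val Q c | Q. Q \<in> C \<and> c \<le> length Q \<and> val Q a = part s a}"
  obtain R where "R \<in> C" "length R = Suc n" "\<forall>i. 1 \<le> i \<and> i \<le> n \<longrightarrow> val R i = part s i"
    using chain_top[OF chain covering] by blast
  then have "val R c \<in> ?S" using assms by (intro CollectI exI[of _ R]) simp
  then have "?S \<noteq> {}" by blast
  moreover have "finite ?S" using finite_C by simp
  ultimately have "hi C c a \<in> ?S" unfolding hi_def by (rule Min_in[rotated])
  with that show ?thesis by auto
qed

lemma hi_le: "Q \<in> C \<Longrightarrow> c \<le> length Q \<Longrightarrow> val Q a = part s a \<Longrightarrow> hi C c a \<le> val Q c"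
  unfolding hi_def using finite_C by (intro Min_le) auto

text \<open>Unless \<open>lo\<close> is already the whole part, some route covers the edge with
  label \<open>lo C c a + 1\<close>; by maximality of \<open>lo\<close> it does not avoid
  \<open>a\<close>, so it has used \<open>a\<close> up.\<close>

lemma hi_le_Suc_lo:
  assumes "1 \<le> a" "a < c" "c \<le> n"
  shows "hi C c a \<le> Suc (lo C c a)"
proof (cases "lo C c a < part s c")
  case True
  then obtain Q where Q: "Q \<in> C" "c \<le> length Q" "val Q c = Suc (lo C c a)"
    using coveringE[OF covering chain_routes[OF chain], of c "Suc (lo C c a)"] assms by auto
  have "val Q a \<noteq> 0" using le_lo[OF Q(1,2), of a] Q(3) by auto
  then have "val Q a = part s a" using val_cases[OF C_routes[OF Q(1)], of a] assms Q by auto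
  with hi_le[OF Q(1,2)] Q show ?thesis by simp
next
  case False
  obtain Q where Q: "Q \<in> C" "c \<le> length Q" "val Q a = part s a" "val Q c = hi C c a"
    using hi_attained[OF assms] .
  have "val Q c \<le> part s c" using val_le[OF C_routes[OF Q(1)], of c] assms Q(2) by simp
  with False Q show ?thesis by simp
qed

lemma lo_le_hi:
  assumes "1 \<le> a" "a < c" "c \<le> n"
  shows "lo C c a \<le> hi C c a"
proof -
  obtain P where P: "P \<in> C" "c \<le> length P" "val P a = 0" "val P c = lo C c a"
    using lo_attained[OF assms] .
  obtain Q where Q: "Q \<in> C" "c \<le> length Q" "val Q a = part s a" "val Q c = hi C c a"
    using hi_attained[OF assms] .
  show ?thesis
    using chainD[OF chain P(1) Q(1), of a c] P Q assms part_pos[of a] by auto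
qed

lemma subset_perm_routes_iff:
  assumes "w \<in> SP"
  shows "C \<subseteq> perm_routes w \<longleftrightarrow>
    (\<forall>a c. 1 \<le> a \<and> a < c \<and> c \<le> n \<longrightarrow> lo C c a \<le> inversions w c a \<and> inversions w c a \<le> hi C c a)"
proof
  assume sub: "C \<subseteq> perm_routes w"
  show "\<forall>a c. 1 \<le> a \<and> a < c \<and> c \<le> n \<longrightarrow> lo C c a \<le> inversions w c a \<and> inversions w c a \<le> hi C c a"
  proof (intro allI impI)
    fix a c assume ac: "1 \<le> a \<and> a < c \<and> c \<le> n"
    obtain P where P: "P \<in> C" "c \<le> length P" "val P a = 0" "val P c = lo C c a"
      using lo_attained[of a c] ac by blast
    obtain Q where Q: "Q \<in> C" "c \<le> length Q" "val Q a = part s a" "val Q c = hi C c a"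
      using hi_attained[of a c] ac by blast
    have "P \<in> perm_routes w" "Q \<in> perm_routes w" using P Q sub by auto
    then show "lo C c a \<le> inversions w c a \<and> inversions w c a \<le> hi C c a"
      using mem_perm_routes_iff[OF assms C_routes[OF P(1)], THEN iffD1, rule_format, of a c]
        mem_perm_routes_iff[OF assms C_routes[OF Q(1)], THEN iffD1, rule_format, of a c] P(2-) Q(2-) ac
      by auto
  qed
next
  assume *: "\<forall>a c. 1 \<le> a \<and> a < c \<and> c \<le> n \<longrightarrow> lo C c a \<le> inversions w c a \<and> inversions w c a \<le> hi C c a"
  show "C \<subseteq> perm_routes w"
  proof
    fix Q assume Q: "Q \<in> C"
    show "Q \<in> perm_routes w"
      unfolding mem_perm_routes_iff[OF assms C_routes[OF Q]]
    proof (intro allI impI)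
      fix a c assume ac: "1 \<le> a \<and> a < c \<and> c \<le> n \<and> c \<le> length Q"
      then have "lo C c a \<le> inversions w c a" "inversions w c a \<le> hi C c a" using * by auto
      then show "(val Q a = 0 \<longrightarrow> val Q c \<le> inversions w c a) \<and>
        (val Q a = part s a \<longrightarrow> inversions w c a \<le> val Q c)"
        using le_lo[OF Q, of c a] hi_le[OF Q, of c a] ac by auto
    qed
  qed
qed

text \<open>Planarity: a route attaining \<open>lo C c a\<close> has fewer than all copies of
  \<open>b\<close>, hence none, and competes for \<open>lo C c b\<close>. Transitivity: a route
  attaining \<open>lo C c b\<close> has fewer letters \<open>b\<close> than some route that avoids
  \<open>a\<close>, so by coherence it avoids \<open>a\<close> too.\<close>

lemma ex_minimal:
  "\<exists>w\<in>SP. \<forall>a c. 1 \<le> a \<longrightarrow> a < c \<longrightarrow> c \<le> n \<longrightarrow> inversions w c a = lo C c a"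
proof -
  have "\<exists>w. nested w \<and> (\<forall>a. count_list w a = (if 1 \<le> a \<and> a \<le> n then part s a else 0)) \<and>
    (\<forall>a c. 1 \<le> a \<longrightarrow> a < c \<longrightarrow> c \<le> n \<longrightarrow> inversions w c a = lo C c a)"
  proof (rule ex_nested_with_inversions)
    show "0 < part s a" if "1 \<le> a" "a \<le> n" for a using part_pos that by simp
    show "lo C c a \<le> part s c" if ac: "1 \<le> a" "a < c" "c \<le> n" for a c
    proof -
      obtain P where P: "P \<in> C" "c \<le> length P" "val P a = 0" "val P c = lo C c a"
        using lo_attained[OF ac] .
      then show ?thesis using val_le[OF C_routes[OF P(1)], of c] ac by simp
    qed
    fix a b c assume abc: "1 \<le> a" "a < b" "b < c" "c \<le> n"
    show "lo C c a \<le> lo C c b" if "lo C b a < part s b"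
    proof -
      obtain P where P: "P \<in> C" "c \<le> length P" "val P a = 0" "val P c = lo C c a"
        using lo_attained[of a c] abc by auto
      have "val P b \<le> lo C b a" using le_lo[OF P(1) _ P(3), of b] P abc by simp
      then have "val P b = 0" using val_cases[OF C_routes[OF P(1)], of b] P abc that by auto
      then show ?thesis using le_lo[OF P(1,2), of b] P by simp
    qed
    show "lo C c b \<le> lo C c a" if "0 < lo C b a"
    proof -
      obtain P where P: "P \<in> C" "c \<le> length P" "val P b = 0" "val P c = lo C c b"
        using lo_attained[of b c] abc by auto
      obtain Q where Q: "Q \<in> C" "b \<le> length Q" "val Q a = 0" "val Q b = lo C b a"
        using lo_attained[of a b] abc by auto
      have "val P a \<le> val Q a"
        by (rule chainD[OF chain P(1) Q(1), of b]) (use P Q abc that in auto)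
      then show ?thesis using le_lo[OF P(1,2), of a] P Q by simp
    qed
  qed
  then show ?thesis unfolding Bex_def stirling_perms_iff by blast
qed

text \<open>Dual to \<open>ex_minimal\<close>, but with the arguments exchanged: planarity now rests
  on coherence, transitivity on the extremal value \<open>hi C b a\<close>.\<close>

lemma ex_maximal:
  "\<exists>w\<in>SP. \<forall>a c. 1 \<le> a \<longrightarrow> a < c \<longrightarrow> c \<le> n \<longrightarrow> inversions w c a = hi C c a"
proof -
  have "\<exists>w. nested w \<and> (\<forall>a. count_list w a = (if 1 \<le> a \<and> a \<le> n then part s a else 0)) \<and>
    (\<forall>a c. 1 \<le> a \<longrightarrow> a < c \<longrightarrow> c \<le> n \<longrightarrow> inversions w c a = hi C c a)"
  proof (rule ex_nested_with_inversions)
    show "0 < part s a" if "1 \<le> a" "a \<le> n" for a using part_pos that by simp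
    show "hi C c a \<le> part s c" if ac: "1 \<le> a" "a < c" "c \<le> n" for a c
    proof -
      obtain P where P: "P \<in> C" "c \<le> length P" "val P a = part s a" "val P c = hi C c a"
        using hi_attained[OF ac] .
      then show ?thesis using val_le[OF C_routes[OF P(1)], of c] ac by simp
    qed
    fix a b c assume abc: "1 \<le> a" "a < b" "b < c" "c \<le> n"
    show "hi C c a \<le> hi C c b" if "hi C b a < part s b"
    proof -
      obtain P where P: "P \<in> C" "c \<le> length P" "val P b = part s b" "val P c = hi C c b"
        using hi_attained[of b c] abc by auto
      obtain Q where Q: "Q \<in> C" "b \<le> length Q" "val Q a = part s a" "val Q b = hi C b a"
        using hi_attained[of a b] abc by auto
      have "val Q a \<le> val P a"
        by (rule chainD[OF chain Q(1) P(1), of b]) (use P Q abc that in auto)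
      then have "val P a = part s a" using Q val_le[OF C_routes[OF P(1)], of a] abc P by simp
      then show ?thesis using hi_le[OF P(1,2), of a] P by simp
    qed
    show "hi C c b \<le> hi C c a" if "0 < hi C b a"
    proof -
      obtain P where P: "P \<in> C" "c \<le> length P" "val P a = part s a" "val P c = hi C c a"
        using hi_attained[of a c] abc by auto
      have "hi C b a \<le> val P b" using hi_le[OF P(1) _ P(3), of b] P abc by simp
      then have "val P b = part s b" using val_cases[OF C_routes[OF P(1)], of b] P abc that by auto
      then show ?thesis using hi_le[OF P(1,2), of b] P by simp
    qed
  qed
  then show ?thesis unfolding Bex_def stirling_perms_iff by blast
qed

end

end

subsection \<open>Transpositions\<close>

text \<open>By nestedness no \<open>a\<close> follows the \<open>c\<close> of the ascent, so the
  block of \<open>a\<close> ends right before that \<open>c\<close> and the three pieces fit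
  together as \<open>u\<close>, \<open>B\<close> and \<open>c # v\<close>.\<close>

lemma split_at_ascent:
  assumes "nested w" "0 < i" "i < length w" "w ! (i - 1) < w ! i"
  obtains u B v where "w = u @ B @ w ! i # v" "length (u @ B) = i"
    "w ! (i - 1) \<notin> set u" "B \<noteq> []" "hd B = w ! (i - 1)" "last B = w ! (i - 1)"
    "w ! (i - 1) \<notin> set v"
    "before (w ! (i - 1)) w = u"
    "transposition w (w ! (i - 1), w ! i) = u @ w ! i # B @ v"
proof -
  define a c where "a = w ! (i - 1)" and "c = w ! i"
  have w: "w = take i w @ c # drop (Suc i) w"
    unfolding c_def using assms(3) by (simp add: id_take_nth_drop)
  have "take i w \<noteq> []" using assms by auto
  have last: "last (take i w) = a"
    using assms(2,3) \<open>take i w \<noteq> []\<close> by (simp add: last_conv_nth a_def min_def)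
  then have a_take: "a \<in> set (take i w)" using \<open>take i w \<noteq> []\<close> last_in_set by force
  have ac: "a < c" using assms(4) by (simp add: a_def c_def)
  have a_drop: "a \<notin> set (drop (Suc i) w)" using nestedD[OF assms(1) w ac a_take] .
  obtain u B' where u: "take i w = u @ a # B'" "a \<notin> set u"
    using split_list_first[OF a_take] by blast
  define B where "B = a # B'"
  have lastB: "last B = a" using last u unfolding B_def by simp
  have wB: "w = u @ B @ c # drop (Suc i) w" using w u unfolding B_def by simp
  have takeWhile_split: "takeWhile (\<lambda>x. x \<noteq> a) (xs @ a # ys) = xs"
    and dropWhile_split: "dropWhile (\<lambda>x. x \<noteq> a) (xs @ a # ys) = a # ys"
    if "a \<notin> set xs" for xs ys
    using that by (induction xs) auto
  have w_split: "w = u @ a # B' @ c # drop (Suc i) w" using w u by simp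
  have bef: "before a w = u"
    unfolding before_def by (subst w_split) (rule takeWhile_split[OF u(2)])
  obtain B'' where B'': "B = B'' @ [a]"
    using lastB unfolding B_def by (metis append_butlast_last_id list.distinct(1))
  have not_in: "a \<notin> set (rev (c # drop (Suc i) w))" using a_drop ac by auto
  have "rev w = rev (c # drop (Suc i) w) @ a # rev B'' @ rev u"
    by (subst wB) (simp add: B'')
  then have aft: "after a w = c # drop (Suc i) w"
    unfolding after_def using takeWhile_split[OF not_in] by (metis rev_rev_ident)
  have "dropWhile (\<lambda>x. x \<noteq> a) w = B @ c # drop (Suc i) w"
    unfolding B_def by (subst w_split) (simp add: dropWhile_split[OF u(2)])
  then have "rev (dropWhile (\<lambda>x. x \<noteq> a) w) = rev (c # drop (Suc i) w) @ a # rev B''"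
    by (simp add: B'')
  then have blk: "block a w = B"
    unfolding block_def using dropWhile_split[OF not_in] by (simp add: B'')
  show ?thesis
  proof (rule that, unfold a_def[symmetric] c_def[symmetric])
    show "w = u @ B @ c # drop (Suc i) w" by (rule wB)
    show "length (u @ B) = i" using u(1) assms(3) unfolding B_def by (metis length_take min.absorb4)
    show "transposition w (a, c) = u @ c # B @ drop (Suc i) w"
      unfolding transposition_def by (simp add: bef blk aft)
  qed (use u lastB bef a_drop in \<open>simp_all add: B_def\<close>)
qed

text \<open>A new pattern would have \<open>c\<close> in the middle or a letter of \<open>B\<close>
  enclosed by copies of \<open>c\<close>. The latter fails as letters of \<open>B\<close> are at
  most \<open>a\<close>. In the former, the repeated letter lies in \<open>u\<close> and
  \<open>B\<close>, so it is smaller than \<open>a\<close> and would already surround the first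
  \<open>a\<close> of \<open>B\<close>.\<close>

lemma nested_transposition:
  assumes "nested (u @ B @ c # v)" "a \<notin> set u" "B \<noteq> []" "hd B = a" "last B = a" "a < c"
  shows "nested (u @ c # B @ v)"
  unfolding nested_def
proof (intro allI impI notI)
  let ?w = "u @ B @ c # v"
  have "set B \<subseteq> {..a}"
  proof
    fix x assume "x \<in> set B"
    show "x \<in> {..a}"
    proof (rule ccontr)
      assume "x \<notin> {..a}"
      then have "a < x" by simp
      obtain p q where B: "B = p @ x # q" using \<open>x \<in> set B\<close> by (meson split_list)
      have "p \<noteq> []" using B assms(4) \<open>a < x\<close> by auto
      then have "a \<in> set p" using B assms(4) by (metis hd_append2 hd_in_set)
      have "q \<noteq> []" using B assms(5) \<open>a < x\<close> by auto
      then have "a \<in> set q" using B assms(5) by (metis last_ConsR last_appendR last_in_set list.distinct(1))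
      have "?w = (u @ p) @ x # (q @ c # v)" by (simp add: B)
      from nestedD[OF assms(1) this \<open>a < x\<close>] \<open>a \<in> set p\<close> \<open>a \<in> set q\<close> show False by simp
    qed
  qed
  then have Bc: "x < c" if "x \<in> set B" for x using that assms(6) by auto
  have ub: "x \<notin> set u" if "x \<in> set B" "x \<noteq> a" for x
  proof
    assume "x \<in> set u"
    have B: "B = a # tl B" using assms(3,4) by (cases B) auto
    have "x < a" using that \<open>set B \<subseteq> {..a}\<close> by auto
    have "?w = u @ a # (tl B @ c # v)" by (subst B) simp
    from nestedD[OF assms(1) this \<open>x < a\<close> \<open>x \<in> set u\<close>] that B show False
      by (metis Un_iff set_ConsD set_append)
  qed
  fix p y q x assume eq: "u @ c # B @ v = p @ y # q" and xy: "x < y" "x \<in> set p" "x \<in> set q"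
  note N = nestedD[OF assms(1) _ xy(1)]
  consider (u) r where "u = p @ y # r" "q = r @ c # B @ v"
    | (c) "p = u" "y = c" "q = B @ v"
    | (B) r r' where "p = u @ c # r" "B = r @ y # r'" "q = r' @ v"
    | (v) r where "p = u @ c # B @ r" "v = r @ y # q"
  proof -
    have "(\<exists>r. u = p @ r \<and> r @ c # B @ v = y # q) \<or> (\<exists>r. u @ r = p \<and> c # B @ v = r @ y # q)"
      using eq unfolding append_eq_append_conv2 by auto
    then show ?thesis
    proof (elim disjE exE conjE)
      fix r assume r: "u = p @ r" "r @ c # B @ v = y # q"
      show ?thesis using r that(1)[of "tl r"] that(2) by (cases r) auto
    next
      fix r assume r: "u @ r = p" "c # B @ v = r @ y # q"
      show ?thesis
      proof (cases r)
        case Nil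
        with r that(2) show ?thesis by auto
      next
        case (Cons z r1)
        with r have z: "z = c" "B @ v = r1 @ y # q" by auto
        from z(2) have "(\<exists>t. B = r1 @ t \<and> t @ v = y # q) \<or> (\<exists>t. B @ t = r1 \<and> v = t @ y # q)"
          unfolding append_eq_append_conv2 by auto
        then show ?thesis
        proof (elim disjE exE conjE)
          fix t assume t: "B = r1 @ t" "t @ v = y # q"
          show ?thesis
          proof (cases t)
            case Nil
            with t r Cons z that(4)[of "[]"] show ?thesis by auto
          next
            case (Cons y' t')
            with t r \<open>r = z # r1\<close> z that(3)[of r1 t'] show ?thesis by auto
          qed
        next
          fix t assume "B @ t = r1" "v = t @ y # q"
          with r Cons z that(4)[of t] show ?thesis by auto
        qed
      qed
    qed
  qed
  then show False
  proof cases
    case u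
    with N[of p "r @ B @ c # v"] xy show False by auto
  next
    case c
    show False
    proof (cases "x \<in> set B")
      case True
      with ub[OF True] c xy assms(2) show False by auto
    next
      case False
      with c N[of "u @ B" v] xy show False by auto
    qed
  next
    case B
    have "y < c" using Bc B by auto
    with B N[of "u @ r" "r' @ c # v"] xy show False by auto
  next
    case v
    with N[of "u @ B @ c # r" q] xy show False by auto
  qed
qed

context composition begin

text \<open>If the pivot is a letter, its block is open at the cut, so no larger letter can be
  adjacent to the cut.\<close>

lemma last_letter_le_pivot:
  assumes w: "w \<in> SP" and i: "0 < i" "i \<le> length w"
  shows "w ! (i - 1) \<le> prefix_pivot s (take i w)"
proof (rule ccontr)
  define k where "k = prefix_pivot s (take i w)"
  assume "\<not> ?thesis"
  then have k: "k < w ! (i - 1)" by (simp add: k_def)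
  have "w ! (i - 1) \<le> n" using stirling_nth[OF w, of "i - 1"] i by auto
  then have "1 \<le> k" "k \<le> n" "0 < count_list (take i w) k" "count_list (take i w) k < count_list w k"
    using prefix_pivot(1,3,4)[OF w, of i] stirling_count[OF w, of k] k
    unfolding k_def[symmetric] by (auto simp: prefix_count_def)
  then show False
    using nested_count_take_Suc[OF stirling_nested[OF w] _ k] i by (cases i) auto
qed

lemma next_letter_le_pivot:
  assumes w: "w \<in> SP" and i: "0 < i" "i < length w" and asc: "w ! (i - 1) < w ! i"
  shows "w ! i \<le> prefix_pivot s (take i w)"
proof (rule ccontr)
  define k where "k = prefix_pivot s (take i w)"
  assume "\<not> ?thesis"
  then have k: "k < w ! i" by (simp add: k_def)
  have "w ! i \<le> n" using stirling_nth[OF w, of i] i by auto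
  then have "1 \<le> k" "k \<le> n" "0 < count_list (take i w) k" "count_list (take i w) k < count_list w k"
    using prefix_pivot(1,3,4)[OF w, of i] stirling_count[OF w, of k] k
    unfolding k_def[symmetric] by (auto simp: prefix_count_def)
  then show False
    using nested_count_take[OF stirling_nested[OF w] _ k] i by auto
qed

lemma transposition_in_SP:
  assumes w: "w \<in> SP" and i: "0 < i" "i < length w" and asc: "w ! (i - 1) < w ! i"
  shows "transposition w (w ! (i - 1), w ! i) \<in> SP"
proof -
  obtain u B v where *: "w = u @ B @ w ! i # v" "w ! (i - 1) \<notin> set u" "B \<noteq> []"
    "hd B = w ! (i - 1)" "last B = w ! (i - 1)"
    "transposition w (w ! (i - 1), w ! i) = u @ w ! i # B @ v"
    by (rule split_at_ascent[OF stirling_nested[OF w] i asc])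
  have "nested (u @ B @ w ! i # v)" using stirling_nested[OF w] *(1) by metis
  then have "nested (u @ w ! i # B @ v)" by (rule nested_transposition) (use * asc in auto)
  moreover have "count_list (u @ w ! i # B @ v) x = count_list w x" for x
    using arg_cong[OF *(1), of "\<lambda>l. count_list l x"] by simp
  ultimately show ?thesis using w unfolding *(6) stirling_perms_iff by simp
qed

lemma inversions_transposition:
  assumes w: "w \<in> SP" and i: "0 < i" "i < length w" and asc: "w ! (i - 1) < w ! i"
  shows "inversions (transposition w (w ! (i - 1), w ! i)) (w ! i) (w ! (i - 1)) =
    Suc (inversions w (w ! i) (w ! (i - 1)))"
proof -
  obtain u B v where *: "w ! (i - 1) \<notin> set u" "B \<noteq> []" "hd B = w ! (i - 1)"
    "before (w ! (i - 1)) w = u" "transposition w (w ! (i - 1), w ! i) = u @ w ! i # B @ v"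
    by (rule split_at_ascent[OF stirling_nested[OF w] i asc])
  have B: "B = w ! (i - 1) # tl B" using *(2,3) by (cases B) auto
  have "before (w ! (i - 1)) (u @ w ! i # B @ v) = u @ [w ! i]"
    unfolding before_def using *(1) asc
    by (subst B) (auto simp: takeWhile_append takeWhile_eq_all_conv)
  then show ?thesis unfolding inversions_def *(4,5) by simp
qed

lemma perm_routes_transposition:
  assumes w: "w \<in> SP" and i: "0 < i" "i < length w" and asc: "w ! (i - 1) < w ! i"
  shows "perm_routes w \<inter> perm_routes (transposition w (w ! (i - 1), w ! i)) =
    perm_routes w - {prefix_route s (take i w)}"
proof -
  define a c where "a = w ! (i - 1)" and "c = w ! i"
  define w' where "w' = transposition w (a, c)"
  have ac: "a < c" using asc by (simp add: a_def c_def)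
  have w': "w' \<in> SP" unfolding w'_def a_def c_def by (rule transposition_in_SP[OF assms])
  obtain u B v where w_eq: "w = u @ B @ c # v" and len: "length (u @ B) = i" and
    "a \<notin> set u" "B \<noteq> []" "hd B = a" "last B = a" "a \<notin> set v" and w'_eq: "w' = u @ c # B @ v"
    unfolding a_def c_def w'_def by (rule split_at_ascent[OF stirling_nested[OF w] i asc]) blast
  have acn: "1 \<le> a" "c \<le> n" using stirling_nth[OF w] i unfolding a_def c_def by auto
  have len': "length w' = length w" by (subst w_eq, subst w'_eq) simp
  \<comment> \<open>At the ascent all \<open>a\<close> are used up with only
    \<open>inversions w c a\<close> letters \<open>c\<close> read; in \<open>w'\<close> one more
    \<open>c\<close> precedes \<open>a\<close>, which excludes this route.\<close>
  have "prefix_route s (take i w) \<notin> perm_routes w'"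
  proof
    assume mem: "prefix_route s (take i w) \<in> perm_routes w'"
    let ?Q = "prefix_route s (take i w)"
    have cQ: "c \<le> length ?Q"
      using next_letter_le_pivot[OF assms] by (simp add: length_prefix_route[OF w] c_def)
    have vals: "val ?Q a = count_list (take i w) a" "val ?Q c = count_list (take i w) c"
      using val_prefix_route'[OF w, of a i] val_prefix_route'[OF w, of c i] cQ ac acn by auto
    have "take i w = u @ B" using len by (subst w_eq) simp
    moreover have "count_list w a = count_list (u @ B) a"
      using \<open>a \<notin> set v\<close> ac by (subst w_eq) simp
    ultimately have "val ?Q a = part s a" using vals stirling_count[OF w, of a] ac acn by simp
    then have "inversions w' c a \<le> val ?Q c"
      using mem_perm_routes_iff[OF w' prefix_route_in_routes[OF w], THEN iffD1, OF mem, rule_format, of a c]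
        cQ ac acn by simp
    moreover have "a \<in> set (take i w)"
      using i unfolding a_def by (auto simp: in_set_conv_nth intro!: exI[of _ "i - 1"])
    then have "inversions w c a = count_list (take i w) c"
      using inversions_eq_count_take[OF stirling_nested[OF w] ac] i by (simp add: a_def)
    ultimately show False
      using inversions_transposition[OF assms] vals unfolding w'_def a_def c_def by simp
  qed
  moreover have "prefix_route s (take j w) \<in> perm_routes w'" if j: "j \<le> length w" "j \<noteq> i" for j
  proof -
    \<comment> \<open>Moving \<open>c\<close> in front of \<open>B\<close> shifts the cuts strictly
      inside \<open>B\<close> by one; all others keep their place.\<close>
    define j' where "j' = (if length u < j \<and> j < i then Suc j else j)"
    have "prefix_route s (take j' w') = prefix_route s (take j w)"
    proof (rule prefix_route_eqI'[OF w' prefix_route_in_routes[OF w]])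
      fix x assume x: "1 \<le> x" "x \<le> length (prefix_route s (take j w))" "x \<le> n"
      have "count_list (take j w) x = count_list (take j' w') x"
      proof (cases "length u < j \<and> j < i")
        case True
        then have tk: "take j w = u @ take (j - length u) B" "take j' w' = u @ c # take (j - length u) B"
          using len by (subst w_eq, simp add: j'_def, subst w'_eq, simp add: j'_def take_Cons')
        have "take (j - length u) B = a # take (j - length u - 1) (tl B)"
          using True \<open>B \<noteq> []\<close> \<open>hd B = a\<close> by (cases B) (auto simp: take_Cons')
        then have "0 < count_list (take j w) a" using tk by simp
        moreover have "a \<in> set (drop j w)"
          using True i unfolding a_def by (auto simp: in_set_conv_nth intro!: exI[of _ "i - 1 - j"])
        then have "count_list (take j w) a < count_list w a"
          by (metis append_take_drop_id count_list_append count_list_0_iff add_diff_cancel_left'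
              less_add_same_cancel1 neq0_conv)
        ultimately have "prefix_pivot s (take j w) \<le> a"
          unfolding prefix_pivot_def using acn ac stirling_count[OF w, of a]
          by (intro Least_le) (auto simp: prefix_count_def)
        then have "x < c" using x ac by (simp add: length_prefix_route[OF w])
        then show ?thesis using tk by simp
      next
        case False
        then have "j' = j" by (auto simp: j'_def)
        have "j \<le> length u \<or> i < j" using False j by auto
        then show ?thesis
        proof
          assume "j \<le> length u"
          then have "take j w = take j w'" by (subst w_eq, subst w'_eq) simp
          with \<open>j' = j\<close> show ?thesis by simp
        next
          assume "i < j"
          then have "take j w = u @ B @ c # take (j - Suc i) v" "take j w' = u @ c # B @ take (j - Suc i) v"
            using len by (subst w_eq, simp add: take_Cons', subst w'_eq, simp add: take_Cons')
          with \<open>j' = j\<close> show ?thesis by simp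
        qed
      qed
      then show "val (prefix_route s (take j w)) x = count_list (take j' w') x"
        using val_prefix_route'[OF w x(1,2,3)] by simp
    qed
    moreover have "j' \<le> length w'" using j i len' by (auto simp: j'_def)
    ultimately show ?thesis unfolding perm_routes_def by (metis (mono_tags, lifting) CollectI)
  qed
  ultimately show ?thesis
    unfolding w'_def[symmetric] a_def[symmetric] c_def[symmetric] perm_routes_def by auto
qed

subsection \<open>Faces\<close>

text \<open>A cut is dropped when its two neighbouring letters form an ascent in \<open>A\<close>;
  the two ends of the word are always kept.\<close>

definition kept :: "nat list \<Rightarrow> (nat \<times> nat) set \<Rightarrow> nat \<Rightarrow> bool" where
  "kept w A i \<longleftrightarrow> i \<le> length w \<and> \<not> (0 < i \<and> i < length w \<and> (w ! (i - 1), w ! i) \<in> A)"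

definition face_routes :: "nat list \<Rightarrow> (nat \<times> nat) set \<Rightarrow> (nat \<times> nat) list set" where
  "face_routes w A = {prefix_route s (take i w) | i. kept w A i}"

lemma face_routes_subset: "face_routes w A \<subseteq> perm_routes w"
  by (auto simp: face_routes_def perm_routes_def kept_def)

lemma ascent_position:
  assumes "A \<subseteq> ascents w" "x \<in> A"
  obtains i where "0 < i" "i < length w" "x = (w ! (i - 1), w ! i)" "w ! (i - 1) < w ! i"
proof -
  obtain a c where x: "x = (a, c)" by (cases x)
  then have "(a, c) \<in> ascents w" using assms by auto
  with that x show ?thesis unfolding ascents_iff by blast
qed

text \<open>Each transposition loses exactly the route at its own ascent, and different cuts have
  different routes.\<close>

lemma face_routes_eq_Int:
  assumes w: "w \<in> SP" and A: "A \<subseteq> ascents w"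
  shows "face_routes w A = perm_routes w \<inter> (\<Inter>x\<in>A. perm_routes (transposition w x))"
proof (intro equalityI subsetI)
  fix Q assume "Q \<in> face_routes w A"
  then obtain j where j: "Q = prefix_route s (take j w)" "kept w A j" unfolding face_routes_def by blast
  have Q: "Q \<in> perm_routes w" using j unfolding perm_routes_def kept_def by blast
  have "Q \<in> perm_routes (transposition w x)" if x: "x \<in> A" for x
  proof -
    obtain i where i: "0 < i" "i < length w" "x = (w ! (i - 1), w ! i)" "w ! (i - 1) < w ! i"
      using ascent_position[OF A x] .
    have "j \<noteq> i" using j(2) i x unfolding kept_def by auto
    then have "Q \<noteq> prefix_route s (take i w)"
      using prefix_route_inj[OF w, of j i] i j unfolding kept_def by auto
    with Q perm_routes_transposition[OF w i(1,2,4)] i(3) show ?thesis by auto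
  qed
  with Q show "Q \<in> perm_routes w \<inter> (\<Inter>x\<in>A. perm_routes (transposition w x))" by blast
next
  fix Q assume Q: "Q \<in> perm_routes w \<inter> (\<Inter>x\<in>A. perm_routes (transposition w x))"
  then obtain j where j: "Q = prefix_route s (take j w)" "j \<le> length w" unfolding perm_routes_def by blast
  have "kept w A j"
  proof (rule ccontr)
    assume "\<not> ?thesis"
    with j have x: "0 < j" "j < length w" "(w ! (j - 1), w ! j) \<in> A" unfolding kept_def by auto
    then have "w ! (j - 1) < w ! j" using A by (auto simp: ascents_def)
    from perm_routes_transposition[OF w x(1,2) this] Q x j show False by blast
  qed
  with j show "Q \<in> face_routes w A" unfolding face_routes_def by blast
qed

lemma face_simplex_eq:
  assumes w: "w \<in> SP" and A: "A \<subseteq> ascents w"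
  shows "face_simplex s (w, A) = convex hull (route_vector ` face_routes w A)"
proof (cases "A = {}")
  case True
  then have "face_routes w A = perm_routes w"
    by (auto simp: face_routes_def perm_routes_def kept_def)
  with True show ?thesis by (simp add: face_simplex_def perm_simplex_eq[OF w])
next
  case False
  have tr: "transposition w x \<in> SP" if "x \<in> A" for x
    by (rule ascent_position[OF A that]) (use transposition_in_SP[OF w] in simp)
  have fin: "finite A"
  proof (rule finite_subset)
    show "A \<subseteq> set w \<times> set w"
    proof
      fix x assume "x \<in> A"
      from ascent_position[OF A this] show "x \<in> set w \<times> set w" by (metis SigmaI less_imp_diff_less nth_mem)
    qed
  qed auto
  have "(\<Inter>x\<in>B. perm_simplex s w \<inter> perm_simplex s (transposition w x)) =
    convex hull (route_vector ` (perm_routes w \<inter> (\<Inter>x\<in>B. perm_routes (transposition w x))))"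
    if "finite B" "B \<noteq> {}" "B \<subseteq> A" for B
    using that
  proof (induction rule: finite_ne_induct)
    case (singleton x)
    then show ?case
      using tr by (simp add: perm_simplex_eq w hull_Int perm_routes_chain)
  next
    case (insert x B)
    let ?I = "perm_routes w \<inter> (\<Inter>x\<in>B. perm_routes (transposition w x))"
    have x: "transposition w x \<in> SP" using insert.prems tr by simp
    \<comment> \<open>Every partial intersection lies inside \<open>perm_routes w\<close> and so
      remains coherent, as \<open>hull_Int\<close> requires.\<close>
    have ch: "chain ?I" by (rule chain_mono[OF perm_routes_chain[OF w]]) blast
    have "(\<Inter>x\<in>insert x B. perm_simplex s w \<inter> perm_simplex s (transposition w x)) =
      convex hull (route_vector ` perm_routes (transposition w x)) \<inter>
      (convex hull (route_vector ` perm_routes w) \<inter> convex hull (route_vector ` ?I))"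
      using insert.IH insert.prems by (auto simp: perm_simplex_eq w x)
    also have "\<dots> = convex hull (route_vector `
      (perm_routes (transposition w x) \<inter> (perm_routes w \<inter> ?I)))"
      by (simp only: hull_Int ch perm_routes_chain w x
          chain_mono[OF perm_routes_chain[OF w] Int_lower1])
    also have "perm_routes (transposition w x) \<inter> (perm_routes w \<inter> ?I) =
      perm_routes w \<inter> (\<Inter>x\<in>insert x B. perm_routes (transposition w x))" by auto
    finally show ?case .
  qed
  from this[OF fin False order_refl] False face_routes_eq_Int[OF w A] show ?thesis
    by (simp add: face_simplex_def)
qed

section \<open>Coverage and lower bound of a face\<close>

text \<open>Skipping a dropped cut means crossing an ascent, so the letters passed increase
  strictly; the walk stops at the end of the word at the latest.\<close>

lemma ex_kept_after:
  assumes "A \<subseteq> ascents w" "0 < i" "i \<le> length w"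
  shows "\<exists>j\<ge>i. kept w A j \<and> (\<forall>l. i \<le> l \<and> l < j \<longrightarrow> w ! (i - 1) < w ! l) \<and> w ! (i - 1) \<le> w ! (j - 1)"
  using assms(3,2)
proof (induction i rule: inc_induct)
  case base
  show ?case by (intro exI[of _ "length w"]) (simp add: kept_def)
next
  case (step i)
  show ?case
  proof (cases "kept w A i")
    case True
    then show ?thesis by (intro exI[of _ i]) simp
  next
    case False
    then have "(w ! (i - 1), w ! i) \<in> A" using step by (simp add: kept_def)
    then have lt: "w ! (i - 1) < w ! i" using assms(1) by (auto simp: ascents_def)
    obtain j where j: "Suc i \<le> j" "kept w A j" "\<And>l. Suc i \<le> l \<Longrightarrow> l < j \<Longrightarrow> w ! i < w ! l" "w ! i \<le> w ! (j - 1)"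
      using step.IH by auto
    have "w ! (i - 1) < w ! l" if "i \<le> l" "l < j" for l
      using j(3)[of l] that lt by (cases "l = i") auto
    moreover have "w ! (i - 1) \<le> w ! (j - 1)" using j(4) lt by linarith
    ultimately show ?thesis using j(1,2) by (intro exI[of _ j]) auto
  qed
qed

text \<open>A substitute for a cut that \<open>A\<close> may have dropped: on the way to the next
  kept cut only larger letters are passed, so the counts up to \<open>w ! (i - 1)\<close> are
  unchanged and the pivot stays at or above this letter.\<close>

lemma ex_face_route:
  assumes w: "w \<in> SP" and A: "A \<subseteq> ascents w" and i: "0 < i" "i \<le> length w"
  shows "\<exists>Q\<in>face_routes w A. w ! (i - 1) \<le> length Q \<and>
    (\<forall>x. 1 \<le> x \<and> x \<le> w ! (i - 1) \<longrightarrow> val Q x = count_list (take i w) x)"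
proof -
  obtain j where j: "i \<le> j" "kept w A j" "\<forall>l. i \<le> l \<and> l < j \<longrightarrow> w ! (i - 1) < w ! l"
    "w ! (i - 1) \<le> w ! (j - 1)"
    using ex_kept_after[OF A i] by blast
  let ?Q = "prefix_route s (take j w)"
  have jl: "0 < j" "j \<le> length w" using j i unfolding kept_def by auto
  have len: "w ! (i - 1) \<le> length ?Q"
    using last_letter_le_pivot[OF w jl] j(4) by (simp add: length_prefix_route[OF w])
  have wi: "w ! (i - 1) \<le> n" using stirling_nth[OF w, of "i - 1"] i by auto
  have "val ?Q x = count_list (take i w) x" if x: "1 \<le> x" "x \<le> w ! (i - 1)" for x
  proof -
    have "x \<notin> set (take (j - i) (drop i w))"
    proof
      assume "x \<in> set (take (j - i) (drop i w))"
      then obtain l where "l < j - i" "i + l < length w" "w ! (i + l) = x"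
        using i by (auto simp: in_set_conv_nth)
      moreover from this have "i + l < j" by linarith
      ultimately show False using j(3)[rule_format, of "i + l"] x by simp
    qed
    moreover have "take j w = take i w @ take (j - i) (drop i w)"
      using j(1) by (metis le_add_diff_inverse take_add)
    ultimately have "count_list (take j w) x = count_list (take i w) x" by simp
    then show ?thesis using val_prefix_route'[OF w x(1), of j] len x wi by simp
  qed
  with len j(2) show ?thesis unfolding face_routes_def by blast
qed

lemma ex_occurrence:
  assumes "0 < t" "t \<le> count_list w x"
  obtains i where "0 < i" "i \<le> length w" "w ! (i - 1) = x" "count_list (take i w) x = t"
proof -
  let ?P = "\<lambda>i. t \<le> count_list (take i w) x"
  define i where "i = (LEAST i. ?P i)"
  have P: "?P (length w)" using assms by simp
  have Pi: "?P i" unfolding i_def by (rule LeastI[of ?P, OF P])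
  have il: "i \<le> length w" unfolding i_def by (rule Least_le[of ?P, OF P])
  have i0: "i \<noteq> 0" using Pi assms(1) by (cases "i = 0") auto
  then obtain j where j: "i = Suc j" by (cases i) auto
  have "\<not> ?P j" using not_less_Least[of j ?P] j unfolding i_def by simp
  with Pi count_list_take_Suc[of j w x] il j have "w ! j = x" "count_list (take i w) x = t"
    by (auto split: if_splits)
  with that[of i] il j show ?thesis by simp
qed

lemma prefix_route_Nil:
  assumes w: "w \<in> SP"
  shows "length (prefix_route s (take 0 w)) = Suc n"
proof -
  have "prefix_pivot s (take 0 w) = Suc n"
    using prefix_pivot(1-3)[OF w, of 0] by (auto simp: prefix_count_def split: if_splits)
  then show ?thesis by (simp only: length_prefix_route[OF w])
qed

lemma face_routes_chain: "w \<in> SP \<Longrightarrow> chain (face_routes w A)"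
  by (rule chain_mono[OF perm_routes_chain face_routes_subset])

lemma face_routes_covering:
  assumes w: "w \<in> SP" and A: "A \<subseteq> ascents w"
  shows "covering (face_routes w A)"
  unfolding covering_def
proof (clarify)
  fix i t assume e: "(i, t) \<in> arcs (oruga s)"
  let ?R = "prefix_route s (take 0 w)"
  have R: "?R \<in> routes s" using prefix_route_in_routes[OF w] .
  have Rf: "?R \<in> face_routes w A" unfolding face_routes_def kept_def by blast
  show "\<exists>R\<in>face_routes w A. (i, t) \<in> set R"
  proof (cases "i = Suc n")
    case True
    then have "t = 1" using e part_last by (auto simp: arcs_iff)
    then have "(i, t) \<in> set ?R"
      using True in_route_iff[OF R, of i t] prefix_route_Nil[OF w] val_last[OF R] by simp
    with Rf show ?thesis by blast
  next
    case False
    then have i: "1 \<le> i" "i \<le> n" "t \<le> part s i" using e by (auto simp: arcs_iff)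
    show ?thesis
    proof (cases "t = 0")
      case True
      have "(i, t) \<in> set ?R"
        using True in_route_iff[OF R, of i t] i prefix_route_Nil[OF w] val_prefix_route'[OF w i(1), of 0]
        by simp
      with Rf show ?thesis by blast
    next
      case False
      \<comment> \<open>An edge with \<open>t > 0\<close> is used right after the
        \<open>t\<close>-th letter \<open>i\<close>, or by the substitute for that cut.\<close>
      then obtain p where p: "0 < p" "p \<le> length w" "w ! (p - 1) = i" "count_list (take p w) i = t"
        using ex_occurrence[of t w i] i stirling_count[OF w, of i] by auto
      obtain Q where Q: "Q \<in> face_routes w A" "w ! (p - 1) \<le> length Q"
        "\<forall>x. 1 \<le> x \<and> x \<le> w ! (p - 1) \<longrightarrow> val Q x = count_list (take p w) x"
        using ex_face_route[OF w A p(1,2)] by blast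
      have "Q \<in> routes s" using Q(1) chain_routes[OF face_routes_chain[OF w]] by blast
      then have "(i, t) \<in> set Q" using Q(2) Q(3)[rule_format, of i] p i in_route_iff[of Q i t] by simp
      with Q(1) show ?thesis by blast
    qed
  qed
qed

text \<open>If \<open>a\<close> is preceded by \<open>t > 0\<close> letters \<open>c\<close>, the
  prefix ending in the \<open>t\<close>-th \<open>c\<close> still avoids \<open>a\<close>; its
  substitute in the face has the same counts up to \<open>c\<close> and raises \<open>lo\<close> to
  \<open>t\<close>.\<close>

lemma inversions_eq_lo:
  assumes w: "w \<in> SP" and A: "A \<subseteq> ascents w" and ac: "1 \<le> a" "a < c" "c \<le> n"
  shows "inversions w c a = lo (face_routes w A) c a"
proof (rule antisym)
  let ?C = "face_routes w A"
  note C = face_routes_chain[OF w, of A] face_routes_covering[OF w A]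
  show "lo ?C c a \<le> inversions w c a"
    using subset_perm_routes_iff[OF C w] face_routes_subset ac by blast
  show "inversions w c a \<le> lo ?C c a"
  proof (cases "inversions w c a = 0")
    case False
    then obtain p where p: "0 < p" "p \<le> length w" "w ! (p - 1) = c" "count_list (take p w) c = inversions w c a"
      using ex_occurrence[of "inversions w c a" w c] inversions_le_count by auto
    obtain Q where Q: "Q \<in> ?C" "w ! (p - 1) \<le> length Q"
      "\<forall>x. 1 \<le> x \<and> x \<le> w ! (p - 1) \<longrightarrow> val Q x = count_list (take p w) x"
      using ex_face_route[OF w A p(1,2)] by blast
    have "a \<notin> set (take p w)"
    proof
      assume a: "a \<in> set (take p w)"
      obtain q where q: "p = Suc q" using p(1) by (cases p) auto
      have "a \<in> set (take q w)"
        using a q p ac by (auto simp: take_Suc_conv_app_nth)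
      then have "inversions w c a \<le> count_list (take q w) c" by (rule inversions_le_count_take)
      with p q show False by (simp add: count_list_take_Suc)
    qed
    then have "val Q a = 0" "val Q c = inversions w c a" using Q(3)[rule_format, of a] Q(3)[rule_format, of c] p ac by auto
    with le_lo[OF C Q(1), of c a] Q(2) p show ?thesis by simp
  qed simp
qed

text \<open>The bound at the prefix of length \<open>i\<close> is inherited from a longer prefix: one ending in the next
  copy of the same letter \<open>x\<close>, one ending in the last copy of a letter whose block contains that of \<open>x\<close>,
  or the one beyond an ascent \<open>(x, d) \<in> A\<close>. It is created at an ascent \<open>(x, c) \<in> A\<close>; if the walk
  skipped \<open>c\<close>, it would meet a route excluded by the hypothesis \<open>no\<close>.\<close>

lemma inversions_upper_bound:
  assumes w: "w \<in> SP" and A: "A \<subseteq> ascents w" and y: "y \<in> SP"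
    and wy: "weak_le s w y" and Ay: "\<And>x. x \<in> A \<Longrightarrow> weak_le s (transposition w x) y"
    and a: "1 \<le> a" and c: "c \<le> n"
    and no: "\<And>Q. Q \<in> face_routes w A \<Longrightarrow> c \<le> length Q \<Longrightarrow> val Q a = part s a \<Longrightarrow> val Q c \<noteq> t"
    and i: "0 < i" "i \<le> length w" and last: "w ! (i - 1) < c" and ac: "a < c"
    and full: "count_list (take i w) a = part s a" and ct: "count_list (take i w) c = t"
  shows "t < inversions y c (w ! (i - 1))"
  using i last full ct
proof (induction "length w - i" arbitrary: i rule: less_induct)
  case less
  define x where "x = w ! (i - 1)"
  have nw: "nested w" and ny: "nested y" using stirling_nested w y by auto
  have x: "1 \<le> x" "x < c" "x \<le> n" using stirling_nth[OF w, of "i - 1"] less.prems c unfolding x_def by auto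
  have x_in: "x \<in> set (take i w)"
    using less.prems unfolding x_def by (auto simp: in_set_conv_nth intro!: exI[of _ "i - 1"])
  have iny: "b \<in> set y" if "1 \<le> b" "b \<le> n" for b using stirling_set[OF y] that by simp
  have full_later: "count_list (take j w) a = part s a" if "i \<le> j" for j
    using count_list_take_mono[OF that, of w a] count_list_take_le[of j w a] less.prems
      stirling_count[OF w a] ac c by simp
  \<comment> \<open>The block of \<open>b\<close> is open at the cut, so no \<open>c\<close> is met
    on the way to a further copy of \<open>b\<close>.\<close>
  have later: "\<exists>j>i. j \<le> length w \<and> w ! (j - 1) = b \<and> count_list (take j w) c = t"
    if b: "b \<in> set (take i w)" "b \<in> set (drop i w)" "b < c" for b
  proof -
    obtain l where l: "l < length w - i" "w ! (i + l) = b"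
      using b(2) by (auto simp: in_set_conv_nth)
    let ?j = "Suc (i + l)"
    have "b \<in> set (take ?j w)" using b(1) set_take_subset_set_take[of i ?j w] by auto
    then have "inversions w c b = count_list (take ?j w) c"
      using inversions_eq_count_take[OF nw b(3), of ?j] l by simp
    moreover have "inversions w c b = count_list (take i w) c"
      using inversions_eq_count_take[OF nw b(3,1)] b(2) less.prems by simp
    ultimately show ?thesis using l less.prems by (intro exI[of _ ?j]) auto
  qed
  have inv_x: "inversions w b x = count_list (take i w) b" if "x < b" for b
    using inversions_eq_count_take[OF nw that x_in less.prems(2)] x_def by simp
  show ?case
    unfolding x_def[symmetric]
  proof (cases "x \<in> set (drop i w)")
    case True
    obtain j where j: "i < j" "j \<le> length w" "w ! (j - 1) = x" "count_list (take j w) c = t"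
      using later[OF x_in True x(2)] by blast
    then show "t < inversions y c x"
      using less.hyps[of j] x full_later[of j] by auto
  next
    case False
    have "count_list w x = count_list (take i w) x + count_list (drop i w) x"
      by (metis append_take_drop_id count_list_append)
    with False have x_full: "count_list (take i w) x = part s x" using stirling_count[OF w x(1,3)] by simp
    \<comment> \<open>As \<open>x\<close> is used up and the pivot is at least the last letter, the
      pivot \<open>k\<close> exceeds \<open>x\<close>. If \<open>k < c\<close>, the cut lies in the
      open block of \<open>k\<close>; otherwise the route reaches \<open>c\<close>.\<close>
    define k where "k = prefix_pivot s (take i w)"
    have "x \<le> k" using last_letter_le_pivot[OF w less.prems(1,2)] by (simp add: x_def k_def)
    moreover have "x \<noteq> k"
      using prefix_pivot(4)[OF w, of i] x_full x(3) unfolding k_def[symmetric] by (auto simp: prefix_count_def)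
    ultimately have xk: "x < k" by simp
    show "t < inversions y c x"
    proof (cases "k < c")
      case True
      then have kn: "1 \<le> k" "k \<le> n" using c xk by auto
      have k: "0 < count_list (take i w) k" "count_list (take i w) k < part s k"
        using prefix_pivot(3,4)[OF w, of i] kn unfolding k_def[symmetric] by (auto simp: prefix_count_def)
      have "count_list w k = count_list (take i w) k + count_list (drop i w) k"
        by (metis append_take_drop_id count_list_append)
      with k stirling_count[OF w kn] have "count_list (drop i w) k \<noteq> 0" by simp
      then have "k \<in> set (drop i w)" by (simp add: count_list_0_iff)
      moreover have "k \<in> set (take i w)" using k(1) by (metis count_list_0_iff less_irrefl)
      ultimately obtain j where j: "i < j" "j \<le> length w" "w ! (j - 1) = k" "count_list (take j w) c = t"
        using later[of k] True by blast
      then have "t < inversions y c k" using less.hyps[of j] True full_later[of j] less.prems by auto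
      \<comment> \<open>Some \<open>k\<close> precedes the first \<open>x\<close> in
        \<open>w\<close> and hence in \<open>y\<close>, so transitivity passes the bound from
        \<open>k\<close> to \<open>x\<close>.\<close>
      moreover have "inversions w k x \<le> inversions y k x"
        using wy x(1) xk kn unfolding weak_le_def by blast
      then have "0 < inversions y k x" using inv_x[OF xk] k by simp
      then have "inversions y c k \<le> inversions y c x"
        by (rule inversions_trans[OF iny[OF x(1,3)]])
      ultimately show ?thesis by simp
    next
      case False
      let ?Q = "prefix_route s (take i w)"
      have cQ: "c \<le> length ?Q" using False by (simp add: length_prefix_route[OF w] k_def)
      have "val ?Q a = part s a" "val ?Q c = t"
        using val_prefix_route'[OF w, of a i] val_prefix_route'[OF w, of c i] cQ a ac c less.prems by auto
      \<comment> \<open>The route has the values forbidden by \<open>no\<close>, so its cut is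
        dropped: the next letter forms an ascent in \<open>A\<close> with \<open>x\<close>, and
        \<open>y\<close> lies above the transposition there.\<close>
      then have "?Q \<notin> face_routes w A" using no[of ?Q] cQ by blast
      then have "\<not> kept w A i" unfolding face_routes_def by blast
      then have il: "i < length w" and asc: "(x, w ! i) \<in> A"
        using less.prems unfolding kept_def x_def by auto
      define d where "d = w ! i"
      have xd: "x < d" using asc A unfolding d_def by (auto simp: ascents_def)
      have dn: "d \<le> n" using stirling_nth[OF w il] by (simp add: d_def)
      have "inversions (transposition w (x, d)) d x = Suc (inversions w d x)"
        using inversions_transposition[OF w less.prems(1) il] xd unfolding x_def d_def by simp
      moreover have "weak_le s (transposition w (x, d)) y" using Ay asc by (simp add: d_def)
      then have "inversions (transposition w (x, d)) d x \<le> inversions y d x"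
        using x(1) xd dn unfolding weak_le_def by blast
      ultimately have inv_d: "inversions w d x < inversions y d x" by simp
      consider "d = c" | "d < c" | "c < d" by linarith
      then show ?thesis
      proof cases
        case 1
        then show ?thesis using inv_d inv_x[OF x(2)] less.prems by simp
      next
        case 2
        have "count_list (take (Suc i) w) c = t"
          using 2 less.prems il by (simp add: count_list_take_Suc d_def)
        then have "t < inversions y c d"
          using less.hyps[of "Suc i"] 2 il full_later[of "Suc i"] by (simp add: d_def)
        moreover have "inversions y c d \<le> inversions y c x"
          by (rule inversions_trans[OF iny[OF x(1,3)]]) (use inv_d in simp)
        ultimately show ?thesis by simp
      next
        case 3
        obtain Q where Q: "Q \<in> face_routes w A" "d \<le> length Q"
          "\<forall>z. 1 \<le> z \<and> z \<le> d \<longrightarrow> val Q z = count_list (take (Suc i) w) z"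
          using ex_face_route[OF w A, of "Suc i"] il unfolding d_def by auto
        have "val Q a = part s a" using Q(3) 3 ac a full_later[of "Suc i"] by simp
        moreover have "val Q c = t"
          using Q(3)[rule_format, of c] 3 ac less.prems il by (simp add: count_list_take_Suc d_def)
        ultimately show ?thesis using no[OF Q(1)] Q(2) 3 by simp
      qed
    qed
  qed
qed

section \<open>Joins, intervals and inclusion of faces\<close>

text \<open>An upper bound dominates \<open>w\<close>, so it can only fall short of \<open>z\<close>
  at pairs with \<open>hi = lo + 1\<close>; there \<open>inversions_upper_bound\<close> supplies the
  missing unit.\<close>

lemma add_ascents_eq:
  assumes w: "w \<in> SP" and A: "A \<subseteq> ascents w" and z: "z \<in> SP"
    and inv: "\<And>a c. 1 \<le> a \<Longrightarrow> a < c \<Longrightarrow> c \<le> n \<Longrightarrow> inversions z c a = hi (face_routes w A) c a"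
  shows "add_ascents s w A = z"
proof -
  let ?C = "face_routes w A"
  note C = face_routes_chain[OF w, of A] face_routes_covering[OF w A]
  have below: "weak_le s v z" if "v \<in> SP" "?C \<subseteq> perm_routes v" for v
    using that subset_perm_routes_iff[OF C] inv unfolding weak_le_def by simp
  have upper: "weak_le s v z" if "v \<in> insert w (transposition w ` A)" for v
  proof -
    have "transposition w x \<in> SP" if "x \<in> A" for x
      by (rule ascent_position[OF A that]) (use transposition_in_SP[OF w] in simp)
    moreover have "?C \<subseteq> perm_routes (transposition w x)" if "x \<in> A" for x
      using face_routes_eq_Int[OF w A] that by blast
    ultimately show ?thesis using that below w face_routes_subset by blast
  qed
  have least: "weak_le s z y" if y: "y \<in> SP" "\<forall>v\<in>insert w (transposition w ` A). weak_le s v y" for y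
    unfolding weak_le_def
  proof (intro allI impI)
    fix a c assume "1 \<le> a \<and> a < c \<and> c \<le> n"
    then have ac: "1 \<le> a" "a < c" "c \<le> n" by auto
    define t where "t = inversions w c a"
    have "t \<le> inversions y c a" using y(2) ac unfolding weak_le_def t_def by blast
    have lo: "lo ?C c a = t" using inversions_eq_lo[OF w A ac] by (simp add: t_def)
    show "inversions z c a \<le> inversions y c a"
    proof (cases "hi ?C c a \<le> t")
      case True
      with \<open>t \<le> inversions y c a\<close> inv[OF ac] show ?thesis by simp
    next
      case False
      then have hi: "hi ?C c a = Suc t" using hi_le_Suc_lo[OF C ac] lo by simp
      \<comment> \<open>The walk starts at the last \<open>a\<close>, where the count of
        \<open>c\<close> is still \<open>t\<close>. Because \<open>hi\<close> exceeds
        \<open>t\<close>, no route of the face that has used up \<open>a\<close> has exactly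
        \<open>t\<close> letters \<open>c\<close>.\<close>
      obtain i where i: "0 < i" "i \<le> length w" "w ! (i - 1) = a" "count_list (take i w) a = part s a"
        using ex_occurrence[of "part s a" w a] stirling_count[OF w, of a] part_pos[of a] ac by auto
      have "a \<in> set (take i w)"
        using i by (auto simp: in_set_conv_nth intro!: exI[of _ "i - 1"])
      then have "count_list (take i w) c = t"
        using inversions_eq_count_take[OF stirling_nested[OF w] ac(2)] i unfolding t_def by simp
      moreover have "val Q c \<noteq> t" if "Q \<in> ?C" "c \<le> length Q" "val Q a = part s a" for Q
        using hi_le[OF C that] hi by simp
      ultimately have "t < inversions y c (w ! (i - 1))"
        using y(2) i ac by (intro inversions_upper_bound[OF w A y(1), of a]) auto
      then show ?thesis using inv[OF ac] hi i by simp
    qed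
  qed
  show ?thesis
    unfolding add_ascents_def weak_join_def
  proof (rule the_equality)
    show "z \<in> SP \<and> (\<forall>x\<in>insert w (transposition w ` A). weak_le s x z) \<and>
      (\<forall>y\<in>SP. (\<forall>x\<in>insert w (transposition w ` A). weak_le s x y) \<longrightarrow> weak_le s z y)"
      using z upper least by blast
  next
    fix z' assume z': "z' \<in> SP \<and> (\<forall>x\<in>insert w (transposition w ` A). weak_le s x z') \<and>
      (\<forall>y\<in>SP. (\<forall>x\<in>insert w (transposition w ` A). weak_le s x y) \<longrightarrow> weak_le s z' y)"
    have "weak_le s z z'" using least z' by blast
    moreover have "weak_le s z' z" using z' z upper by blast
    ultimately show "z' = z" using weak_le_antisym z z' by blast
  qed
qed

lemma weak_interval_eq:
  assumes w: "w \<in> SP" and A: "A \<subseteq> ascents w"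
  shows "weak_interval s w (add_ascents s w A) = {y \<in> SP. face_routes w A \<subseteq> perm_routes y}"
proof -
  note C = face_routes_chain[OF w, of A] face_routes_covering[OF w A]
  obtain z where z: "z \<in> SP"
    "\<forall>a c. 1 \<le> a \<longrightarrow> a < c \<longrightarrow> c \<le> n \<longrightarrow> inversions z c a = hi (face_routes w A) c a"
    using ex_maximal[OF C] by blast
  then have z_eq: "add_ascents s w A = z" by (intro add_ascents_eq[OF w A]) auto
  have "weak_le s w y \<and> weak_le s y z \<longleftrightarrow> face_routes w A \<subseteq> perm_routes y" if "y \<in> SP" for y
    unfolding subset_perm_routes_iff[OF C that] weak_le_def
    using z(2) inversions_eq_lo[OF w A] by auto
  then show ?thesis
    unfolding z_eq weak_interval_def by blast
qed

text \<open>The interval of \<open>(w, A)\<close> contains \<open>w\<close> and its transpositions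
  along \<open>A\<close>, whose route sets already intersect in
  \<open>face_routes w A\<close>.\<close>

lemma face_le_iff:
  assumes "w \<in> SP" "A \<subseteq> ascents w" "w' \<in> SP" "A' \<subseteq> ascents w'"
  shows "face_le s (w, A) (w', A') \<longleftrightarrow> face_routes w' A' \<subseteq> face_routes w A"
proof -
  have "face_le s (w, A) (w', A') \<longleftrightarrow>
    {y \<in> SP. face_routes w A \<subseteq> perm_routes y} \<subseteq> {y \<in> SP. face_routes w' A' \<subseteq> perm_routes y}"
    by (simp only: face_le_def split weak_interval_eq assms)
  also have "\<dots> \<longleftrightarrow> face_routes w' A' \<subseteq> face_routes w A"
  proof
    assume sub: "{y \<in> SP. face_routes w A \<subseteq> perm_routes y} \<subseteq> {y \<in> SP. face_routes w' A' \<subseteq> perm_routes y}"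
    have "face_routes w' A' \<subseteq> perm_routes w" using sub face_routes_subset assms(1) by blast
    moreover have "face_routes w' A' \<subseteq> perm_routes (transposition w x)" if x: "x \<in> A" for x
    proof -
      have "transposition w x \<in> SP"
        by (rule ascent_position[OF assms(2) x]) (use transposition_in_SP[OF assms(1)] in simp)
      moreover have "face_routes w A \<subseteq> perm_routes (transposition w x)"
        using face_routes_eq_Int[OF assms(1,2)] x by blast
      ultimately show ?thesis using sub by blast
    qed
    ultimately show "face_routes w' A' \<subseteq> face_routes w A"
      unfolding face_routes_eq_Int[OF assms(1,2)] by blast
  qed blast
  finally show ?thesis .
qed

text \<open>The lower bounds of the route set are the inversion numbers of \<open>w\<close>; the
  missing cuts then give \<open>A\<close>.\<close>

lemma face_routes_inj:
  assumes w: "w \<in> SP" and A: "A \<subseteq> ascents w" and w': "w' \<in> SP" and A': "A' \<subseteq> ascents w'"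
    and eq: "face_routes w A = face_routes w' A'"
  shows "w = w' \<and> A = A'"
proof -
  have "weak_le s w w'" "weak_le s w' w"
    unfolding weak_le_def using inversions_eq_lo[OF w A] inversions_eq_lo[OF w' A'] eq by auto
  then have ww': "w = w'" by (rule weak_le_antisym[OF w w'])
  have "A \<subseteq> B" if A: "A \<subseteq> ascents w" and eq: "face_routes w A = face_routes w B" for A B
  proof
    fix x assume x: "x \<in> A"
    obtain i where i: "0 < i" "i < length w" "x = (w ! (i - 1), w ! i)" "w ! (i - 1) < w ! i"
      using ascent_position[OF A x] .
    have "prefix_route s (take i w) \<notin> face_routes w A"
    proof
      assume "prefix_route s (take i w) \<in> face_routes w A"
      then obtain j where j: "prefix_route s (take i w) = prefix_route s (take j w)" "kept w A j"
        unfolding face_routes_def by blast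
      then have "i = j" using i by (intro prefix_route_inj[OF w]) (auto simp: kept_def)
      with j i x show False by (simp add: kept_def)
    qed
    then have "prefix_route s (take i w) \<notin> face_routes w B" by (simp add: eq)
    then have "\<not> kept w B i" by (auto simp: face_routes_def)
    with i show "x \<in> B" by (auto simp: kept_def)
  qed
  from this[OF A, of A'] this[of A' A] A' eq ww' show ?thesis by auto
qed

lemma covering_chain_is_face:
  assumes C: "chain C" "covering C"
  shows "\<exists>w A. w \<in> SP \<and> A \<subseteq> ascents w \<and> face_routes w A = C"
proof -
  have Cr: "Q \<in> routes s" if "Q \<in> C" for Q using that chain_routes[OF C(1)] by blast
  obtain w where w: "w \<in> SP"
    and inv: "\<forall>a c. 1 \<le> a \<longrightarrow> a < c \<longrightarrow> c \<le> n \<longrightarrow> inversions w c a = lo C c a"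
    using ex_minimal[OF C] by blast
  have sub: "C \<subseteq> perm_routes w"
    unfolding subset_perm_routes_iff[OF C w] using inv lo_le_hi[OF C] by auto
  have nw: "nested w" using stirling_nested[OF w] .
  define A where "A = {(w ! (i - 1), w ! i) | i. 0 < i \<and> i < length w \<and> prefix_route s (take i w) \<notin> C}"
  have asc: "w ! (i - 1) < w ! i" if i: "0 < i" "i < length w" "prefix_route s (take i w) \<notin> C" for i
  proof (rule ccontr)
    assume "\<not> ?thesis"
    then have le: "w ! i \<le> w ! (i - 1)" by simp
    define b where "b = w ! (i - 1)"
    define t where "t = count_list (take i w) b"
    obtain i' where i': "i = Suc i'" using i by (cases i) auto
    have b: "1 \<le> b" "b \<le> n" using stirling_nth[OF w, of "i - 1"] i unfolding b_def by auto
    have t: "count_list (take i' w) b < t"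
      using i i' unfolding t_def b_def by (simp add: count_list_take_Suc)
    have before_i: "i \<le> j" if "count_list (take j w) b = t" for j
    proof (rule ccontr)
      assume "\<not> i \<le> j"
      then have "j \<le> i'" using i' by simp
      from count_list_take_mono[OF this, of w b] t that show False by simp
    qed
    show False
    proof (cases "w ! i = b")
      case True
      have t_lt: "t < part s b"
      proof -
        have "t < count_list (take (Suc i) w) b" using i True by (simp add: count_list_take_Suc t_def)
        also have "\<dots> \<le> part s b" using count_list_take_le stirling_count[OF w b] by metis
        finally show ?thesis .
      qed
      \<comment> \<open>Between two adjacent copies of \<open>b\<close> the count \<open>t\<close>
        determines the cut, so the route of \<open>C\<close> covering the edge \<open>(b, t)\<close>
        is the route of this cut.\<close>
      obtain Q where Q: "Q \<in> C" "b \<le> length Q" "val Q b = t"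
        using coveringE[OF C(2) chain_routes[OF C(1)] b, of t] t_lt by auto
      obtain j where j: "Q = prefix_route s (take j w)" "j \<le> length w"
        using Q(1) sub unfolding perm_routes_def by blast
      have tj: "count_list (take j w) b = t"
        using val_prefix_route'[OF w b(1) _ b(2), of j] Q j by simp
      have "j \<le> i"
      proof (rule ccontr)
        assume "\<not> j \<le> i"
        then have "count_list (take (Suc i) w) b \<le> count_list (take j w) b"
          by (intro count_list_take_mono) simp
        with tj i True show False by (simp add: count_list_take_Suc t_def)
      qed
      with before_i[OF tj] Q j i show False by simp
    next
      case False
      define a where "a = w ! i"
      have ab: "1 \<le> a" "a < b" using stirling_nth[OF w i(2)] le False unfolding a_def b_def by auto
      have split: "w = take i' w @ b # drop i w"
        using i i' unfolding b_def by (simp add: id_take_nth_drop)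
      have "a \<in> set (drop i w)"
        using i unfolding a_def by (metis Cons_nth_drop_Suc list.set_intros(1))
      then have "a \<notin> set (take i' w)" using nestedD[OF nw split ab(2)] by blast
      then have a_not: "a \<notin> set (take i w)"
        using i i' ab unfolding b_def by (simp add: take_Suc_conv_app_nth)
      have aw: "a \<in> set w" using i unfolding a_def by simp
      have a_Suc: "a \<in> set (take (Suc i) w)" using i unfolding a_def by (simp add: take_Suc_conv_app_nth)
      have "t \<le> inversions w b a" unfolding t_def by (rule count_le_inversions[OF aw a_not])
      moreover have "inversions w b a \<le> t"
        using inversions_le_count_take[OF a_Suc, of b] i ab unfolding t_def
        by (simp add: count_list_take_Suc a_def)
      \<comment> \<open>At a descent the cut lies just before the first \<open>a\<close>, after
        \<open>t\<close> letters \<open>b\<close>. As \<open>w\<close> attains the lower bounds,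
        some route of \<open>C\<close> avoids \<open>a\<close> and has \<open>t\<close> letters
        \<open>b\<close>, which pins down the same cut.\<close>
      ultimately have "lo C b a = t" using inv ab b(2) by simp
      then obtain Q where Q: "Q \<in> C" "b \<le> length Q" "val Q a = 0" "val Q b = t"
        using lo_attained[OF C ab b(2)] by metis
      obtain j where j: "Q = prefix_route s (take j w)" "j \<le> length w"
        using Q(1) sub unfolding perm_routes_def by blast
      have cj: "count_list (take j w) a = 0" "count_list (take j w) b = t"
        using val_prefix_route'[OF w ab(1), of j] val_prefix_route'[OF w b(1), of j] Q j ab b by auto
      have "j \<le> i"
      proof (rule ccontr)
        assume "\<not> j \<le> i"
        then have "set (take (Suc i) w) \<subseteq> set (take j w)" by (intro set_take_subset_set_take) simp
        with a_Suc cj show False by (auto simp: count_list_0_iff)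
      qed
      with before_i[OF cj(2)] Q j i show False by simp
    qed
  qed
  have A: "A \<subseteq> ascents w"
    unfolding A_def using asc by (auto simp: ascents_iff)
  moreover have "face_routes w A = C"
  proof (intro equalityI subsetI)
    fix Q assume "Q \<in> face_routes w A"
    then obtain i where i: "Q = prefix_route s (take i w)" "kept w A i" unfolding face_routes_def by blast
    have "i \<le> length w" using i(2) by (simp add: kept_def)
    \<comment> \<open>The end cuts are no ascents; their routes are those given by
      \<open>chain_bottom\<close> and \<open>chain_top\<close>.\<close>
    then consider "i = 0" | "i = length w" | "0 < i" "i < length w" by linarith
    then show "Q \<in> C"
    proof cases
      case 1
      obtain R where R: "R \<in> C" "\<forall>i. 1 \<le> i \<and> i \<le> n \<longrightarrow> val R i = 0"
        using chain_bottom[OF C] by blast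
      have "prefix_route s (take i w) = R"
        by (rule prefix_route_eqI'[OF w Cr[OF R(1)]]) (use R 1 in auto)
      with i R show ?thesis by simp
    next
      case 2
      obtain R where R: "R \<in> C" "\<forall>i. 1 \<le> i \<and> i \<le> n \<longrightarrow> val R i = part s i"
        using chain_top[OF C] by blast
      have "prefix_route s (take i w) = R"
        by (rule prefix_route_eqI'[OF w Cr[OF R(1)]]) (use R 2 stirling_count[OF w] in auto)
      with i R show ?thesis by simp
    next
      case 3
      then show ?thesis using i unfolding kept_def A_def by blast
    qed
  next
    fix Q assume Q: "Q \<in> C"
    then obtain i where i: "Q = prefix_route s (take i w)" "i \<le> length w"
      using sub unfolding perm_routes_def by blast
    have "kept w A i"
    proof (rule ccontr)
      assume "\<not> ?thesis"
      then have k: "0 < i" "i < length w" "(w ! (i - 1), w ! i) \<in> A" using i by (auto simp: kept_def)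
      then obtain j where j: "0 < j" "j < length w" "prefix_route s (take j w) \<notin> C"
        "w ! (j - 1) = w ! (i - 1)" "w ! j = w ! i"
        unfolding A_def by auto
      \<comment> \<open>The pair of letters occurs at one cut only, so a cut dropped because of its
        letters is itself one whose route is missing from \<open>C\<close>.\<close>
      have "j = i"
        by (rule ascent_position_unique[OF nw asc[OF j(1-3)]]) (use j k in auto)
      with j Q i show False by simp
    qed
    with i show "Q \<in> face_routes w A" unfolding face_routes_def by blast
  qed
  ultimately show ?thesis using w by blast
qed

section \<open>The isomorphism of posets\<close>

lemma face_simplex_bij: "bij_betw (face_simplex s) (faces s) (interior_simplices s)"
proof (rule bij_betw_imageI)
  show "inj_on (face_simplex s) (faces s)"
  proof (rule inj_onI, clarify)
    fix w A w' A' assume "(w, A) \<in> faces s" "(w', A') \<in> faces s"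
      and eq: "face_simplex s (w, A) = face_simplex s (w', A')"
    then have *: "w \<in> SP" "A \<subseteq> ascents w" "w' \<in> SP" "A' \<subseteq> ascents w'" by (auto simp: faces_def)
    note ch = face_routes_chain[OF *(1), of A] face_routes_chain[OF *(3), of A']
    have "face_routes w A = face_routes w' A'"
      using eq hull_subset_iff[OF chain_routes[OF ch(1)] ch(2)] hull_subset_iff[OF chain_routes[OF ch(2)] ch(1)]
      unfolding face_simplex_eq[OF *(1,2)] face_simplex_eq[OF *(3,4)] by auto
    with face_routes_inj * show "w = w' \<and> A = A'" by blast
  qed
  show "face_simplex s ` faces s = interior_simplices s"
  proof (intro equalityI subsetI)
    fix \<sigma> assume "\<sigma> \<in> face_simplex s ` faces s"
    then obtain w A where *: "w \<in> SP" "A \<subseteq> ascents w" "\<sigma> = face_simplex s (w, A)"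
      by (auto simp: faces_def)
    note ch = face_routes_chain[OF *(1), of A] face_routes_covering[OF *(1,2)]
    show "\<sigma> \<in> interior_simplices s"
      unfolding interior_simplices_eq *(3) face_simplex_eq[OF *(1,2)]
      using ch covering_nonempty[OF ch(2)] by blast
  next
    fix \<sigma> assume "\<sigma> \<in> interior_simplices s"
    then obtain C where C: "\<sigma> = convex hull (route_vector ` C)" "chain C" "covering C"
      unfolding interior_simplices_eq by blast
    obtain w A where *: "w \<in> SP" "A \<subseteq> ascents w" "face_routes w A = C"
      using covering_chain_is_face[OF C(2,3)] by blast
    then have "\<sigma> = face_simplex s (w, A)" using C(1) face_simplex_eq by simp
    moreover have "(w, A) \<in> faces s" using * by (simp add: faces_def)
    ultimately show "\<sigma> \<in> face_simplex s ` faces s" by blast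
  qed
qed

lemma face_le_iff_simplex_subset:
  assumes "F \<in> faces s" "G \<in> faces s"
  shows "face_le s F G \<longleftrightarrow> face_simplex s G \<subseteq> face_simplex s F"
proof -
  obtain w A w' A' where F: "F = (w, A)" "G = (w', A')" by (cases F, cases G) auto
  then have *: "w \<in> SP" "A \<subseteq> ascents w" "w' \<in> SP" "A' \<subseteq> ascents w'"
    using assms by (auto simp: faces_def)
  show ?thesis
    unfolding F face_le_iff[OF *] face_simplex_eq[OF *(1,2)] face_simplex_eq[OF *(3,4)]
    using hull_subset_iff[OF chain_routes[OF face_routes_chain[OF *(3)]] face_routes_chain[OF *(1)]]
    by simp
qed

end

theorem theorem6p20:
  fixes s :: "nat list"
  assumes "\<forall>x\<in>set s. 0 < x"
  shows "bij_betw (face_simplex s) (faces s) (interior_simplices s) \<and>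
         (\<forall>F\<in>faces s. \<forall>G\<in>faces s.
            face_le s F G \<longleftrightarrow> face_simplex s G \<subseteq> face_simplex s F)"
proof -
  interpret composition s using assms by unfold_locales
  show ?thesis using face_simplex_bij face_le_iff_simplex_subset by blast
qed

end
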